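(* Suppose (A1) and (A2) of the context hold. Run the 0-PGD algorithm with minibatch gradient estimation described in the context, with stepsize $\gamma=\frac{\delta}{cG\sqrt d}$ and constant batchsize $B_t\equiv B$. Then the output $x_{\widetilde T}$ has the following convergence rate: $$\mathbb{E}\big[\|\mathcal{G}_{\gamma h}(x_{\widetilde T},\nabla F_\delta(x_{\widetilde T}))\|\big]\le\frac{\sqrt{2cG}\,d^{1/4}}{\sqrt{T\delta}}\sqrt{\mathbb{E}[\phi(x_0)]-\phi_{\min}+2\delta G}+\frac{16G\sqrt d}{\sqrt B},$$ where $\phi_{\min}=\min_{x\in\mathbb{R}^d}[F(x)+h(x)]$. Furthermore, one can obtain a $(\gamma,\delta,\epsilon)$-PGSP by using the hyperparameters $$T=\frac{8cG\sqrt d}{\delta\epsilon^2}\big[\mathbb{E}[\phi(x_0)]-\phi_{\min}+2\delta G\big]=\mathcal{O}(Gd^{1/2}\delta^{-1}\epsilon^{-2}),\qquad B=\frac{1024\,dG^2}{\epsilon^2}=\mathcal{O}(G^2d\epsilon^{-2}),$$ which requires at most $2TB=\mathcal{O}(G^3d^{3/2}\delta^{-1}\epsilon^{-4})$ function evaluations and $T=\mathcal{O}(Gd^{1/2}\delta^{-1}\epsilon^{-2})$ proximal updates.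
   Context: Problem: $\min_{x\in\mathbb{R}^d}\phi(x):=F(x)+h(x)$, where $F(x)=\mathbb{E}_{\xi\sim\mathcal{P}}[f_\xi(x)]$. (A1) For any stochastic sample $\xi$, $f_\xi:\mathbb{R}^d\to\mathbb{R}$ is $L_\xi$-Lipschitz continuous for some $L_\xi>0$, and $\mathbb{E}_\xi[L_\xi^2]\le G^2$ for some $G>0$. (Hence $F$ is $G$-Lipschitz.) (A2) $h:\mathbb{R}^d\to\mathbb{R}\cup\{+\infty\}$ is a proper closed convex function with at least one feasible point $x^{(h)}\in\mathbb{R}^d$ such that $h(x^{(h)})<+\infty$. Smoothing with radius $\delta>0$: $F_\delta(x)=\mathbb{E}_u[F(x+\delta u)]$ with $u$ uniformly distributed on the unit sphere $\{u\in\mathbb{R}^d:\|u\|=1\}$. $c>0$ is the absolute constant in the property, quoted in the paper from the literature, that for any $G$-Lipschitz $F$ the function $F_\delta$ is differentiable everywhere with $\frac{cG\sqrt d}{\delta}$-Lipschitz continuous gradient. Clarke subdifferential: $\partial F(x)=\{g\in\mathbb{R}^d:\langle g,v\rangle\le \limsup_{y\to x,\,t\downarrow0}\frac{F(y+tv)-F(y)}{t}\ \forall v\in\mathbb{R}^d\}$. Goldstein $\delta$-subdifferential: $\partial_\delta F(x)={\rm conv}\big[\bigcup_{\|y-x\|\le\delta}\partial F(y)\big]$. Proximal operator: ${\rm prox}_{\gamma h}(x)=\arg\min_y[h(y)+\frac1{2\gamma}\|y-x\|^2]$. Proximal gradient mapping: $\mathcal{G}_{\gamma h}(x,g)=\frac1\gamma[x-{\rm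 prox}_{\gamma h}(x-\gamma g)]$. A point $x\in\mathbb{R}^d$ is a $(\gamma,\delta,\epsilon)$-proximal Goldstein stationary point (PGSP) if $\min_{g\in\partial_\delta F(x)}\|\mathcal{G}_{\gamma h}(x,g)\|\le\epsilon$. Two-point estimator: $\hat g_\delta(x;u,\xi)=\frac{d}{2\delta}[f_\xi(x+\delta u)-f_\xi(x-\delta u)]u$. 0-PGD (zeroth-order proximal gradient descent) algorithm with minibatch gradient estimation: initialize $x_0\in\mathbb{R}^d$. For $t=0,\dots,T-1$: obtain i.i.d. samples $u_{1,t},\dots,u_{B_t,t}$ uniform on the unit sphere and i.i.d. samples $\xi_{1,t},\dots,\xi_{B_t,t}\sim\mathcal{P}$; set $g_t=\frac1{B_t}\sum_{i=1}^{B_t}\hat g_\delta(x_t;u_{i,t},\xi_{i,t})$; make the proximal update $x_{t+1}={\rm prox}_{\gamma h}(x_t-\gamma g_t)$. Output $x_{\widetilde T}$ with $\widetilde T$ uniformly random in $\{0,\dots,T-1\}$.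
   Formalization: F_δ averages over the unit ball (estimator directions stay on the sphere): with the sphere average no constant c exists, since F(x)=|‖x‖−δ| is 1-Lipschitz but its F_δ is not differentiable at 0. T and B are rounded up to integers. *)

theory Defs
  imports "HOL-Probability.Probability" "HOL-Library.Landau_Symbols"
begin

section \<open>Uniform distributions and randomized smoothing\<close>

definition unif_ball :: "'a::euclidean_space measure" where
  "unif_ball = uniform_measure lborel (cball 0 1)"

text \<open>The normalized (rotation invariant) surface measure of the unit sphere, obtained as the law
  of the direction \<open>u / norm u\<close> of a uniformly distributed point \<open>u\<close> of the unit ball.\<close>

definition unif_sphere :: "'a::euclidean_space measure" where
  "unif_sphere = distr unif_ball borel sgn"

definition smoothing :: "'a::euclidean_space measure \<Rightarrow> real \<Rightarrow> ('a \<Rightarrow> real) \<Rightarrow> 'a \<Rightarrow> real" where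
  "smoothing \<nu> \<delta> F x = (\<integral>u. F (x + \<delta> *\<^sub>R u) \<partial>\<nu>)"

definition gradient :: "('a::real_inner \<Rightarrow> real) \<Rightarrow> 'a \<Rightarrow> 'a" where
  "gradient F x = (THE D. GDERIV F x :> D)"

text \<open>The smoothness property of the smoothed function in which the constant \<open>c\<close> occurs. The
  dimension is \<open>DIM('a)\<close>; a constant that works in every dimension works in this one.

  The smoothing distribution \<open>\<nu>\<close> is a parameter because the two uniform distributions behave
  differently. For \<open>\<nu> = unif_sphere\<close> no \<open>c\<close> has the property: the average over the sphere of
  \<open>F x = \<bar>norm x - \<delta>\<bar>\<close> has a conical singularity at \<open>0\<close>. For \<open>\<nu> = unif_ball\<close> it is the
  standard smoothing lemma, and the two-point estimator, whose directions are always uniform on the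
  sphere, is unbiased for the gradient of the smoothed function.\<close>

definition smoothing_constant :: "'a::euclidean_space measure \<Rightarrow> real \<Rightarrow> bool" where
  "smoothing_constant \<nu> c \<longleftrightarrow> c > 0 \<and>
     (\<forall>G>0. \<forall>\<delta>>0. \<forall>F :: 'a \<Rightarrow> real. G-lipschitz_on UNIV F \<longrightarrow>
        (\<forall>x. smoothing \<nu> \<delta> F differentiable (at x)) \<and>
        (c * G * sqrt (real DIM('a)) / \<delta>)-lipschitz_on UNIV (gradient (smoothing \<nu> \<delta> F)))"


section \<open>Proper closed convex functions and the proximal operator\<close>

definition epi :: "('a \<Rightarrow> ereal) \<Rightarrow> ('a \<times> real) set" where
  "epi h = {(x, r). h x \<le> ereal r}"

definition proper_closed_convex :: "('a::euclidean_space \<Rightarrow> ereal) \<Rightarrow> bool" where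
  "proper_closed_convex h \<longleftrightarrow>
     (\<forall>x. h x \<noteq> -\<infinity>) \<and> (\<exists>x. h x < \<infinity>) \<and> closed (epi h) \<and> convex (epi h)"

definition prox :: "real \<Rightarrow> ('a::euclidean_space \<Rightarrow> ereal) \<Rightarrow> 'a \<Rightarrow> 'a" where
  "prox \<gamma> h x = (ARG_MIN (\<lambda>y. h y + ereal (1 / (2 * \<gamma>) * (norm (y - x))\<^sup>2)) y. True)"

definition grad_map :: "real \<Rightarrow> ('a::euclidean_space \<Rightarrow> ereal) \<Rightarrow> 'a \<Rightarrow> 'a \<Rightarrow> 'a" where
  "grad_map \<gamma> h x g = (1 / \<gamma>) *\<^sub>R (x - prox \<gamma> h (x - \<gamma> *\<^sub>R g))"


section \<open>Goldstein stationarity\<close>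

definition clarke_subdiff :: "('a::euclidean_space \<Rightarrow> real) \<Rightarrow> 'a \<Rightarrow> 'a set" where
  "clarke_subdiff F x = {g. \<forall>v.
     ereal (g \<bullet> v) \<le> Limsup (nhds x \<times>\<^sub>F at_right 0) (\<lambda>(y, t). ereal ((F (y + t *\<^sub>R v) - F y) / t))}"

definition goldstein_subdiff :: "real \<Rightarrow> ('a::euclidean_space \<Rightarrow> real) \<Rightarrow> 'a \<Rightarrow> 'a set" where
  "goldstein_subdiff \<delta> F x = convex hull (\<Union>y \<in> cball x \<delta>. clarke_subdiff F y)"

text \<open>Minimum at most \<open>\<epsilon>\<close>: the minimum is attained because \<open>goldstein_subdiff \<delta> F x\<close> is compact for
  Lipschitz \<open>F\<close> and \<open>grad_map \<gamma> h x\<close> is continuous.\<close>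

definition PGSP ::
  "('a::euclidean_space \<Rightarrow> real) \<Rightarrow> ('a \<Rightarrow> ereal) \<Rightarrow> real \<Rightarrow> real \<Rightarrow> real \<Rightarrow> 'a \<Rightarrow> bool" where
  "PGSP F h \<gamma> \<delta> \<epsilon> x \<longleftrightarrow> (\<exists>g \<in> goldstein_subdiff \<delta> F x. norm (grad_map \<gamma> h x g) \<le> \<epsilon>)"

text \<open>The quantity that \<open>PGSP\<close> compares with \<open>\<epsilon>\<close>; the infimum over the empty set would be \<open>\<infinity>\<close>.\<close>

definition pgs_residual ::
  "('a::euclidean_space \<Rightarrow> real) \<Rightarrow> ('a \<Rightarrow> ereal) \<Rightarrow> real \<Rightarrow> real \<Rightarrow> 'a \<Rightarrow> ennreal" where
  "pgs_residual F h \<gamma> \<delta> x = (INF g \<in> goldstein_subdiff \<delta> F x. ennreal (norm (grad_map \<gamma> h x g)))"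


section \<open>The algorithm, with its oracle calls counted\<close>

text \<open>A value together with the number of function evaluations and of proximal updates spent
  on computing it.\<close>

type_synonym 'r costed = "'r \<times> nat \<times> nat"

definition ret :: "'r \<Rightarrow> 'r costed" where
  "ret r = (r, 0, 0)"

definition bindc :: "'r costed \<Rightarrow> ('r \<Rightarrow> 's costed) \<Rightarrow> 's costed" where
  "bindc m k = (case m of (r, a, p) \<Rightarrow> case k r of (s, b, q) \<Rightarrow> (s, a + b, p + q))"

abbreviation val :: "'r costed \<Rightarrow> 'r" where "val m \<equiv> fst m"
abbreviation fevals :: "'r costed \<Rightarrow> nat" where "fevals m \<equiv> fst (snd m)"
abbreviation prox_updates :: "'r costed \<Rightarrow> nat" where "prox_updates m \<equiv> snd (snd m)"

definition call_fun :: "('a \<Rightarrow> real) \<Rightarrow> 'a \<Rightarrow> real costed" where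
  "call_fun \<phi> y = (\<phi> y, 1, 0)"

definition call_prox :: "real \<Rightarrow> ('a::euclidean_space \<Rightarrow> ereal) \<Rightarrow> 'a \<Rightarrow> 'a costed" where
  "call_prox \<gamma> h y = (prox \<gamma> h y, 0, 1)"

definition two_point :: "real \<Rightarrow> ('a::euclidean_space \<Rightarrow> real) \<Rightarrow> 'a \<Rightarrow> 'a \<Rightarrow> 'a costed" where
  "two_point \<delta> \<phi> x u =
     bindc (call_fun \<phi> (x + \<delta> *\<^sub>R u)) (\<lambda>a.
     bindc (call_fun \<phi> (x - \<delta> *\<^sub>R u)) (\<lambda>b.
     ret ((real DIM('a) / (2 * \<delta>) * (a - b)) *\<^sub>R u)))"

primrec sum_costed :: "(nat \<Rightarrow> 'a::comm_monoid_add costed) \<Rightarrow> nat \<Rightarrow> 'a costed" where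
  "sum_costed m 0 = ret 0"
| "sum_costed m (Suc n) = bindc (sum_costed m n) (\<lambda>s. bindc (m n) (\<lambda>g. ret (s + g)))"

definition minibatch ::
  "('s \<Rightarrow> 'a::euclidean_space \<Rightarrow> real) \<Rightarrow> real \<Rightarrow> nat \<Rightarrow> (nat \<Rightarrow> 'a \<times> 's) \<Rightarrow> 'a \<Rightarrow> 'a costed" where
  "minibatch f \<delta> B w x =
     bindc (sum_costed (\<lambda>i. case w i of (u, \<xi>) \<Rightarrow> two_point \<delta> (f \<xi>) x u) B) (\<lambda>s.
     ret ((1 / real B) *\<^sub>R s))"

text \<open>\<open>w (t, i)\<close> is the \<open>i\<close>-th pair (direction, stochastic sample) drawn in iteration \<open>t\<close>.\<close>

primrec zo_pgd ::
  "('s \<Rightarrow> 'a::euclidean_space \<Rightarrow> real) \<Rightarrow> ('a \<Rightarrow> ereal) \<Rightarrow> real \<Rightarrow> real \<Rightarrow> nat \<Rightarrow>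
   'a \<Rightarrow> (nat \<times> nat \<Rightarrow> 'a \<times> 's) \<Rightarrow> nat \<Rightarrow> 'a costed" where
  "zo_pgd f h \<gamma> \<delta> B x0 w 0 = ret x0"
| "zo_pgd f h \<gamma> \<delta> B x0 w (Suc t) =
     bindc (zo_pgd f h \<gamma> \<delta> B x0 w t) (\<lambda>x.
     bindc (minibatch f \<delta> B (\<lambda>i. w (t, i)) x) (\<lambda>g.
     call_prox \<gamma> h (x - \<gamma> *\<^sub>R g)))"

lemma val_bindc [simp]: "val (bindc m k) = val (k (val m))"
  and val_ret [simp]: "val (ret r) = r"
  by (simp_all add: bindc_def ret_def split: prod.splits)

lemma val_sum_costed: "val (sum_costed m n) = (\<Sum>i<n. val (m i))"
  by (induction n) simp_all

lemma val_zo_pgd_Suc: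
  fixes f :: "'s \<Rightarrow> 'a::euclidean_space \<Rightarrow> real" and \<delta> :: real
  defines "ghat \<equiv> \<lambda>x u \<xi>. (real DIM('a) / (2 * \<delta>) * (f \<xi> (x + \<delta> *\<^sub>R u) - f \<xi> (x - \<delta> *\<^sub>R u))) *\<^sub>R u"
  shows "val (zo_pgd f h \<gamma> \<delta> B x0 w (Suc t)) =
    (let x = val (zo_pgd f h \<gamma> \<delta> B x0 w t);
         g = (1 / real B) *\<^sub>R (\<Sum>i<B. ghat x (fst (w (t, i))) (snd (w (t, i))))
     in prox \<gamma> h (x - \<gamma> *\<^sub>R g))"
  by (simp add: ghat_def Let_def minibatch_def val_sum_costed call_prox_def two_point_def
      call_fun_def split_def)

text \<open>The joint law of the initial point (with law \<open>\<mu>0\<close>), of all the pairs of direction and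
  stochastic sample, and of the uniformly random output index; all of them are independent.\<close>

definition run_space ::
  "'a::euclidean_space measure \<Rightarrow> 's measure \<Rightarrow> nat \<Rightarrow> nat \<Rightarrow>
   ('a \<times> (nat \<times> nat \<Rightarrow> 'a \<times> 's) \<times> nat) measure" where
  "run_space \<mu>0 P T B =
     \<mu>0 \<Otimes>\<^sub>M (\<Pi>\<^sub>M j \<in> {..<T} \<times> {..<B}. unif_sphere \<Otimes>\<^sub>M P) \<Otimes>\<^sub>M uniform_count_measure {..<T}"

definition zo_pgd_output ::
  "('s \<Rightarrow> 'a::euclidean_space \<Rightarrow> real) \<Rightarrow> ('a \<Rightarrow> ereal) \<Rightarrow> real \<Rightarrow> real \<Rightarrow> nat \<Rightarrow>
   'a \<times> (nat \<times> nat \<Rightarrow> 'a \<times> 's) \<times> nat \<Rightarrow> 'a" where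
  "zo_pgd_output f h \<gamma> \<delta> B = (\<lambda>(x0, w, k). val (zo_pgd f h \<gamma> \<delta> B x0 w k))"


section \<open>Hyperparameters and their asymptotic regime\<close>

text \<open>Here \<open>\<Delta>\<close> stands for the initial gap between the expected and the minimal objective value. The
  real-valued formulas are rounded up to integers.\<close>

definition hyper_T :: "real \<Rightarrow> real \<Rightarrow> nat \<Rightarrow> real \<Rightarrow> real \<Rightarrow> real \<Rightarrow> nat" where
  "hyper_T c G d \<delta> \<epsilon> \<Delta> = nat \<lceil>8 * c * G * sqrt (real d) / (\<delta> * \<epsilon>\<^sup>2) * (\<Delta> + 2 * \<delta> * G)\<rceil>"

definition hyper_B :: "real \<Rightarrow> nat \<Rightarrow> real \<Rightarrow> nat" where
  "hyper_B G d \<epsilon> = nat \<lceil>1024 * real d * G\<^sup>2 / \<epsilon>\<^sup>2\<rceil>"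

text \<open>Landau symbols over the filter \<open>principal (regime D)\<close> are uniform over all parameters
  \<open>(G, d, \<delta>, \<epsilon>, \<Delta>)\<close> in \<open>regime D\<close>: the implied constant may depend only on \<open>D\<close> (a bound on the
  bracket \<open>\<Delta> + 2 * \<delta> * G\<close>) and on the absolute constant \<open>c\<close>. The last two conditions say that the
  asymptotic rates of \<open>T\<close> and \<open>B\<close> are at least 1, so that rounding up is harmless.\<close>

definition regime :: "real \<Rightarrow> (real \<times> nat \<times> real \<times> real \<times> real) set" where
  "regime D = {(G, d, \<delta>, \<epsilon>, \<Delta>). G > 0 \<and> d \<ge> 1 \<and> \<delta> > 0 \<and> \<epsilon> > 0 \<and> \<Delta> \<ge> 0 \<and> \<Delta> + 2 * \<delta> * G \<le> D \<and>
     G * sqrt (real d) / (\<delta> * \<epsilon>\<^sup>2) \<ge> 1 \<and> G\<^sup>2 * real d / \<epsilon>\<^sup>2 \<ge> 1}"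

end

theory Submission
  imports Defs "HOL-Real_Asymp.Real_Asymp"
begin

text \<open>The smoothed objective \<open>F\<^sub>\<delta> + h\<close> decreases along proximal steps, up to the error of the stochastic
  gradient. If \<open>g\<close> replaces the gradient at \<open>x\<close>, if \<open>e\<close> is the norm of the error and \<open>D\<close> the decrease of
  \<open>F\<^sub>\<delta> + h\<close>, then smoothness of \<open>F\<^sub>\<delta>\<close> with constant \<open>1 / \<gamma>\<close> and the three-point inequality of the
  proximal operator give \<open>norm (grad_map \<gamma> h x (\<nabla>F\<^sub>\<delta> x)) \<le> 2 * e + sqrt (2 * D / \<gamma> + e\<^sup>2)\<close>
  (\<open>prox_step\<close>). In this form the decrease enters with the same constant as in the deterministic
  analysis. Averaging over the iterations telescopes the decreases, and Jensen's inequality turns a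
  bound on \<open>\<sigma>\<^sup>2 = E e\<^sup>2\<close> into the convergence rate with noise term \<open>3 * \<sigma>\<close> (\<open>average_bound\<close>).

  The noise term has to be of order \<open>G * sqrt (d / B)\<close>, so the two-point estimator must be unbiased
  and have a second moment of order \<open>d * G\<^sup>2\<close>, whereas the Lipschitz property alone gives
  \<open>d\<^sup>2 * G\<^sup>2\<close>.

  Unbiasedness is the divergence theorem for a ball and a Lipschitz integrand. It is obtained by
  smoothing with a continuous radial cutoff instead of the indicator of the ball: the derivative then
  falls on the cutoff, whose gradient is supported on a thin shell, and the shell contracts to the
  sphere (\<open>ball_average_deriv\<close>, \<open>GDERIV_smoothing_unif_ball\<close>).

  The second moment is a concentration property of the sphere
  (\<open>sphere_two_point_second_moment\<close>). A Gaussian vector has a uniformly distributed direction and,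
  after division by \<open>sqrt d\<close>, a norm close to \<open>1\<close>, so the sphere may be replaced by a Gaussian vector
  \<open>X\<close>. For an independent copy \<open>Y\<close> the path \<open>cos t * X + sin t * Y\<close> joins \<open>X\<close> to \<open>- X\<close>, and at each time
  its position and velocity are again two independent Gaussian vectors. Hence the derivative of the
  function along the path has second moment at most \<open>L\<^sup>2\<close>, and the antipodal difference at most
  \<open>\<pi>\<^sup>2 * L\<^sup>2\<close> (\<open>antipodal_gaussian_bound\<close>).

  The gradient of the smoothed function lies in the Goldstein subdifferential because otherwise a
  hyperplane would separate the two, while the directional derivative of an average of \<open>F\<close> over a ball
  is at most the largest Clarke derivative on that ball
  (\<open>gradient_smoothing_in_goldstein\<close>). Averages over the sphere do not have the required
  smoothness in any dimension (\<open>not_smoothing_constant_unif_sphere\<close>), so that case of the theorem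
  is vacuous.\<close>


section \<open>Uniform distributions on the ball and the sphere\<close>

lemma borel_cball [measurable]: "cball x r \<in> sets borel"
  by simp

lemma nn_integral_lborel_affine:
  fixes f :: "'a::euclidean_space \<Rightarrow> ennreal"
  assumes [measurable]: "f \<in> borel_measurable borel" and "c \<noteq> 0"
  shows "(\<integral>\<^sup>+x. f x \<partial>lborel) = ennreal (\<bar>c\<bar> ^ DIM('a)) * (\<integral>\<^sup>+x. f (t + c *\<^sub>R x) \<partial>lborel)"
  by (subst lborel_affine[OF assms(2), of t])
    (simp add: nn_integral_density nn_integral_distr nn_integral_cmult)

lemma integral_lborel_affine:
  fixes f :: "'a::euclidean_space \<Rightarrow> real"
  assumes [measurable]: "f \<in> borel_measurable borel" and "c \<noteq> 0"
  shows "(\<integral>x. f x \<partial>lborel) = \<bar>c\<bar> ^ DIM('a) * (\<integral>x. f (t + c *\<^sub>R x) \<partial>lborel)"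
  by (subst lborel_affine[OF assms(2), of t])
    (simp add: integral_density integral_distr)

lemma measurable_sgn [measurable]: "(sgn :: 'a::euclidean_space \<Rightarrow> 'a) \<in> borel_measurable borel"
  unfolding sgn_div_norm[abs_def] by measurable

lemma sgn_scaleR_pos: "c > 0 \<Longrightarrow> sgn (c *\<^sub>R x) = sgn (x::'a::real_normed_vector)"
  by (simp add: sgn_scaleR)

lemma indicator_cball_scaleR:
  "r > 0 \<Longrightarrow> indicator (cball 0 r) (r *\<^sub>R x) = (indicator (cball 0 1) (x::'a::real_normed_vector) :: 'b::zero_neq_one)"
  by (auto simp: indicator_def)

text \<open>Dilations preserve directions, so over balls of different radii the direction has the same
  distribution. This scaling property takes the place of polar coordinates below.\<close>

lemma nn_integral_sgn_cball:
  fixes q :: "'a::euclidean_space \<Rightarrow> ennreal"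
  assumes [measurable]: "q \<in> borel_measurable borel" and "r > 0"
  shows "(\<integral>\<^sup>+x. q (sgn x) * indicator (cball 0 r) x \<partial>lborel) =
    ennreal (r ^ DIM('a)) * (\<integral>\<^sup>+x. q (sgn x) * indicator (cball 0 1) x \<partial>lborel)"
  using assms(2)
  by (subst nn_integral_lborel_affine[where c=r and t=0])
    (simp_all add: sgn_scaleR_pos indicator_cball_scaleR)

lemma integral_sgn_cball:
  fixes q :: "'a::euclidean_space \<Rightarrow> real"
  assumes [measurable]: "q \<in> borel_measurable borel" and "r > 0"
  shows "(\<integral>x. q (sgn x) * indicator (cball 0 r) x \<partial>lborel) =
    r ^ DIM('a) * (\<integral>x. q (sgn x) * indicator (cball 0 1) x \<partial>lborel)"
  using assms(2)
  by (subst integral_lborel_affine[where c=r and t=0])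
    (simp_all add: sgn_scaleR_pos indicator_cball_scaleR)

abbreviation ball_vol :: "'a::euclidean_space itself \<Rightarrow> real" where
  "ball_vol _ \<equiv> measure lborel (cball 0 1 :: 'a set)"

lemma ball_vol_pos: "ball_vol TYPE('a::euclidean_space) > 0"
  by (simp add: content_cball)

lemma emeasure_cball_eq: "emeasure lborel (cball 0 r :: 'a::euclidean_space set) = ennreal (measure lborel (cball 0 r :: 'a set))"
  by (rule emeasure_eq_ennreal_measure) (metis emeasure_lborel_cball_finite less_irrefl infinity_ennreal_def)

lemma prob_space_unif_ball: "prob_space (unif_ball :: 'a::euclidean_space measure)"
  unfolding unif_ball_def
  by (rule prob_space_uniform_measure)
    (use ball_vol_pos[where 'a='a] in \<open>auto simp: emeasure_cball_eq\<close>)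

lemma sets_unif_ball [simp, measurable_cong]: "sets unif_ball = sets borel"
  by (simp add: unif_ball_def)

lemma space_unif_ball [simp]: "space unif_ball = UNIV"
  by (simp add: unif_ball_def)

lemma sets_unif_sphere [simp, measurable_cong]: "sets unif_sphere = sets borel"
  by (simp add: unif_sphere_def)

lemma space_unif_sphere [simp]: "space unif_sphere = UNIV"
  by (simp add: unif_sphere_def)

lemma prob_space_unif_sphere: "prob_space (unif_sphere :: 'a::euclidean_space measure)"
proof -
  interpret prob_space "unif_ball :: 'a measure" by (rule prob_space_unif_ball)
  show ?thesis unfolding unif_sphere_def by (rule prob_space_distr) simp
qed

lemma nn_integral_unif_ball:
  fixes f :: "'a::euclidean_space \<Rightarrow> ennreal"
  assumes [measurable]: "f \<in> borel_measurable borel"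
  shows "(\<integral>\<^sup>+x. f x \<partial>unif_ball) = (\<integral>\<^sup>+x. f x * indicator (cball 0 1) x \<partial>lborel) / ennreal (ball_vol TYPE('a))"
  unfolding unif_ball_def
  by (subst nn_integral_uniform_measure) (simp_all add: emeasure_cball_eq)

lemma integral_unif_ball:
  fixes f :: "'a::euclidean_space \<Rightarrow> 'b::{banach, second_countable_topology}"
  assumes [measurable]: "f \<in> borel_measurable borel"
  shows "(\<integral>x. f x \<partial>unif_ball) = (1 / ball_vol TYPE('a)) *\<^sub>R (\<integral>x. indicator (cball 0 1) x *\<^sub>R f x \<partial>lborel)"
proof -
  have eq: "unif_ball = density lborel (\<lambda>x::'a. ennreal ((1 / ball_vol TYPE('a)) * indicator (cball 0 1) x))"
    unfolding unif_ball_def uniform_measure_def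
    using ball_vol_pos[where 'a='a]
    by (intro arg_cong2[where f=density] refl ext)
      (auto simp: emeasure_cball_eq indicator_def divide_ennreal simp flip: ennreal_1)
  show ?thesis
    unfolding eq using ball_vol_pos[where 'a='a]
    by (subst integral_density) (simp_all flip: integral_scaleR_right)
qed

lemma nn_integral_unif_sphere:
  assumes [measurable]: "f \<in> borel_measurable borel"
  shows "(\<integral>\<^sup>+u. f u \<partial>unif_sphere) = (\<integral>\<^sup>+x. f (sgn x) \<partial>(unif_ball :: 'a::euclidean_space measure))"
  unfolding unif_sphere_def by (simp add: nn_integral_distr)

lemma integral_unif_sphere:
  fixes f :: "'a::euclidean_space \<Rightarrow> 'b::{banach, second_countable_topology}"
  assumes [measurable]: "f \<in> borel_measurable borel"
  shows "(\<integral>u. f u \<partial>unif_sphere) = (\<integral>x. f (sgn x) \<partial>unif_ball)"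
  unfolding unif_sphere_def by (simp add: integral_distr)

lemma AE_unif_ball: "AE u in unif_ball. norm (u::'a::euclidean_space) \<le> 1"
  unfolding unif_ball_def by (rule AE_uniform_measureI) auto

lemma AE_unif_sphere: "AE u in unif_sphere. norm (u::'a::euclidean_space) \<le> 1"
  unfolding unif_sphere_def by (subst AE_distr_iff) (auto simp: norm_sgn)

lemma borel_measurable_lipschitz:
  fixes F :: "'a::euclidean_space \<Rightarrow> 'b::euclidean_space"
  shows "G-lipschitz_on UNIV F \<Longrightarrow> F \<in> borel_measurable borel"
  by (intro borel_measurable_continuous_onI lipschitz_on_continuous_on)

lemma unif_ball_reflect:
  fixes f :: "'a::euclidean_space \<Rightarrow> real"
  assumes [measurable]: "f \<in> borel_measurable borel"
  shows "(\<integral>x. f (- x) \<partial>unif_ball) = (\<integral>x. f x \<partial>unif_ball)"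
proof -
  have "(\<integral>x. indicator (cball 0 1) x *\<^sub>R f x \<partial>lborel) = (\<integral>x. indicator (cball 0 1) x *\<^sub>R f (-x) \<partial>lborel)"
    by (subst integral_lborel_affine[where c="-1" and t=0]) (auto simp: indicator_def if_distrib cong: if_cong)
  then show ?thesis by (simp add: integral_unif_ball)
qed


section \<open>The gradient of the smoothed function\<close>

text \<open>A continuous replacement of the indicator of the unit ball, which decreases linearly from \<open>1\<close> to \<open>0\<close>
  between the radii \<open>1 - \<eta>\<close> and \<open>1\<close>. Its radial slope there is \<open>- 1 / \<eta>\<close>, so its gradient is carried by
  the shell between these radii.\<close>

definition cutoff :: "real \<Rightarrow> 'a::real_normed_vector \<Rightarrow> real" where
  "cutoff \<eta> v = min 1 (max 0 ((1 - norm v) / \<eta>))"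

definition shell :: "real \<Rightarrow> 'a::real_normed_vector \<Rightarrow> real" where
  "shell \<eta> v = indicator (cball 0 1) v - indicator (cball 0 (1 - \<eta>)) v"

lemma measurable_cutoff [measurable]: "cutoff \<eta> \<in> borel_measurable borel"
  unfolding cutoff_def[abs_def] by measurable

lemma measurable_shell [measurable]: "(shell \<eta> :: 'a::euclidean_space \<Rightarrow> real) \<in> borel_measurable borel"
  unfolding shell_def[abs_def] by measurable

lemma cutoff_bounds: "0 \<le> cutoff \<eta> v" "cutoff \<eta> v \<le> 1"
  by (auto simp: cutoff_def)

lemma cutoff_eq_0: "\<eta> > 0 \<Longrightarrow> norm v \<ge> 1 \<Longrightarrow> cutoff \<eta> v = 0"
  by (auto simp: cutoff_def divide_simps)

lemma cutoff_eq_1: "\<eta> > 0 \<Longrightarrow> norm v \<le> 1 - \<eta> \<Longrightarrow> cutoff \<eta> v = 1"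
  by (auto simp: cutoff_def divide_simps)

lemma cutoff_lipschitz:
  assumes "\<eta> > 0" shows "\<bar>cutoff \<eta> v - cutoff \<eta> v'\<bar> \<le> norm (v - v') / \<eta>"
proof -
  have "\<bar>cutoff \<eta> v - cutoff \<eta> v'\<bar> \<le> \<bar>(1 - norm v) / \<eta> - (1 - norm v') / \<eta>\<bar>"
    unfolding cutoff_def by linarith
  also have "\<dots> = \<bar>norm v - norm v'\<bar> / \<eta>"
    using assms by (simp add: field_simps abs_minus_commute flip: diff_divide_distrib)
  also have "\<dots> \<le> norm (v - v') / \<eta>"
    using assms by (intro divide_right_mono norm_triangle_ineq3) auto
  finally show ?thesis .
qed

lemma cutoff_deriv:
  fixes v w :: "'a::euclidean_space"
  assumes \<eta>: "0 < \<eta>" "\<eta> < 1" and v: "norm v \<noteq> 1" "norm v \<noteq> 1 - \<eta>"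
  shows "((\<lambda>t. cutoff \<eta> (v - t *\<^sub>R w)) has_real_derivative shell \<eta> v * (sgn v \<bullet> w) / \<eta>) (at 0)"
proof -
  let ?n = "\<lambda>t. norm (v - t *\<^sub>R w)"
  have cont: "?n \<midarrow>0\<rightarrow> norm v"
    by (rule tendsto_eq_intros refl | simp)+
  consider "norm v < 1 - \<eta>" | "1 - \<eta> < norm v" "norm v < 1" | "norm v > 1"
    using v by linarith
  then show ?thesis
  proof cases
    case 1
    have "\<forall>\<^sub>F t in nhds 0. ?n t < 1 - \<eta>"
      using order_tendstoD(2)[OF cont 1] 1 by (simp add: eventually_nhds_conv_at)
    then have ev: "\<forall>\<^sub>F t in nhds 0. cutoff \<eta> (v - t *\<^sub>R w) = 1"
      by eventually_elim (use \<eta> in \<open>simp add: cutoff_eq_1\<close>)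
    have "shell \<eta> v = 0" using 1 \<eta> by (auto simp: shell_def indicator_def)
    with DERIV_cong_ev[OF refl ev refl] show ?thesis by simp
  next
    case 3
    have "\<forall>\<^sub>F t in nhds 0. 1 < ?n t"
      using order_tendstoD(1)[OF cont 3] 3 by (simp add: eventually_nhds_conv_at)
    then have ev: "\<forall>\<^sub>F t in nhds 0. cutoff \<eta> (v - t *\<^sub>R w) = 0"
      by eventually_elim (use \<eta> in \<open>simp add: cutoff_eq_0\<close>)
    have "shell \<eta> v = 0" using 3 \<eta> by (auto simp: shell_def indicator_def)
    with DERIV_cong_ev[OF refl ev refl] show ?thesis by simp
  next
    case 2
    have "\<forall>\<^sub>F t in nhds 0. 1 - \<eta> < ?n t"
      using order_tendstoD(1)[OF cont 2(1)] 2 by (simp add: eventually_nhds_conv_at)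
    moreover have "\<forall>\<^sub>F t in nhds 0. ?n t < 1"
      using order_tendstoD(2)[OF cont 2(2)] 2 by (simp add: eventually_nhds_conv_at)
    ultimately have ev: "\<forall>\<^sub>F t in nhds 0. cutoff \<eta> (v - t *\<^sub>R w) = (1 - ?n t) / \<eta>"
      by eventually_elim (use \<eta> in \<open>auto simp: cutoff_def min_def max_def divide_simps\<close>)
    have sh: "shell \<eta> v = 1" using 2 \<eta> by (auto simp: shell_def indicator_def)
    have "v \<noteq> 0" using 2 \<eta> by auto
    then have "(norm has_derivative (\<lambda>h. h \<bullet> sgn v)) (at (v - 0 *\<^sub>R w))"
      using GDERIV_norm[of v] by (simp add: gderiv_def)
    moreover have "((\<lambda>t. v - t *\<^sub>R w) has_derivative (\<lambda>t. - t *\<^sub>R w)) (at 0)"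
      by (auto intro!: derivative_eq_intros)
    ultimately have "(?n has_derivative (\<lambda>t. (- t *\<^sub>R w) \<bullet> sgn v)) (at 0)"
      by (rule has_derivative_compose[rotated])
    then have "(?n has_real_derivative - (sgn v \<bullet> w)) (at 0)"
      unfolding has_field_derivative_def
      by (rule has_derivative_eq_rhs) (auto simp: fun_eq_iff inner_commute mult.commute)
    then have "((\<lambda>t. (1 - ?n t) / \<eta>) has_real_derivative (sgn v \<bullet> w) / \<eta>) (at 0)"
      using \<eta> by (auto intro!: derivative_eq_intros)
    with DERIV_cong_ev[OF refl ev refl] sh show ?thesis by simp
  qed
qed

lemma AE_norm_neq: "AE v in lborel. norm (v::'a::euclidean_space) \<noteq> r"
proof -
  have "sphere 0 r \<in> null_sets (lebesgue :: 'a measure)"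
    using negligible_sphere[of 0 r] by (simp add: negligible_iff_null_sets)
  then have "sphere 0 r \<in> null_sets (lborel :: 'a measure)"
    by (subst (asm) null_sets_completion_iff) auto
  then show ?thesis
    by (rule AE_I') auto
qed

lemma integrable_on_cball:
  fixes q :: "'a::euclidean_space \<Rightarrow> real"
  assumes [measurable]: "q \<in> borel_measurable borel"
    and "\<And>v. norm v \<le> r \<Longrightarrow> \<bar>q v\<bar> \<le> M" and "\<And>v. norm v > r \<Longrightarrow> q v = 0"
  shows "integrable lborel q"
proof (rule Bochner_Integration.integrable_bound)
  show "integrable lborel (\<lambda>v::'a. M * indicator (cball 0 r) v)"
    by (intro integrable_mult_right integrable_real_indicator) (auto simp: emeasure_cball_eq)
  show "AE v in lborel. norm (q v) \<le> norm (M * indicator (cball 0 r) v)"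
    using assms(2,3) by (intro AE_I2) (force simp: indicator_def not_le)
qed auto

lemma abs_integral_le:
  fixes f g :: "'a \<Rightarrow> real"
  assumes "integrable M f" "integrable M g" "\<And>x. \<bar>f x\<bar> \<le> g x"
  shows "\<bar>\<integral>x. f x \<partial>M\<bar> \<le> (\<integral>x. g x \<partial>M)"
proof -
  have "\<bar>\<integral>x. f x \<partial>M\<bar> \<le> (\<integral>x. \<bar>f x\<bar> \<partial>M)" by (rule integral_abs_bound)
  also have "\<dots> \<le> (\<integral>x. g x \<partial>M)" using assms by (intro integral_mono) auto
  finally show ?thesis .
qed

lemma lipschitz_bound:
  fixes H :: "'a::euclidean_space \<Rightarrow> real"
  assumes "G-lipschitz_on UNIV H" shows "\<bar>H (x + v)\<bar> \<le> \<bar>H x\<bar> + G * norm v"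
  using lipschitz_onD[OF assms, of "x + v" x] by (simp add: dist_norm)

text \<open>A translation moves the increment \<open>t\<close> from \<open>H\<close> to the cutoff. No differentiability of \<open>H\<close> is involved:
  the difference quotients of the cutoff are bounded by its Lipschitz constant and converge off two
  spheres, so dominated convergence applies.\<close>

lemma cutoff_smoothing_deriv:
  fixes H :: "'a::euclidean_space \<Rightarrow> real"
  assumes H: "G-lipschitz_on UNIV H" and \<eta>: "0 < \<eta>" "\<eta> < 1"
  shows "((\<lambda>t. \<integral>v. H (x + t *\<^sub>R w + v) * cutoff \<eta> v \<partial>lborel) has_real_derivative
     (\<integral>v. H (x + v) * (shell \<eta> v * (sgn v \<bullet> w)) \<partial>lborel) / \<eta>) (at 0)"
proof -
  note [measurable] = borel_measurable_lipschitz[OF H]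
  have G: "G \<ge> 0" using H by (rule lipschitz_on_nonneg)
  define A where "A t = (\<integral>v. H (x + t *\<^sub>R w + v) * cutoff \<eta> v \<partial>lborel)" for t
  have A_eq: "A t = (\<integral>v. H (x + v) * cutoff \<eta> (v - t *\<^sub>R w) \<partial>lborel)" for t
    unfolding A_def
    by (subst integral_lborel_affine[where c=1 and t="- t *\<^sub>R w"]) (auto simp: algebra_simps)
  have int: "integrable lborel (\<lambda>v. H (x + v) * cutoff \<eta> (v - t *\<^sub>R w))" for t
  proof (rule integrable_on_cball[where r="1 + \<bar>t\<bar> * norm w" and M="\<bar>H x\<bar> + G * (1 + \<bar>t\<bar> * norm w)"])
    fix v :: 'a assume "norm v \<le> 1 + \<bar>t\<bar> * norm w"
    then have "\<bar>H (x + v)\<bar> \<le> \<bar>H x\<bar> + G * (1 + \<bar>t\<bar> * norm w)"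
      using lipschitz_bound[OF H, of x v] mult_left_mono[OF _ G, of "norm v" "1 + \<bar>t\<bar> * norm w"] by linarith
    then have "\<bar>H (x + v)\<bar> * cutoff \<eta> (v - t *\<^sub>R w) \<le> (\<bar>H x\<bar> + G * (1 + \<bar>t\<bar> * norm w)) * 1"
      using cutoff_bounds[of \<eta> "v - t *\<^sub>R w"] by (intro mult_mono) auto
    then show "\<bar>H (x + v) * cutoff \<eta> (v - t *\<^sub>R w)\<bar> \<le> \<bar>H x\<bar> + G * (1 + \<bar>t\<bar> * norm w)"
      using cutoff_bounds[of \<eta> "v - t *\<^sub>R w"] by (simp add: abs_mult)
  next
    fix v :: 'a assume "norm v > 1 + \<bar>t\<bar> * norm w"
    then have "norm (v - t *\<^sub>R w) \<ge> 1"
      using norm_triangle_ineq2[of v "t *\<^sub>R w"] by simp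
    then show "H (x + v) * cutoff \<eta> (v - t *\<^sub>R w) = 0" using \<eta> by (simp add: cutoff_eq_0)
  qed auto
  have "(\<lambda>t. (A (0 + t) - A 0) / t) \<midarrow>0\<rightarrow> (\<integral>v. H (x + v) * (shell \<eta> v * (sgn v \<bullet> w)) \<partial>lborel) / \<eta>"
    unfolding LIMSEQ_SEQ_conv[symmetric]
  proof (intro allI impI, elim conjE)
    fix S :: "nat \<Rightarrow> real" assume S0: "\<forall>n. S n \<noteq> 0" and S: "S \<longlonglongrightarrow> 0"
    obtain \<tau> where \<tau>: "\<And>n. \<bar>S n\<bar> \<le> \<tau>"
      using convergent_imp_Bseq[OF convergentI[OF S]] by (auto simp: Bseq_def)
    \<comment> \<open>All translates of the cutoff along the sequence vanish outside the ball of this radius.\<close>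
    define R where "R = 1 + \<tau> * norm w"
    have R: "1 + \<bar>S n\<bar> * norm w \<le> R" for n
      unfolding R_def using mult_right_mono[OF \<tau>[of n], of "norm w"] by simp
    have lim: "(\<lambda>n. \<integral>v. H (x + v) * ((cutoff \<eta> (v - S n *\<^sub>R w) - cutoff \<eta> v) / S n) \<partial>lborel) \<longlonglongrightarrow>
      (\<integral>v. H (x + v) * (shell \<eta> v * (sgn v \<bullet> w) / \<eta>) \<partial>lborel)"
    proof (rule integral_dominated_convergence[where w="\<lambda>v. (\<bar>H x\<bar> + G * R) * (norm w / \<eta>) * indicator (cball 0 R) v"])
      show "integrable lborel (\<lambda>v::'a. (\<bar>H x\<bar> + G * R) * (norm w / \<eta>) * indicator (cball 0 R) v)"
        by (intro integrable_mult_right integrable_real_indicator) (auto simp: emeasure_cball_eq)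
      show "AE v in lborel. (\<lambda>n. H (x + v) * ((cutoff \<eta> (v - S n *\<^sub>R w) - cutoff \<eta> v) / S n))
        \<longlonglongrightarrow> H (x + v) * (shell \<eta> v * (sgn v \<bullet> w) / \<eta>)"
        using AE_norm_neq[of 1] AE_norm_neq[of "1 - \<eta>"]
      proof eventually_elim
        case (elim v)
        have "(\<lambda>t. (cutoff \<eta> (v - t *\<^sub>R w) - cutoff \<eta> v) / t) \<midarrow>0\<rightarrow> shell \<eta> v * (sgn v \<bullet> w) / \<eta>"
          using cutoff_deriv[OF \<eta> elim, of w] by (simp add: DERIV_def)
        then have "(\<lambda>n. (cutoff \<eta> (v - S n *\<^sub>R w) - cutoff \<eta> v) / S n) \<longlonglongrightarrow> shell \<eta> v * (sgn v \<bullet> w) / \<eta>"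
          using S0 S unfolding LIMSEQ_SEQ_conv[symmetric] by blast
        then show ?case by (rule tendsto_mult_left)
      qed
      fix n
      show "AE v in lborel. norm (H (x + v) * ((cutoff \<eta> (v - S n *\<^sub>R w) - cutoff \<eta> v) / S n))
        \<le> (\<bar>H x\<bar> + G * R) * (norm w / \<eta>) * indicator (cball 0 R) v"
      proof (intro AE_I2)
        fix v :: 'a
        show "norm (H (x + v) * ((cutoff \<eta> (v - S n *\<^sub>R w) - cutoff \<eta> v) / S n))
        \<le> (\<bar>H x\<bar> + G * R) * (norm w / \<eta>) * indicator (cball 0 R) v"
        proof (cases "norm v \<le> R")
          case True
          have "\<bar>H (x + v)\<bar> \<le> \<bar>H x\<bar> + G * R"
            using lipschitz_bound[OF H, of x v] mult_left_mono[OF True G] by simp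
          moreover have "\<bar>cutoff \<eta> (v - S n *\<^sub>R w) - cutoff \<eta> v\<bar> \<le> \<bar>S n\<bar> * norm w / \<eta>"
            using cutoff_lipschitz[OF \<eta>(1), of "v - S n *\<^sub>R w" v] by simp
          then have "\<bar>cutoff \<eta> (v - S n *\<^sub>R w) - cutoff \<eta> v\<bar> / \<bar>S n\<bar> \<le> norm w / \<eta>"
            using S0[rule_format, of n] by (simp add: pos_divide_le_eq mult_ac)
          ultimately have "\<bar>H (x + v)\<bar> * (\<bar>cutoff \<eta> (v - S n *\<^sub>R w) - cutoff \<eta> v\<bar> / \<bar>S n\<bar>) \<le> (\<bar>H x\<bar> + G * R) * (norm w / \<eta>)"
            by (intro mult_mono) auto
          then show ?thesis
            using True by (simp add: abs_mult)
        next
          case False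
          then have "norm v \<ge> 1" "norm (v - S n *\<^sub>R w) \<ge> 1"
            using R[of n] norm_triangle_ineq2[of v "S n *\<^sub>R w"] mult_nonneg_nonneg[of "\<bar>S n\<bar>" "norm w"]
            by (auto simp del: mult_nonneg_nonneg)
          then show ?thesis using False \<eta> by (simp add: cutoff_eq_0)
        qed
      qed
    qed auto
    have quot: "(\<integral>v. H (x + v) * ((cutoff \<eta> (v - S n *\<^sub>R w) - cutoff \<eta> v) / S n) \<partial>lborel) = (A (0 + S n) - A 0) / S n" for n
    proof -
      have "(A (0 + S n) - A 0) / S n = (\<integral>v. (H (x + v) * cutoff \<eta> (v - S n *\<^sub>R w) - H (x + v) * cutoff \<eta> v) / S n \<partial>lborel)"
        unfolding A_eq using int[of "S n"] int[of 0] by simp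
      also have "\<dots> = (\<integral>v. H (x + v) * ((cutoff \<eta> (v - S n *\<^sub>R w) - cutoff \<eta> v) / S n) \<partial>lborel)"
        by (rule Bochner_Integration.integral_cong) (simp_all add: right_diff_distrib)
      finally show ?thesis by (rule sym)
    qed
    have shell: "(\<integral>v. H (x + v) * (shell \<eta> v * (sgn v \<bullet> w) / \<eta>) \<partial>lborel) = (\<integral>v. H (x + v) * (shell \<eta> v * (sgn v \<bullet> w)) \<partial>lborel) / \<eta>"
      by (simp flip: integral_divide_zero)
    show "(\<lambda>n. (A (0 + S n) - A 0) / S n) \<longlonglongrightarrow> (\<integral>v. H (x + v) * (shell \<eta> v * (sgn v \<bullet> w)) \<partial>lborel) / \<eta>"
      using lim unfolding quot shell .
  qed
  then show ?thesis unfolding DERIV_def A_def .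
qed

lemma shell_bounds: "\<eta> > 0 \<Longrightarrow> 0 \<le> shell \<eta> v" "\<eta> > 0 \<Longrightarrow> shell \<eta> v \<le> 1"
  by (auto simp: shell_def indicator_def)

lemma shell_eq_0: "\<eta> > 0 \<Longrightarrow> norm v > 1 \<Longrightarrow> shell \<eta> v = 0"
  by (auto simp: shell_def indicator_def)

lemma sgn_sgn_vec: "sgn (sgn v) = sgn (v :: 'a::real_normed_vector)"
  by (cases "v = 0") (simp_all add: sgn_div_norm)

lemma norm_sgn_inner_le: "\<bar>sgn v \<bullet> w\<bar> \<le> norm w"
  using Cauchy_Schwarz_ineq2[of "sgn v" w] by (cases "v = 0") (auto simp: norm_sgn)

text \<open>The shell is the difference of two balls; for integrands that depend on the direction only, scaling
  gives the factor \<open>1 - (1 - \<eta>) ^ DIM('a)\<close>.\<close>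

lemma integral_shell_sgn:
  fixes q :: "'a::euclidean_space \<Rightarrow> real"
  assumes [measurable]: "q \<in> borel_measurable borel"
    and b: "\<And>v. norm v \<le> 1 \<Longrightarrow> \<bar>q v\<bar> \<le> M" and \<eta>: "0 < \<eta>" "\<eta> < 1"
  shows "(\<integral>v. q (sgn v) * shell \<eta> v \<partial>lborel) =
    (1 - (1 - \<eta>) ^ DIM('a)) * (\<integral>v. q (sgn v) * indicator (cball 0 1) v \<partial>lborel)"
proof -
  have int: "integrable lborel (\<lambda>v. q (sgn v) * indicator (cball 0 r) v)" for r
    by (rule integrable_on_cball[where r=r and M="\<bar>M\<bar>"])
      (use b[of "sgn _"] in \<open>auto simp: indicator_def norm_sgn split: if_splits intro: order_trans[OF _ abs_ge_self]\<close>)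
  have "(\<integral>v. q (sgn v) * shell \<eta> v \<partial>lborel) =
    (\<integral>v. q (sgn v) * indicator (cball 0 1) v \<partial>lborel) - (\<integral>v. q (sgn v) * indicator (cball 0 (1 - \<eta>)) v \<partial>lborel)"
    unfolding shell_def right_diff_distrib by (rule Bochner_Integration.integral_diff[OF int int])
  then show ?thesis
    using \<eta> by (simp add: integral_sgn_cball[where r="1 - \<eta>"] algebra_simps)
qed

lemma integral_shell:
  assumes "0 < \<eta>" "\<eta> < 1"
  shows "(\<integral>v. shell \<eta> (v :: 'a::euclidean_space) \<partial>lborel) = (1 - (1 - \<eta>) ^ DIM('a)) * ball_vol TYPE('a)"
  using integral_shell_sgn[of "\<lambda>_::'a. 1" 1, OF _ _ assms] by simp

lemma integrable_shell:
  fixes q :: "'a::euclidean_space \<Rightarrow> real"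
  assumes [measurable]: "q \<in> borel_measurable borel" and "\<eta> > 0"
    and "\<And>v. norm v \<le> 1 \<Longrightarrow> \<bar>q v\<bar> \<le> M"
  shows "integrable lborel (\<lambda>v. q v * shell \<eta> v)"
proof (rule integrable_on_cball[where r=1 and M=M])
  fix v :: 'a assume "norm v \<le> 1"
  then show "\<bar>q v * shell \<eta> v\<bar> \<le> M"
    using assms(3)[of v] shell_bounds[OF assms(2), of v]
      mult_mono[of "\<bar>q v\<bar>" M "shell \<eta> v" 1] by (simp add: abs_mult)
qed (use assms in \<open>auto simp: shell_eq_0\<close>)

lemma abs_integral_le_shell:
  fixes q :: "'a::euclidean_space \<Rightarrow> real" and \<eta> C :: real
  assumes [measurable]: "q \<in> borel_measurable borel" and \<eta>: "0 < \<eta>" "\<eta> < 1" and "C \<ge> 0"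
    and "\<And>v. \<bar>q v\<bar> \<le> C * shell \<eta> v"
  shows "\<bar>\<integral>v. q v \<partial>lborel\<bar> \<le> C * ball_vol TYPE('a) * (DIM('a) * \<eta>)"
proof -
  have "\<bar>\<integral>v. q v \<partial>lborel\<bar> \<le> (\<integral>v. C * shell \<eta> (v::'a) \<partial>lborel)"
  proof (rule abs_integral_le)
    show int: "integrable lborel (\<lambda>v::'a. C * shell \<eta> v)"
      using \<eta> by (intro integrable_shell[where M="\<bar>C\<bar>"]) auto
    show "integrable lborel q"
      by (rule Bochner_Integration.integrable_bound[OF int]) (use assms in \<open>auto intro!: AE_I2 order_trans[OF _ abs_ge_self]\<close>)
  qed (use assms in auto)
  also have "\<dots> = C * ball_vol TYPE('a) * (1 - (1 - \<eta>) ^ DIM('a))"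
    using \<eta> by (simp add: integral_shell)
  also have "\<dots> \<le> C * ball_vol TYPE('a) * (DIM('a) * \<eta>)"
    using Bernoulli_inequality[of "- \<eta>" "DIM('a)"] \<eta> assms(4)
    by (intro mult_left_mono) (auto simp: mult.commute)
  finally show ?thesis .
qed

lemma shell_ratio_tendsto: "((\<lambda>\<eta>. (1 - (1 - \<eta>) ^ d) / \<eta>) \<longlongrightarrow> real d) (at (0::real))"
proof -
  have "((\<lambda>\<eta>. - ((1 - \<eta>) ^ d)) has_real_derivative real d) (at 0)"
    by (auto intro!: derivative_eq_intros)
  then show ?thesis by (simp add: DERIV_def)
qed

text \<open>This is the divergence theorem for the ball. The averages against the cutoffs converge to the average
  over the ball. In their derivatives, replacing \<open>v\<close> by \<open>sgn v\<close> on the shell costs \<open>O(\<eta>)\<close>, and the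
  remaining mass \<open>(1 - (1 - \<eta>) ^ DIM('a)) / \<eta>\<close> of the shell tends to the dimension. The convergence is
  uniform in \<open>s\<close>, so the limit may be differentiated.\<close>

lemma ball_average_deriv:
  fixes H :: "'a::euclidean_space \<Rightarrow> real"
  assumes H: "G-lipschitz_on UNIV H"
  shows "((\<lambda>s. \<integral>v. H (x + s *\<^sub>R w + v) * indicator (cball 0 1) v \<partial>lborel) has_real_derivative
     DIM('a) * (\<integral>v. H (x + sgn v) * (sgn v \<bullet> w) * indicator (cball 0 1) v \<partial>lborel)) (at 0)"
proof -
  note [measurable] = borel_measurable_lipschitz[OF H]
  have G: "G \<ge> 0" using H by (rule lipschitz_on_nonneg)
  define I where "I z = (\<integral>v. H (z + sgn v) * (sgn v \<bullet> w) * indicator (cball 0 1) v \<partial>lborel)" for z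
  define S where "S = {-1<..<1::real}"
  define M where "M = \<bar>H x\<bar> + G * (norm w + 1)"
  have M0: "M \<ge> 0" using G by (simp add: M_def)
  have HM: "\<bar>H (x + s *\<^sub>R w + v)\<bar> \<le> M" if "s \<in> S" "norm v \<le> 1" for s v
  proof -
    have "norm (s *\<^sub>R w + v) \<le> norm (s *\<^sub>R w) + norm v" by (rule norm_triangle_ineq)
    also have "\<dots> \<le> norm w + 1"
      using that mult_right_mono[of "\<bar>s\<bar>" 1 "norm w"] by (simp add: S_def abs_le_iff)
    finally have "G * norm (s *\<^sub>R w + v) \<le> G * (norm w + 1)" using G by (rule mult_left_mono)
    with lipschitz_bound[OF H, of x "s *\<^sub>R w + v"] show ?thesis by (simp add: M_def add.assoc)
  qed
  define \<eta> where "\<eta> n = 1 / (real n + 2)" for n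
  have \<eta>: "0 < \<eta> n" "\<eta> n < 1" for n by (auto simp: \<eta>_def field_simps)
  have \<eta>0: "\<eta> \<longlonglongrightarrow> 0"
    unfolding \<eta>_def by (rule tendsto_divide_0[OF tendsto_const], rule filterlim_at_top_imp_at_infinity) real_asymp
  define A where "A n s = (\<integral>v. H (x + s *\<^sub>R w + v) * cutoff (\<eta> n) v \<partial>lborel)" for n s
  define A' where "A' n s = (\<integral>v. H (x + s *\<^sub>R w + v) * (shell (\<eta> n) v * (sgn v \<bullet> w)) \<partial>lborel) / \<eta> n" for n s
  define V where "V = ball_vol TYPE('a)"
  have V: "V > 0" unfolding V_def by (rule ball_vol_pos)
  define d where "d = real DIM('a)"
  define r where "r n = (1 - (1 - \<eta> n) ^ DIM('a)) / \<eta> n" for n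
  have r: "r \<longlonglongrightarrow> d"
    unfolding r_def d_def
    by (rule filterlim_compose[OF shell_ratio_tendsto]) (use \<eta>0 \<eta> in \<open>auto simp: filterlim_at less_imp_neq[THEN not_sym] intro!: always_eventually\<close>)
  have IM: "\<bar>I (x + s *\<^sub>R w)\<bar> \<le> M * norm w * V" if "s \<in> S" for s
  proof -
    have "\<bar>I (x + s *\<^sub>R w)\<bar> \<le> (\<integral>v. M * norm w * indicator (cball 0 1) (v::'a) \<partial>lborel)"
      unfolding I_def
    proof (rule abs_integral_le)
      show int: "integrable lborel (\<lambda>v::'a. M * norm w * indicator (cball 0 1) v)"
        by (intro integrable_mult_right integrable_real_indicator) (auto simp: emeasure_cball_eq)
      show *: "\<bar>H (x + s *\<^sub>R w + sgn v) * (sgn v \<bullet> w) * indicator (cball 0 1) v\<bar> \<le> M * norm w * indicator (cball 0 1) v" for v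
        using HM[OF that, of "sgn v"] norm_sgn_inner_le[of v w] M0
        by (auto simp: indicator_def abs_mult norm_sgn intro!: mult_mono)
      show "integrable lborel (\<lambda>v. H (x + s *\<^sub>R w + sgn v) * (sgn v \<bullet> w) * indicator (cball 0 1) v)"
        by (rule Bochner_Integration.integrable_bound[OF int])
          (use * in \<open>auto intro!: AE_I2 order_trans[OF _ abs_ge_self]\<close>)
    qed
    then show ?thesis by (simp add: V_def)
  qed
  \<comment> \<open>The first summand is the cost of replacing \<open>v\<close> by \<open>sgn v\<close> on the shell, the second compares the mass of
    the shell with the dimension.\<close>
  have deriv_bound: "\<bar>A' n s - d * I (x + s *\<^sub>R w)\<bar> \<le> G * norm w * V * d * \<eta> n + \<bar>r n - d\<bar> * (M * norm w * V)"
    if s: "s \<in> S" for n s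
  proof -
    let ?z = "x + s *\<^sub>R w"
    let ?s = "shell (\<eta> n)"
    have i1: "integrable lborel (\<lambda>v. H (?z + v) * (?s v * (sgn v \<bullet> w)))"
    proof -
      have "integrable lborel (\<lambda>v. (H (?z + v) * (sgn v \<bullet> w)) * ?s v)"
        by (rule integrable_shell[where M="M * norm w"])
          (use HM[OF s] norm_sgn_inner_le[of _ w] M0 \<eta> in \<open>auto simp: abs_mult intro!: mult_mono\<close>)
      then show ?thesis by (simp add: mult_ac)
    qed
    have i2: "integrable lborel (\<lambda>v. (H (?z + sgn v) * (sgn v \<bullet> w)) * ?s v)"
      by (rule integrable_shell[where M="M * norm w"])
        (use HM[OF s, of "sgn _"] norm_sgn_inner_le[of _ w] M0 \<eta> in \<open>auto simp: abs_mult norm_sgn intro!: mult_mono\<close>)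
    have eq: "(\<integral>v. (H (?z + sgn v) * (sgn v \<bullet> w)) * ?s v \<partial>lborel) = (1 - (1 - \<eta> n) ^ DIM('a)) * I ?z"
    proof -
      have "\<bar>H (?z + sgn v) * (sgn v \<bullet> w)\<bar> \<le> M * norm w" for v
        using HM[OF s, of "sgn v"] norm_sgn_inner_le[of v w] M0
        by (auto simp: abs_mult norm_sgn intro!: mult_mono)
      then have b: "\<bar>H (?z + sgn v) * (sgn v \<bullet> w)\<bar> \<le> M * norm w" for v .
      show ?thesis unfolding I_def
        using integral_shell_sgn[of "\<lambda>u. H (?z + sgn u) * (sgn u \<bullet> w)" "M * norm w" "\<eta> n", OF _ b \<eta>]
        by (simp add: sgn_sgn_vec)
    qed
    have "\<bar>(\<integral>v. H (?z + v) * (?s v * (sgn v \<bullet> w)) - H (?z + sgn v) * (sgn v \<bullet> w) * ?s v \<partial>lborel)\<bar>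
      \<le> (G * \<eta> n * norm w) * ball_vol TYPE('a) * (DIM('a) * \<eta> n)"
    proof (rule abs_integral_le_shell)
      fix v :: 'a
      show "\<bar>H (?z + v) * (?s v * (sgn v \<bullet> w)) - H (?z + sgn v) * (sgn v \<bullet> w) * ?s v\<bar> \<le> G * \<eta> n * norm w * ?s v"
      proof (cases "?s v = 0")
        case False
        then have nv: "1 - \<eta> n < norm v" "norm v \<le> 1"
          using \<eta>[of n] by (auto simp: shell_def indicator_def of_bool_def split: if_splits)
        then have "v \<noteq> 0" using \<eta>[of n] by auto
        then have "v - sgn v = (norm v - 1) *\<^sub>R sgn v"
          by (simp add: sgn_div_norm algebra_simps)
        then have "norm (v - sgn v) \<le> \<eta> n" using nv by (simp add: norm_sgn)
        then have "\<bar>H (?z + v) - H (?z + sgn v)\<bar> \<le> G * \<eta> n"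
          using lipschitz_onD[OF H, of "?z + v" "?z + sgn v"] mult_left_mono[OF _ G]
          by (fastforce simp: dist_norm)
        then have "\<bar>H (?z + v) - H (?z + sgn v)\<bar> * \<bar>sgn v \<bullet> w\<bar> * ?s v \<le> G * \<eta> n * norm w * ?s v"
          using norm_sgn_inner_le[of v w] \<eta>[of n] G shell_bounds(1)[of "\<eta> n" v] by (intro mult_mono) auto
        moreover have "H (?z + v) * (?s v * (sgn v \<bullet> w)) - H (?z + sgn v) * (sgn v \<bullet> w) * ?s v
          = (H (?z + v) - H (?z + sgn v)) * (sgn v \<bullet> w) * ?s v" by (simp add: algebra_simps)
        ultimately show ?thesis using shell_bounds(1)[of "\<eta> n" v] \<eta>[of n] by (simp add: abs_mult)
      qed simp
    qed (use \<eta>[of n] G in auto)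
    then have "\<bar>A' n s * \<eta> n - (r n * \<eta> n) * I ?z\<bar> \<le> (G * norm w * V * d * \<eta> n) * \<eta> n"
      using \<eta>[of n] unfolding Bochner_Integration.integral_diff[OF i1 i2] eq
      by (simp add: A'_def r_def V_def d_def mult_ac)
    also have "A' n s * \<eta> n - (r n * \<eta> n) * I ?z = (A' n s - r n * I ?z) * \<eta> n"
      by (simp add: algebra_simps)
    finally have "\<bar>A' n s - r n * I ?z\<bar> \<le> G * norm w * V * d * \<eta> n"
      using \<eta>[of n] by (simp add: abs_mult)
    moreover have "\<bar>r n * I ?z - d * I ?z\<bar> \<le> \<bar>r n - d\<bar> * (M * norm w * V)"
      unfolding left_diff_distrib[symmetric] abs_mult by (intro mult_left_mono IM[OF s]) auto
    ultimately show ?thesis by linarith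
  qed
  have A_lim: "(\<lambda>n. A n s) \<longlonglongrightarrow> (\<integral>v. H (x + s *\<^sub>R w + v) * indicator (cball 0 1) v \<partial>lborel)" if s: "s \<in> S" for s
  proof -
    let ?z = "x + s *\<^sub>R w"
    have i0: "integrable lborel (\<lambda>v. H (?z + v) * q v)" if "q \<in> borel_measurable borel" "\<And>v. \<bar>q v\<bar> \<le> indicator (cball 0 1) v" for q :: "'a \<Rightarrow> real"
    proof (rule integrable_on_cball[where r=1 and M=M])
      fix v :: 'a assume "norm v \<le> 1"
      then show "\<bar>H (?z + v) * q v\<bar> \<le> M"
        using HM[OF s, of v] that(2)[of v] unfolding abs_mult
        by (auto simp: indicator_def split: if_splits intro: order_trans[OF mult_left_le])
    next
      show "(\<lambda>v. H (?z + v) * q v) \<in> borel_measurable borel"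
        using that(1) by measurable
      fix v :: 'a assume "norm v > 1"
      then show "H (?z + v) * q v = 0" using that(2)[of v] by (simp add: indicator_def)
    qed
    have i1: "integrable lborel (\<lambda>v. H (?z + v) * cutoff (\<eta> n) v)" for n
    proof (rule i0)
      fix v :: 'a show "\<bar>cutoff (\<eta> n) v\<bar> \<le> indicator (cball 0 1) v"
        using cutoff_eq_0[OF \<eta>(1)[of n], of v] cutoff_bounds[of "\<eta> n" v] by (cases "norm v \<le> 1") auto
    qed simp
    have i2: "integrable lborel (\<lambda>v. H (?z + v) * indicator (cball 0 1) v)"
      by (intro i0) (auto simp: indicator_def)
    have "\<bar>A n s - (\<integral>v. H (?z + v) * indicator (cball 0 1) v \<partial>lborel)\<bar> \<le> M * ball_vol TYPE('a) * (DIM('a) * \<eta> n)" for n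
      unfolding A_def Bochner_Integration.integral_diff[OF i1 i2, symmetric]
    proof (rule abs_integral_le_shell)
      fix v :: 'a
      show "\<bar>H (?z + v) * cutoff (\<eta> n) v - H (?z + v) * indicat_real (cball 0 1) v\<bar> \<le> M * shell (\<eta> n) v"
      proof (cases "norm v \<le> 1")
        case True
        have *: "\<bar>cutoff (\<eta> n) v - 1\<bar> \<le> shell (\<eta> n) v"
          using True cutoff_bounds[of "\<eta> n" v] cutoff_eq_1[OF \<eta>(1), of v n] by (auto simp: shell_def indicator_def)
        have "\<bar>H (?z + v)\<bar> * \<bar>cutoff (\<eta> n) v - 1\<bar> \<le> M * shell (\<eta> n) v"
          using HM[OF s True] * M0 by (intro mult_mono) auto
        then show ?thesis using True by (simp add: indicator_def flip: abs_mult) (simp add: algebra_simps)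
      qed (use \<eta> in \<open>simp add: cutoff_eq_0 shell_eq_0 indicator_def\<close>)
    qed (use \<eta> M0 in auto)
    moreover have "(\<lambda>n. M * ball_vol TYPE('a) * (DIM('a) * \<eta> n)) \<longlonglongrightarrow> 0"
      by (intro tendsto_mult_right_zero \<eta>0)
    ultimately show ?thesis
      by (rule_tac Lim_null[THEN iffD2], rule_tac Lim_null_comparison[OF always_eventually]) auto
  qed
  have derA: "(A n has_derivative (\<lambda>h. A' n s * h)) (at s within S)" for n s
  proof -
    have "((\<lambda>t. A n (s + t)) has_real_derivative A' n s) (at 0)"
      using cutoff_smoothing_deriv[OF H \<eta>[of n], of "x + s *\<^sub>R w" w]
      by (simp add: A_def A'_def algebra_simps)
    then have "(A n has_real_derivative A' n s) (at s)"
      using DERIV_shift[of "A n" "A' n s" 0 s] by (simp only: add_0 add.commute[of s])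
    then show ?thesis
      unfolding has_field_derivative_def by (rule has_derivative_at_withinI)
  qed
  have "\<exists>g. \<forall>s\<in>S. (\<lambda>n. A n s) \<longlonglongrightarrow> g s \<and> (g has_derivative (\<lambda>h. (d * I (x + s *\<^sub>R w)) * h)) (at s within S)"
  proof (rule has_derivative_sequence[where ?x0.0=0])
    show "convex S" by (simp add: S_def)
    show "0 \<in> S" by (simp add: S_def)
    show "(\<lambda>n. A n 0) \<longlonglongrightarrow> (\<integral>v. H (x + 0 *\<^sub>R w + v) * indicator (cball 0 1) v \<partial>lborel)"
      by (rule A_lim) (simp add: S_def)
    show "(A n has_derivative (\<lambda>h. A' n s * h)) (at s within S)" for n s by (rule derA)
    fix e :: real assume e: "e > 0"
    have "(\<lambda>n. G * norm w * V * d * \<eta> n + \<bar>r n - d\<bar> * (M * norm w * V)) \<longlonglongrightarrow> G * norm w * V * d * 0 + \<bar>d - d\<bar> * (M * norm w * V)"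
      by (intro tendsto_intros \<eta>0 r)
    then have "\<forall>\<^sub>F n in sequentially. G * norm w * V * d * \<eta> n + \<bar>r n - d\<bar> * (M * norm w * V) < e"
      by (rule order_tendstoD) (use e in simp)
    then show "\<forall>\<^sub>F n in sequentially. \<forall>s\<in>S. \<forall>h. norm (A' n s * h - (d * I (x + s *\<^sub>R w)) * h) \<le> e * norm h"
    proof eventually_elim
      case (elim n)
      show ?case
      proof (intro ballI allI)
        fix s h assume "s \<in> S"
        from deriv_bound[OF this, of n] elim have "\<bar>A' n s - d * I (x + s *\<^sub>R w)\<bar> \<le> e" by linarith
        then show "norm (A' n s * h - (d * I (x + s *\<^sub>R w)) * h) \<le> e * norm h"
            unfolding left_diff_distrib[symmetric] real_norm_def abs_mult by (intro mult_right_mono) auto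
      qed
    qed
  qed
  then obtain g where "\<forall>s\<in>S. (\<lambda>n. A n s) \<longlonglongrightarrow> g s \<and> (g has_derivative (\<lambda>h. (d * I (x + s *\<^sub>R w)) * h)) (at s within S)"
    by (rule exE)
  note g' = bspec[OF this]
  have g: "(\<lambda>n. A n s) \<longlonglongrightarrow> g s" "(g has_derivative (\<lambda>h. (d * I (x + s *\<^sub>R w)) * h)) (at s within S)"
    if "s \<in> S" for s
    by (rule conjunct1[OF g'[OF that]], rule conjunct2[OF g'[OF that]])
  have "open S" "0 \<in> S" by (auto simp: S_def)
  then have "(g has_derivative (\<lambda>h. (d * I x) * h)) (at 0)"
    using g(2)[OF \<open>0 \<in> S\<close>] unfolding at_within_open[OF \<open>0 \<in> S\<close> \<open>open S\<close>] by simp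
  then have "((\<lambda>s. \<integral>v. H (x + s *\<^sub>R w + v) * indicator (cball 0 1) v \<partial>lborel) has_derivative (\<lambda>h. (d * I x) * h)) (at 0)"
    by (rule has_derivative_transform_within_open[OF _ \<open>open S\<close> \<open>0 \<in> S\<close>])
      (rule LIMSEQ_unique[OF g(1) A_lim], assumption+)
  then show ?thesis by (simp add: has_field_derivative_def I_def d_def)
qed

text \<open>The expectation of the one-point estimator of the gradient.\<close>

definition sphere_grad :: "real \<Rightarrow> ('a::euclidean_space \<Rightarrow> real) \<Rightarrow> 'a \<Rightarrow> 'a" where
  "sphere_grad \<delta> F x = (\<integral>u. (DIM('a) / \<delta> * F (x + \<delta> *\<^sub>R u)) *\<^sub>R u \<partial>unif_sphere)"

lemma integrable_sphere_grad:
  fixes F :: "'a::euclidean_space \<Rightarrow> real" and G \<delta> :: real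
  assumes F: "G-lipschitz_on UNIV F"
  shows "integrable unif_sphere (\<lambda>u. (c * F (x + \<delta> *\<^sub>R u)) *\<^sub>R u)"
proof -
  note [measurable] = borel_measurable_lipschitz[OF F]
  have G: "G \<ge> 0" using F by (rule lipschitz_on_nonneg)
  interpret prob_space "unif_sphere :: 'a measure" by (rule prob_space_unif_sphere)
  show ?thesis
  proof (rule integrable_const_bound[where B="\<bar>c\<bar> * (\<bar>F x\<bar> + G * \<bar>\<delta>\<bar>)"])
    show "AE u in unif_sphere. norm ((c * F (x + \<delta> *\<^sub>R u)) *\<^sub>R u) \<le> \<bar>c\<bar> * (\<bar>F x\<bar> + G * \<bar>\<delta>\<bar>)"
      using AE_unif_sphere
    proof eventually_elim
      case (elim u)
      have "G * norm (\<delta> *\<^sub>R u) \<le> G * \<bar>\<delta>\<bar>" using elim G by (auto intro!: mult_left_mono mult_left_le)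
      with lipschitz_bound[OF F, of x "\<delta> *\<^sub>R u"] have "\<bar>F (x + \<delta> *\<^sub>R u)\<bar> \<le> \<bar>F x\<bar> + G * \<bar>\<delta>\<bar>" by linarith
      then have "\<bar>c\<bar> * \<bar>F (x + \<delta> *\<^sub>R u)\<bar> * norm u \<le> \<bar>c\<bar> * (\<bar>F x\<bar> + G * \<bar>\<delta>\<bar>) * 1"
        using elim G by (intro mult_mono) auto
      then show ?case by (simp add: abs_mult)
    qed
  qed measurable
qed

lemma sphere_grad_lipschitz:
  fixes F :: "'a::euclidean_space \<Rightarrow> real" and G \<delta> :: real
  assumes F: "G-lipschitz_on UNIV F" and \<delta>: "\<delta> > 0"
  shows "(real DIM('a) * G / \<delta>)-lipschitz_on UNIV (sphere_grad \<delta> F)"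
proof (rule lipschitz_onI)
  note [measurable] = borel_measurable_lipschitz[OF F]
  have G: "G \<ge> 0" using F by (rule lipschitz_on_nonneg)
  interpret prob_space "unif_sphere :: 'a measure" by (rule prob_space_unif_sphere)
  show "0 \<le> real DIM('a) * G / \<delta>" using G \<delta> by simp
  fix x y :: 'a
  let ?q = "\<lambda>u. (DIM('a) / \<delta> * F (x + \<delta> *\<^sub>R u)) *\<^sub>R u - (DIM('a) / \<delta> * F (y + \<delta> *\<^sub>R u)) *\<^sub>R u"
  have int: "integrable unif_sphere ?q"
    by (intro Bochner_Integration.integrable_diff integrable_sphere_grad[OF F])
  have "dist (sphere_grad \<delta> F x) (sphere_grad \<delta> F y) = norm (\<integral>u. ?q u \<partial>unif_sphere)"
    unfolding sphere_grad_def dist_norm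
    by (subst Bochner_Integration.integral_diff[OF integrable_sphere_grad[OF F] integrable_sphere_grad[OF F]]) (rule refl)
  also have "\<dots> \<le> (\<integral>u. norm (?q u) \<partial>unif_sphere)" by (rule integral_norm_bound)
  also have "\<dots> \<le> (\<integral>u. real DIM('a) * G / \<delta> * dist x y \<partial>(unif_sphere :: 'a measure))"
  proof (rule integral_mono_AE)
    show "AE u in unif_sphere. norm (?q u) \<le> real DIM('a) * G / \<delta> * dist x y"
      using AE_unif_sphere
    proof eventually_elim
      case (elim u)
      have "?q u = (DIM('a) / \<delta> * (F (x + \<delta> *\<^sub>R u) - F (y + \<delta> *\<^sub>R u))) *\<^sub>R u"
        by (simp add: algebra_simps)
      then have "norm (?q u) = DIM('a) / \<delta> * \<bar>F (x + \<delta> *\<^sub>R u) - F (y + \<delta> *\<^sub>R u)\<bar> * norm u"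
        using \<delta> by (simp add: abs_mult)
      also have "\<dots> \<le> DIM('a) / \<delta> * (G * dist x y) * 1"
        using lipschitz_onD[OF F, of "x + \<delta> *\<^sub>R u" "y + \<delta> *\<^sub>R u"] elim \<delta> G
        by (intro mult_mono mult_left_mono) (auto simp: dist_norm)
      finally show ?case by simp
    qed
  qed (use int in auto)
  also have "\<dots> = real DIM('a) * G / \<delta> * dist x y" using prob_space by simp
  finally show "dist (sphere_grad \<delta> F x) (sphere_grad \<delta> F y) \<le> real DIM('a) * G / \<delta> * dist x y" .
qed

lemma smoothing_directional_deriv:
  fixes F :: "'a::euclidean_space \<Rightarrow> real" and G \<delta> :: real
  assumes F: "G-lipschitz_on UNIV F" and \<delta>: "\<delta> > 0"
  shows "((\<lambda>s. smoothing unif_ball \<delta> F (x + s *\<^sub>R w)) has_real_derivative sphere_grad \<delta> F x \<bullet> w) (at 0)"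
proof -
  note [measurable] = borel_measurable_lipschitz[OF F]
  define V where "V = ball_vol TYPE('a)"
  have G: "G \<ge> 0" using F by (rule lipschitz_on_nonneg)
  have H: "(G * \<delta>)-lipschitz_on UNIV (\<lambda>y. F (\<delta> *\<^sub>R y))"
  proof (rule lipschitz_onI)
    fix y z show "dist (F (\<delta> *\<^sub>R y)) (F (\<delta> *\<^sub>R z)) \<le> G * \<delta> * dist y z"
      using lipschitz_onD[OF F, of "\<delta> *\<^sub>R y" "\<delta> *\<^sub>R z"] \<delta> by (simp add: dist_norm mult.assoc flip: scaleR_diff_right)
  qed (use G \<delta> in simp)
  have sg: "sphere_grad \<delta> F x \<bullet> w = (1 / V) * (\<integral>v. indicator (cball 0 1) v * (DIM('a) / \<delta> * F (x + \<delta> *\<^sub>R sgn v) * (sgn v \<bullet> w)) \<partial>lborel)"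
  proof -
    have "sphere_grad \<delta> F x \<bullet> w = (\<integral>u. DIM('a) / \<delta> * F (x + \<delta> *\<^sub>R u) * (u \<bullet> w) \<partial>unif_sphere)"
      unfolding sphere_grad_def by (subst integral_inner_left[OF integrable_sphere_grad[OF F], symmetric]) simp
    then show ?thesis by (simp add: integral_unif_sphere integral_unif_ball V_def)
  qed
  have sm: "smoothing unif_ball \<delta> F y = (1 / V) * (\<integral>v. F (y + \<delta> *\<^sub>R v) * indicator (cball 0 1) v \<partial>lborel)" for y
    by (simp add: smoothing_def integral_unif_ball V_def mult.commute)
  have "((\<lambda>s. (1 / V) * (\<integral>v. F (\<delta> *\<^sub>R ((1 / \<delta>) *\<^sub>R x + s *\<^sub>R ((1 / \<delta>) *\<^sub>R w) + v)) * indicator (cball 0 1) v \<partial>lborel)) has_real_derivative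
    (1 / V) * (DIM('a) * (\<integral>v. F (\<delta> *\<^sub>R ((1 / \<delta>) *\<^sub>R x + sgn v)) * (sgn v \<bullet> ((1 / \<delta>) *\<^sub>R w)) * indicator (cball 0 1) v \<partial>lborel))) (at 0)"
    by (rule DERIV_cmult ball_average_deriv[OF H])+
  moreover have "(\<integral>v. indicator (cball 0 1) v * (DIM('a) / \<delta> * F (x + \<delta> *\<^sub>R sgn v) * (sgn v \<bullet> w)) \<partial>lborel)
    = DIM('a) * (\<integral>v. F (\<delta> *\<^sub>R ((1 / \<delta>) *\<^sub>R x + sgn v)) * (sgn v \<bullet> ((1 / \<delta>) *\<^sub>R w)) * indicator (cball 0 1) v \<partial>lborel)"
    using \<delta> by (simp add: scaleR_add_right mult_ac flip: integral_mult_right_zero)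
  ultimately show ?thesis
    unfolding sg using \<delta> by (simp add: sm scaleR_add_right)
qed

text \<open>Along each line the derivative is known, and it is a Lipschitz function of the base point. By the mean
  value theorem the error of the linearization is then quadratic, which gives differentiability.\<close>

theorem GDERIV_smoothing_unif_ball:
  fixes F :: "'a::euclidean_space \<Rightarrow> real" and G \<delta> :: real
  assumes F: "G-lipschitz_on UNIV F" and \<delta>: "\<delta> > 0"
  shows "GDERIV (smoothing unif_ball \<delta> F) x :> sphere_grad \<delta> F x"
proof -
  let ?f = "smoothing unif_ball \<delta> F" and ?g = "sphere_grad \<delta> F"
  define M where "M = real DIM('a) * G / \<delta>"
  have M: "M \<ge> 0" unfolding M_def using lipschitz_on_nonneg[OF sphere_grad_lipschitz[OF F \<delta>]] .
  have bound: "\<bar>?f (x + h) - ?f x - ?g x \<bullet> h\<bar> \<le> M * norm h * norm h" for h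
  proof -
    have "((\<lambda>s. ?f (x + s *\<^sub>R h)) has_real_derivative ?g (x + s *\<^sub>R h) \<bullet> h) (at s)" for s
      using smoothing_directional_deriv[OF F \<delta>, of "x + s *\<^sub>R h" h]
        DERIV_shift[of "\<lambda>s. ?f (x + s *\<^sub>R h)" "?g (x + s *\<^sub>R h) \<bullet> h" 0 s]
      by (simp add: algebra_simps)
    from MVT2[of 0 1 "\<lambda>s. ?f (x + s *\<^sub>R h)", OF _ this]
    obtain s where s: "0 < s" "s < 1" "?f (x + h) - ?f x = ?g (x + s *\<^sub>R h) \<bullet> h" by auto
    have "\<bar>(?g (x + s *\<^sub>R h) - ?g x) \<bullet> h\<bar> \<le> norm (?g (x + s *\<^sub>R h) - ?g x) * norm h"
      by (rule Cauchy_Schwarz_ineq2)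
    also have "\<dots> \<le> (M * norm h) * norm h"
    proof (rule mult_right_mono)
      have "norm (?g (x + s *\<^sub>R h) - ?g x) \<le> M * norm (s *\<^sub>R h)"
        using lipschitz_onD[OF sphere_grad_lipschitz[OF F \<delta>], of "x + s *\<^sub>R h" x] by (simp add: dist_norm M_def)
      also have "\<dots> \<le> M * norm h" using s M by (intro mult_left_mono) (auto simp: mult_left_le_one_le)
      finally show "norm (?g (x + s *\<^sub>R h) - ?g x) \<le> M * norm h" .
    qed simp
    finally show ?thesis unfolding s(3) by (simp add: inner_diff_left)
  qed
  show ?thesis
    unfolding gderiv_def has_derivative_at
  proof
    show "bounded_linear (\<lambda>h. h \<bullet> ?g x)" by (rule bounded_linear_inner_left)
    have "(\<lambda>h. M * norm h) \<midarrow>0\<rightarrow> 0" by (rule tendsto_eq_intros refl | simp)+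
    then show "(\<lambda>h. norm (?f (x + h) - ?f x - h \<bullet> ?g x) / norm h) \<midarrow>0\<rightarrow> 0"
    proof (rule tendsto_sandwich[OF _ _ tendsto_const, rotated -1])
      show "\<forall>\<^sub>F h in at 0. norm (?f (x + h) - ?f x - h \<bullet> ?g x) / norm h \<le> M * norm h"
        using bound by (auto simp: eventually_at_filter divide_le_eq inner_commute intro!: always_eventually)
    qed auto
  qed
qed

lemma gradient_eq: "GDERIV F x :> D \<Longrightarrow> gradient F x = D"
  unfolding gradient_def gderiv_def
proof (rule the_equality)
  fix D' assume "(F has_derivative (\<lambda>h. h \<bullet> D)) (at x)" "(F has_derivative (\<lambda>h. h \<bullet> D')) (at x)"
  from has_derivative_unique[OF this] show "D' = D"
    by (metis inner_commute vector_eq_rdot)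
qed

lemma gradient_smoothing_unif_ball:
  fixes F :: "'a::euclidean_space \<Rightarrow> real" and G \<delta> :: real
  assumes F: "G-lipschitz_on UNIV F" and \<delta>: "\<delta> > 0"
  shows "gradient (smoothing unif_ball \<delta> F) = sphere_grad \<delta> F"
  using gradient_eq[OF GDERIV_smoothing_unif_ball[OF assms]] by blast

lemma integrable_smoothing:
  fixes F :: "'a::euclidean_space \<Rightarrow> real" and G \<delta> :: real
  assumes F: "G-lipschitz_on UNIV F"
  shows "integrable unif_ball (\<lambda>u. F (x + \<delta> *\<^sub>R u))"
proof -
  note [measurable] = borel_measurable_lipschitz[OF F]
  have G: "G \<ge> 0" using F by (rule lipschitz_on_nonneg)
  interpret prob_space "unif_ball :: 'a measure" by (rule prob_space_unif_ball)
  show ?thesis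
  proof (rule integrable_const_bound[where B="\<bar>F x\<bar> + G * \<bar>\<delta>\<bar>"])
    show "AE u in unif_ball. norm (F (x + \<delta> *\<^sub>R u)) \<le> \<bar>F x\<bar> + G * \<bar>\<delta>\<bar>"
      using AE_unif_ball
    proof eventually_elim
      case (elim u)
      have "G * norm (\<delta> *\<^sub>R u) \<le> G * \<bar>\<delta>\<bar>" using elim G by (auto intro!: mult_left_mono mult_left_le)
      with lipschitz_bound[OF F, of x "\<delta> *\<^sub>R u"] show ?case by simp
    qed
  qed measurable
qed

lemma smoothing_close:
  fixes F :: "'a::euclidean_space \<Rightarrow> real" and G \<delta> :: real
  assumes F: "G-lipschitz_on UNIV F" and \<delta>: "\<delta> > 0"
  shows "\<bar>smoothing unif_ball \<delta> F x - F x\<bar> \<le> \<delta> * G"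
proof -
  note [measurable] = borel_measurable_lipschitz[OF F]
  have G: "G \<ge> 0" using F by (rule lipschitz_on_nonneg)
  interpret prob_space "unif_ball :: 'a measure" by (rule prob_space_unif_ball)
  have [simp]: "prob UNIV = 1" using prob_space by simp
  have AE: "AE u in unif_ball. \<bar>F (x + \<delta> *\<^sub>R u) - F x\<bar> \<le> \<delta> * G"
    using AE_unif_ball
  proof eventually_elim
    case (elim u)
    have "\<bar>F (x + \<delta> *\<^sub>R u) - F x\<bar> \<le> G * (\<delta> * norm u)"
      using lipschitz_onD[OF F, of "x + \<delta> *\<^sub>R u" x] \<delta> by (simp add: dist_norm)
    also have "\<dots> \<le> G * (\<delta> * 1)" using elim G \<delta> by (intro mult_left_mono) auto
    finally show ?case by (simp add: mult.commute)
  qed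
  have int': "integrable unif_ball (\<lambda>u. F (x + \<delta> *\<^sub>R u))" by (rule integrable_smoothing[OF F])
  then have int: "integrable unif_ball (\<lambda>u. F (x + \<delta> *\<^sub>R u) - F x)" by simp
  have "smoothing unif_ball \<delta> F x - F x = (\<integral>u. F (x + \<delta> *\<^sub>R u) - F x \<partial>unif_ball)"
    using int' by (simp add: smoothing_def)
  also have "\<bar>\<dots>\<bar> \<le> (\<integral>u. \<bar>F (x + \<delta> *\<^sub>R u) - F x\<bar> \<partial>unif_ball)" by (rule integral_abs_bound)
  also have "\<dots> \<le> (\<integral>u. \<delta> * G \<partial>(unif_ball :: 'a measure))"
    by (rule integral_mono_AE) (use AE int in auto)
  finally show ?thesis by simp
qed

text \<open>Under the reflection \<open>u \<mapsto> - u\<close> of the sphere the one-point estimator becomes its mirror image; the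
  average of the two is the two-point estimator.\<close>

lemma sphere_grad_odd:
  fixes F :: "'a::euclidean_space \<Rightarrow> real" and G \<delta> :: real
  assumes F: "G-lipschitz_on UNIV F"
  shows "sphere_grad \<delta> F x = (\<integral>u. (DIM('a) / (2 * \<delta>) * (F (x + \<delta> *\<^sub>R u) - F (x - \<delta> *\<^sub>R u))) *\<^sub>R u \<partial>unif_sphere)"
proof (rule euclidean_eqI)
  note [measurable] = borel_measurable_lipschitz[OF F]
  fix b :: 'a assume "b \<in> Basis"
  define I where "I \<sigma> = (\<integral>u. DIM('a) / \<delta> * F (x + (\<sigma> * \<delta>) *\<^sub>R u) * (u \<bullet> b) \<partial>unif_sphere)" for \<sigma> :: real
  have i: "integrable unif_sphere (\<lambda>u. (c * F (x + r *\<^sub>R u)) * (u \<bullet> b))" for c r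
    using integrable_inner_left[OF integrable_sphere_grad[OF F, of c x r], of b] by simp
  have i2: "integrable unif_sphere (\<lambda>u. (DIM('a) / (2 * \<delta>) * (F (x + \<delta> *\<^sub>R u) - F (x - \<delta> *\<^sub>R u))) *\<^sub>R u)"
    using Bochner_Integration.integrable_diff[OF integrable_sphere_grad[OF F, of "DIM('a) / (2 * \<delta>)" x \<delta>]
        integrable_sphere_grad[OF F, of "DIM('a) / (2 * \<delta>)" x "- \<delta>"]]
    by (simp add: algebra_simps)
  have "I (-1) = - I 1"
  proof -
    have "I (-1) = (\<integral>v. DIM('a) / \<delta> * F (x + (-1 * \<delta>) *\<^sub>R sgn v) * (sgn v \<bullet> b) \<partial>unif_ball)"
      unfolding I_def by (subst integral_unif_sphere) simp_all
    also have "\<dots> = (\<integral>v. - (DIM('a) / \<delta> * F (x + (1 * \<delta>) *\<^sub>R sgn v) * (sgn v \<bullet> b)) \<partial>unif_ball)"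
      by (subst unif_ball_reflect[symmetric]) (simp_all add: sgn_minus)
    also have "\<dots> = - I 1"
      unfolding I_def by (subst integral_unif_sphere) simp_all
    finally show ?thesis .
  qed
  moreover have "(\<integral>u. (DIM('a) / (2 * \<delta>) * (F (x + \<delta> *\<^sub>R u) - F (x - \<delta> *\<^sub>R u))) *\<^sub>R u \<partial>unif_sphere) \<bullet> b = (I 1 - I (-1)) / 2"
  proof -
    have "(\<integral>u. (DIM('a) / (2 * \<delta>) * (F (x + \<delta> *\<^sub>R u) - F (x - \<delta> *\<^sub>R u))) *\<^sub>R u \<partial>unif_sphere) \<bullet> b =
      (\<integral>u. (DIM('a) / \<delta> * F (x + (1 * \<delta>) *\<^sub>R u) * (u \<bullet> b) - DIM('a) / \<delta> * F (x + (-1 * \<delta>) *\<^sub>R u) * (u \<bullet> b)) / 2 \<partial>unif_sphere)"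
      unfolding integral_inner_left[OF i2, symmetric] by (rule Bochner_Integration.integral_cong) (simp_all add: right_diff_distrib left_diff_distrib diff_divide_distrib mult_ac)
    also have "\<dots> = (I 1 - I (-1)) / 2"
      unfolding I_def using i[of "DIM('a) / \<delta>" "1 * \<delta>"] i[of "DIM('a) / \<delta>" "-1 * \<delta>"]
      by (simp only: integral_divide_zero Bochner_Integration.integral_diff)
    finally show ?thesis .
  qed
  moreover have "sphere_grad \<delta> F x \<bullet> b = I 1"
    unfolding sphere_grad_def I_def
    by (subst integral_inner_left[OF integrable_sphere_grad[OF F], symmetric]) simp
  ultimately show "sphere_grad \<delta> F x \<bullet> b = (\<integral>u. (DIM('a) / (2 * \<delta>) * (F (x + \<delta> *\<^sub>R u) - F (x - \<delta> *\<^sub>R u))) *\<^sub>R u \<partial>unif_sphere) \<bullet> b"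
    by simp
qed


section \<open>Sums of independent centred vectors\<close>

lemma (in prob_space) nn_integral_norm_add_centered_sq:
  fixes Z :: "'a \<Rightarrow> 'b::euclidean_space"
  assumes [measurable]: "Z \<in> borel_measurable M" and int: "integrable M Z" and mean: "(\<integral>y. Z y \<partial>M) = 0"
  shows "(\<integral>\<^sup>+y. ennreal ((norm (c + Z y))\<^sup>2) \<partial>M) \<le> ennreal ((norm c)\<^sup>2) + (\<integral>\<^sup>+y. ennreal ((norm (Z y))\<^sup>2) \<partial>M)"
proof (cases "(\<integral>\<^sup>+y. ennreal ((norm (Z y))\<^sup>2) \<partial>M) < \<infinity>")
  case True
  then have sq: "integrable M (\<lambda>y. (norm (Z y))\<^sup>2)"
    by (intro integrableI_bounded) auto
  have eq: "(norm (c + Z y))\<^sup>2 = (norm c)\<^sup>2 + 2 * (c \<bullet> Z y) + (norm (Z y))\<^sup>2" for y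
    by (simp add: power2_norm_eq_inner inner_add_left inner_add_right inner_commute)
  have intc: "integrable M (\<lambda>y. 2 * (c \<bullet> Z y))" using int by simp
  have "(\<integral>y. (norm (c + Z y))\<^sup>2 \<partial>M) = (norm c)\<^sup>2 + (\<integral>y. (norm (Z y))\<^sup>2 \<partial>M)"
    unfolding eq using int sq intc mean by (simp add: prob_space)
  moreover have "integrable M (\<lambda>y. (norm (c + Z y))\<^sup>2)"
    unfolding eq using sq intc by simp
  ultimately show ?thesis
    using sq by (simp add: nn_integral_eq_integral flip: ennreal_plus)
next
  case False
  then have "(\<integral>\<^sup>+y. ennreal ((norm (Z y))\<^sup>2) \<partial>M) = \<infinity>" by (simp flip: less_top)
  then show ?thesis by simp
qed

text \<open>Second moments of independent centred vectors add up. With a deterministic starting vector \<open>a\<close> the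
  statement is its own induction hypothesis: the integral over one factor adds the second moment of
  that factor, whatever the others are.\<close>

lemma (in product_sigma_finite) nn_integral_norm_sum_sq:
  fixes Z :: "'i \<Rightarrow> 'a \<Rightarrow> 'b::euclidean_space"
  assumes "finite I" and prob: "\<And>i. prob_space (M i)"
    and "\<And>i. i \<in> I \<Longrightarrow> integrable (M i) (Z i)" "\<And>i. i \<in> I \<Longrightarrow> (\<integral>y. Z i y \<partial>M i) = 0"
    and "\<And>i. i \<in> I \<Longrightarrow> (\<integral>\<^sup>+y. ennreal ((norm (Z i y))\<^sup>2) \<partial>M i) \<le> v i"
  shows "(\<integral>\<^sup>+w. ennreal ((norm (a + (\<Sum>i\<in>I. Z i (w i))))\<^sup>2) \<partial>PiM I M) \<le> ennreal ((norm a)\<^sup>2) + (\<Sum>i\<in>I. v i)"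
  using assms(1,3-)
proof (induction I arbitrary: a)
  case empty
  then show ?case by (simp add: PiM_empty)
next
  case (insert i I)
  have [measurable]: "Z j \<in> borel_measurable (M j)" if "j \<in> insert i I" for j
    using insert.prems(1)[OF that] by simp
  interpret i: prob_space "M i" by (rule prob)
  interpret PI: prob_space "PiM I M" by (rule prob_space_PiM) (rule prob)
  have eq: "(\<Sum>j\<in>insert i I. Z j ((x(i := y)) j)) = Z i y + (\<Sum>j\<in>I. Z j (x j))" for x y
    using insert.hyps by (simp add: sum.insert) (intro sum.cong, auto)
  have "(\<integral>\<^sup>+w. ennreal ((norm (a + (\<Sum>j\<in>insert i I. Z j (w j))))\<^sup>2) \<partial>PiM (insert i I) M)
    = (\<integral>\<^sup>+x. \<integral>\<^sup>+y. ennreal ((norm ((a + (\<Sum>j\<in>I. Z j (x j))) + Z i y))\<^sup>2) \<partial>M i \<partial>PiM I M)"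
  proof (subst product_nn_integral_insert[OF insert.hyps])
    show "(\<lambda>w. ennreal ((norm (a + (\<Sum>j\<in>insert i I. Z j (w j))))\<^sup>2)) \<in> borel_measurable (PiM (insert i I) M)"
      by measurable
  qed (simp only: eq add_ac)
  also have "\<dots> \<le> (\<integral>\<^sup>+x. ennreal ((norm (a + (\<Sum>j\<in>I. Z j (x j))))\<^sup>2) + v i \<partial>PiM I M)"
  proof (intro nn_integral_mono)
    fix x
    have "(\<integral>\<^sup>+y. ennreal ((norm ((a + (\<Sum>j\<in>I. Z j (x j))) + Z i y))\<^sup>2) \<partial>M i)
       \<le> ennreal ((norm (a + (\<Sum>j\<in>I. Z j (x j))))\<^sup>2) + (\<integral>\<^sup>+y. ennreal ((norm (Z i y))\<^sup>2) \<partial>M i)"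
      using insert.prems by (intro i.nn_integral_norm_add_centered_sq) auto
    also have "\<dots> \<le> ennreal ((norm (a + (\<Sum>j\<in>I. Z j (x j))))\<^sup>2) + v i"
      using insert.prems by (intro add_left_mono) auto
    finally show "(\<integral>\<^sup>+y. ennreal ((norm ((a + (\<Sum>j\<in>I. Z j (x j))) + Z i y))\<^sup>2) \<partial>M i)
       \<le> ennreal ((norm (a + (\<Sum>j\<in>I. Z j (x j))))\<^sup>2) + v i" .
  qed
  also have "\<dots> = (\<integral>\<^sup>+x. ennreal ((norm (a + (\<Sum>j\<in>I. Z j (x j))))\<^sup>2) \<partial>PiM I M) + v i"
    using insert.hyps by (subst nn_integral_add) (auto simp: PI.emeasure_space_1)
  also have "\<dots> \<le> (ennreal ((norm a)\<^sup>2) + (\<Sum>i\<in>I. v i)) + v i"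
    using insert by (intro add_right_mono insert.IH) auto
  finally show ?case using insert.hyps by (simp add: add_ac)
qed


section \<open>The standard Gaussian measure\<close>

text \<open>The density exhibits the rotation invariance; the description as a product measure in
  \<open>gaussian_eq_distr\<close> gives the moments.\<close>

definition gaussian :: "'a::euclidean_space measure" where
  "gaussian = density lborel (\<lambda>x. ennreal (\<Prod>b\<in>Basis. std_normal_density (x \<bullet> b)))"

abbreviation std_normal :: "real measure" where
  "std_normal \<equiv> density lborel std_normal_density"

lemma prob_space_std_normal: "prob_space std_normal"
  by (rule prob_space_normal_density) simp

lemma product_sigma_finite_std_normal: "product_sigma_finite (\<lambda>_. std_normal)"
  unfolding product_sigma_finite_def
  by (intro allI prob_space_imp_sigma_finite prob_space_std_normal)

lemma product_sigma_finite_lborel: "product_sigma_finite (\<lambda>_. lborel :: real measure)"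
  unfolding product_sigma_finite_def by (intro allI sigma_finite_lborel)

lemma PiM_std_normal:
  assumes "finite I"
  shows "(\<Pi>\<^sub>M i\<in>I. std_normal) = density (\<Pi>\<^sub>M i\<in>I. lborel) (\<lambda>x. ennreal (\<Prod>i\<in>I. std_normal_density (x i)))"
proof -
  interpret N: product_sigma_finite "\<lambda>_. std_normal" by (rule product_sigma_finite_std_normal)
  interpret L: product_sigma_finite "\<lambda>_. lborel :: real measure" by (rule product_sigma_finite_lborel)
  show ?thesis
  proof (rule N.PiM_eqI[OF assms, symmetric])
    show "sets (density (\<Pi>\<^sub>M i\<in>I. lborel) (\<lambda>x. ennreal (\<Prod>i\<in>I. std_normal_density (x i)))) = sets (\<Pi>\<^sub>M i\<in>I. std_normal)"
      unfolding sets_density by (intro sets_PiM_cong) auto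
    fix A assume A: "\<And>i. i \<in> I \<Longrightarrow> A i \<in> sets std_normal"
    then have A'[measurable]: "\<And>i. i \<in> I \<Longrightarrow> A i \<in> sets borel" by simp
    have [measurable]: "Pi\<^sub>E I A \<in> sets (\<Pi>\<^sub>M i\<in>I. lborel)"
      using A' assms by (intro sets_PiM_I_finite) auto
    have "emeasure (density (\<Pi>\<^sub>M i\<in>I. lborel) (\<lambda>x. ennreal (\<Prod>i\<in>I. std_normal_density (x i)))) (Pi\<^sub>E I A)
      = (\<integral>\<^sup>+x. ennreal (\<Prod>i\<in>I. std_normal_density (x i)) * indicator (Pi\<^sub>E I A) x \<partial>(\<Pi>\<^sub>M i\<in>I. lborel))"
      by (subst emeasure_density) auto
    also have "\<dots> = (\<integral>\<^sup>+x. (\<Prod>i\<in>I. ennreal (std_normal_density (x i)) * indicator (A i) (x i)) \<partial>(\<Pi>\<^sub>M i\<in>I. lborel))"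
    proof (rule nn_integral_cong)
      fix x :: "'a \<Rightarrow> real" assume "x \<in> space (\<Pi>\<^sub>M i\<in>I. lborel)"
      then have ext: "x \<in> extensional I" by (simp add: space_PiM PiE_def)
      have "(\<Prod>i\<in>I. indicator (A i) (x i) :: ennreal) = indicator (Pi\<^sub>E I A) x"
      proof (cases "x \<in> Pi\<^sub>E I A")
        case True then show ?thesis by (auto simp: PiE_def Pi_def intro!: prod.neutral)
      next
        case False
        then obtain i where "i \<in> I" "x i \<notin> A i" using ext by (auto simp: PiE_def)
        then have "(\<Prod>i\<in>I. indicator (A i) (x i) :: ennreal) = 0"
          using assms by (intro prod_zero) (auto intro!: bexI[of _ i])
        with False show ?thesis by simp
      qed
      then show "ennreal (\<Prod>i\<in>I. std_normal_density (x i)) * indicator (Pi\<^sub>E I A) x =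
        (\<Prod>i\<in>I. ennreal (std_normal_density (x i)) * indicator (A i) (x i))"
        by (simp add: prod.distrib prod_ennreal)
    qed
    also have "\<dots> = (\<Prod>i\<in>I. \<integral>\<^sup>+x. ennreal (std_normal_density x) * indicator (A i) x \<partial>lborel)"
      by (intro L.product_nn_integral_prod assms) measurable
    also have "\<dots> = (\<Prod>i\<in>I. emeasure std_normal (A i))"
      using A' by (intro prod.cong refl) (simp add: emeasure_density)
    finally show "emeasure (density (\<Pi>\<^sub>M i\<in>I. lborel) (\<lambda>x. ennreal (\<Prod>i\<in>I. std_normal_density (x i)))) (Pi\<^sub>E I A)
      = (\<Prod>i\<in>I. emeasure std_normal (A i))" .
  qed
qed

lemma gaussian_eq_distr:
  "(gaussian :: 'a::euclidean_space measure) = distr (\<Pi>\<^sub>M b\<in>Basis. std_normal) borel (\<lambda>f. \<Sum>b\<in>Basis. f b *\<^sub>R b)"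
proof -
  let ?L = "\<Pi>\<^sub>M b\<in>(Basis::'a set). (lborel :: real measure)"
  have "(gaussian :: 'a measure) = density (distr ?L borel (\<lambda>f. \<Sum>b\<in>Basis. f b *\<^sub>R b)) (\<lambda>x. ennreal (\<Prod>b\<in>Basis. std_normal_density (x \<bullet> b)))"
    unfolding gaussian_def by (rule arg_cong2[where f=density, OF lborel_eq refl])
  also have "\<dots> = distr (density ?L (\<lambda>f. ennreal (\<Prod>b\<in>Basis. std_normal_density ((\<Sum>b\<in>Basis. f b *\<^sub>R b) \<bullet> b)))) borel (\<lambda>f. \<Sum>b\<in>Basis. f b *\<^sub>R b)"
    by (rule density_distr) measurable
  finally show ?thesis
    by (simp add: PiM_std_normal)
qed

lemma sets_gaussian [simp, measurable_cong]: "sets gaussian = sets borel"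
  and space_gaussian [simp]: "space gaussian = UNIV"
  by (simp_all add: gaussian_def)

lemma prob_space_gaussian: "prob_space (gaussian :: 'a::euclidean_space measure)"
proof -
  interpret P: prob_space "\<Pi>\<^sub>M b\<in>(Basis::'a set). std_normal"
    by (rule prob_space_PiM) (rule prob_space_std_normal)
  have "(\<lambda>f. \<Sum>b\<in>(Basis::'a set). f b *\<^sub>R b) \<in> borel_measurable (\<Pi>\<^sub>M b\<in>(Basis::'a set). std_normal)"
    by measurable
  then show ?thesis unfolding gaussian_eq_distr by (rule P.prob_space_distr)
qed

lemma nn_integral_gaussian_distr:
  assumes [measurable]: "q \<in> borel_measurable borel"
  shows "(\<integral>\<^sup>+x. q x \<partial>gaussian) = (\<integral>\<^sup>+f. q (\<Sum>b\<in>Basis. f b *\<^sub>R b) \<partial>(\<Pi>\<^sub>M b\<in>(Basis::'a::euclidean_space set). std_normal))"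
  unfolding gaussian_eq_distr
  by (subst nn_integral_distr) measurable

lemma std_normal_moments:
  shows "integrable std_normal (\<lambda>y. c * y)" "(\<integral>y. c * y \<partial>std_normal) = 0"
    "integrable std_normal (\<lambda>y. y\<^sup>2 - 1)" "(\<integral>y. y\<^sup>2 - 1 \<partial>std_normal) = 0"
    "(\<integral>\<^sup>+y. ennreal ((c * y)\<^sup>2) \<partial>std_normal) = ennreal (c\<^sup>2)"
    "(\<integral>\<^sup>+y. ennreal ((y\<^sup>2 - 1)\<^sup>2) \<partial>std_normal) = 2"
proof -
  interpret N: prob_space std_normal by (rule prob_space_std_normal)
  have [simp]: "N.prob UNIV = 1" using N.prob_space by simp
  have i: "integrable std_normal (\<lambda>y. y ^ k)" for k
    using integrable_std_normal_moment[of k] by (subst integrable_density) auto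
  have e: "(\<integral>y. y ^ k \<partial>std_normal) = (\<integral>y. std_normal_density y * y ^ k \<partial>lborel)" for k
    by (subst integral_density) auto
  have m1: "(\<integral>y. y \<partial>std_normal) = 0" using e[of 1] integral_std_normal_moment_odd[of 0] by simp
  have m2: "(\<integral>y. y\<^sup>2 \<partial>std_normal) = 1" using e[of 2] integral_std_normal_moment_even[of 1] by simp
  have m4: "(\<integral>y. y ^ 4 \<partial>std_normal) = 3" using e[of 4] integral_std_normal_moment_even[of 2] by (simp add: fact_numeral)
  show "integrable std_normal (\<lambda>y. c * y)" "(\<integral>y. c * y \<partial>std_normal) = 0"
    using i[of 1] m1 by simp_all
  show "integrable std_normal (\<lambda>y. y\<^sup>2 - 1)" "(\<integral>y. y\<^sup>2 - 1 \<partial>std_normal) = 0"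
    using i[of 2] m2 by (simp_all)
  show "(\<integral>\<^sup>+y. ennreal ((c * y)\<^sup>2) \<partial>std_normal) = ennreal (c\<^sup>2)"
    using i[of 2] m2 by (subst nn_integral_eq_integral) (simp_all add: power_mult_distrib)
  have eq: "(y\<^sup>2 - 1)\<^sup>2 = y ^ 4 - 2 * y\<^sup>2 + 1" for y :: real
    by (simp add: power2_eq_square power4_eq_xxxx algebra_simps)
  have "(\<integral>y. (y\<^sup>2 - 1)\<^sup>2 \<partial>std_normal) = 2"
    unfolding eq using i[of 2] i[of 4] m2 m4 by simp
  moreover have "integrable std_normal (\<lambda>y. (y\<^sup>2 - 1)\<^sup>2)"
    unfolding eq using i[of 2] i[of 4] by simp
  ultimately show "(\<integral>\<^sup>+y. ennreal ((y\<^sup>2 - 1)\<^sup>2) \<partial>std_normal) = 2"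
    by (subst nn_integral_eq_integral) simp_all
qed

lemma norm_sq_eq_sum: "(norm (x::'a::euclidean_space))\<^sup>2 = (\<Sum>b\<in>Basis. (x \<bullet> b)\<^sup>2)"
  unfolding power2_norm_eq_inner by (subst euclidean_inner) (simp add: power2_eq_square)

lemma gaussian_inner_second_moment:
  "(\<integral>\<^sup>+y. ennreal ((g \<bullet> y)\<^sup>2) \<partial>gaussian) \<le> ennreal ((norm (g::'a::euclidean_space))\<^sup>2)"
proof -
  interpret N: product_sigma_finite "\<lambda>_::'a. std_normal" by (rule product_sigma_finite_std_normal)
  have "(\<integral>\<^sup>+y. ennreal ((g \<bullet> y)\<^sup>2) \<partial>gaussian) =
    (\<integral>\<^sup>+f. ennreal ((norm (0 + (\<Sum>b\<in>Basis. (g \<bullet> b) * f b)))\<^sup>2) \<partial>(\<Pi>\<^sub>M b\<in>(Basis::'a set). std_normal))"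
    by (subst nn_integral_gaussian_distr) (simp_all add: inner_sum_right mult.commute)
  also have "\<dots> \<le> ennreal ((norm (0::real))\<^sup>2) + (\<Sum>b\<in>(Basis::'a set). ennreal ((g \<bullet> b)\<^sup>2))"
    by (rule N.nn_integral_norm_sum_sq[OF finite_Basis prob_space_std_normal std_normal_moments(1,2)])
      (simp only: real_norm_def power2_abs std_normal_moments order_refl)
  also have "\<dots> = ennreal ((norm g)\<^sup>2)"
    by (simp add: norm_sq_eq_sum[of g] sum_ennreal)
  finally show ?thesis .
qed

text \<open>The squared norm is a sum of \<open>DIM('a)\<close> independent variables with mean \<open>1\<close> and variance \<open>2\<close>.\<close>

lemma gaussian_norm_concentration:
  "(\<integral>\<^sup>+x. ennreal ((1 - (norm (x::'a::euclidean_space))\<^sup>2 / DIM('a))\<^sup>2) \<partial>gaussian) \<le> ennreal (2 / DIM('a))"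
proof -
  interpret N: product_sigma_finite "\<lambda>_::'a. std_normal" by (rule product_sigma_finite_std_normal)
  have eq: "(1 - (norm (\<Sum>b\<in>Basis. f b *\<^sub>R b :: 'a))\<^sup>2 / DIM('a))\<^sup>2
    = (1 / DIM('a))\<^sup>2 * (norm (0 + (\<Sum>b\<in>(Basis::'a set). (f b)\<^sup>2 - 1)))\<^sup>2" for f :: "'a \<Rightarrow> real"
  proof -
    have "(norm (\<Sum>b\<in>Basis. f b *\<^sub>R b :: 'a))\<^sup>2 = (\<Sum>b\<in>(Basis::'a set). (f b)\<^sup>2)"
      by (subst norm_sq_eq_sum) simp
    then show ?thesis
      by (simp add: sum_subtractf power2_eq_square field_simps)
  qed
  have "(\<integral>\<^sup>+x. ennreal ((1 - (norm (x::'a))\<^sup>2 / DIM('a))\<^sup>2) \<partial>gaussian) =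
    (\<integral>\<^sup>+f. ennreal ((1 / DIM('a))\<^sup>2) * ennreal ((norm (0 + (\<Sum>b\<in>(Basis::'a set). (f b)\<^sup>2 - 1)))\<^sup>2) \<partial>(\<Pi>\<^sub>M b\<in>(Basis::'a set). std_normal))"
    by (subst nn_integral_gaussian_distr) (simp_all only: eq ennreal_mult zero_le_power2, measurable)
  also have "\<dots> = ennreal ((1 / DIM('a))\<^sup>2) * (\<integral>\<^sup>+f. ennreal ((norm (0 + (\<Sum>b\<in>(Basis::'a set). (f b)\<^sup>2 - 1)))\<^sup>2) \<partial>(\<Pi>\<^sub>M b\<in>(Basis::'a set). std_normal))"
    by (rule nn_integral_cmult) measurable
  also have "\<dots> \<le> ennreal ((1 / DIM('a))\<^sup>2) * (ennreal ((norm (0::real))\<^sup>2) + (\<Sum>b\<in>(Basis::'a set). 2))"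
    by (intro mult_left_mono N.nn_integral_norm_sum_sq[OF finite_Basis prob_space_std_normal std_normal_moments(3,4)])
      (simp_all only: real_norm_def power2_abs std_normal_moments order_refl zero_le)
  also have "\<dots> = ennreal (2 / DIM('a))"
    by (simp add: ennreal_of_nat_eq_real_of_nat power2_eq_square field_simps flip: ennreal_numeral ennreal_mult)
  finally show ?thesis .
qed

lemma gaussian_density_eq:
  fixes x :: "'a::euclidean_space"
  shows "(\<Prod>b\<in>Basis. std_normal_density (x \<bullet> b)) = (1 / sqrt (2 * pi)) ^ DIM('a) * exp (- (norm x)\<^sup>2 / 2)"
    by (simp add: norm_sq_eq_sum[of x] std_normal_density_def prod.distrib prod_dividef power_one_over exp_sum[symmetric] sum_negf sum_divide_distrib)

lemma nn_integral_gaussian: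
  assumes [measurable]: "q \<in> borel_measurable borel"
  shows "(\<integral>\<^sup>+x. q x \<partial>gaussian) =
    (\<integral>\<^sup>+x. ennreal ((1 / sqrt (2 * pi)) ^ DIM('a) * exp (- (norm x)\<^sup>2 / 2)) * q (x::'a::euclidean_space) \<partial>lborel)"
  unfolding gaussian_def gaussian_density_eq by (subst nn_integral_density) auto

lemma nn_integral_gaussian_tail: "(\<integral>\<^sup>+r. ennreal (r * exp (- (r\<^sup>2 / 2))) * indicator {\<rho>..} r \<partial>lborel) = ennreal (exp (- (\<rho>\<^sup>2 / 2)))"
  if "\<rho> \<ge> 0" for \<rho> :: real
proof -
  have "(\<integral>\<^sup>+r. ennreal (r * exp (- (r\<^sup>2 / 2))) * indicator {\<rho>..} r \<partial>lborel) = ennreal (0 - (- exp (- (\<rho>\<^sup>2 / 2))))"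
  proof (rule nn_integral_FTC_atLeast)
    show "((\<lambda>r::real. - exp (- (r\<^sup>2 / 2))) \<longlongrightarrow> 0) at_top" by real_asymp
    fix r :: real assume "\<rho> \<le> r"
    then show "0 \<le> r * exp (- (r\<^sup>2 / 2))" using that by simp
    show "((\<lambda>r. - exp (- (r\<^sup>2 / 2))) has_real_derivative r * exp (- (r\<^sup>2 / 2))) (at r)"
      by (auto intro!: derivative_eq_intros)
  qed auto
  then show ?thesis by simp
qed

text \<open>By \<open>nn_integral_gaussian_tail\<close> the Gaussian density is a mixture of indicators of balls centred at the
  origin, and all of these induce the same distribution of the direction.\<close>

theorem nn_integral_gaussian_sgn:
  fixes q :: "'a::euclidean_space \<Rightarrow> ennreal"
  assumes [measurable]: "q \<in> borel_measurable borel"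
  shows "(\<integral>\<^sup>+x. q (sgn x) \<partial>gaussian) = (\<integral>\<^sup>+u. q u \<partial>unif_sphere)"
proof -
  interpret G: prob_space "gaussian :: 'a measure" by (rule prob_space_gaussian)
  define C where "C = (1 / sqrt (2 * pi)) ^ DIM('a)"
  define J where "J q = (\<integral>\<^sup>+x. q (sgn x) * indicator (cball 0 1) x \<partial>lborel)" for q :: "'a \<Rightarrow> ennreal"
  define K where "K = (\<integral>\<^sup>+r. ennreal (C * (r * exp (- (r\<^sup>2 / 2))) * r ^ DIM('a)) * indicator {0<..} r \<partial>lborel)"
  have C: "C \<ge> 0" by (simp add: C_def)
  have main: "(\<integral>\<^sup>+x. q (sgn x) \<partial>gaussian) = K * J q" if [measurable]: "q \<in> borel_measurable borel" for q
  proof -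
    have "(\<integral>\<^sup>+x. q (sgn x) \<partial>gaussian) = (\<integral>\<^sup>+x. ennreal C * ennreal (exp (- ((norm x)\<^sup>2 / 2))) * q (sgn x) \<partial>lborel)"
      using C by (simp add: nn_integral_gaussian C_def[symmetric] ennreal_mult)
    also have "\<dots> = (\<integral>\<^sup>+x. \<integral>\<^sup>+r. ennreal C * (ennreal (r * exp (- (r\<^sup>2 / 2))) * indicator {norm x..} r) * q (sgn x) \<partial>lborel \<partial>lborel)"
    proof (rule nn_integral_cong)
      fix x :: 'a
      have "(\<integral>\<^sup>+r. ennreal C * (ennreal (r * exp (- (r\<^sup>2 / 2))) * indicator {norm x..} r) * q (sgn x) \<partial>lborel)
        = (\<integral>\<^sup>+r. ennreal C * (ennreal (r * exp (- (r\<^sup>2 / 2))) * indicator {norm x..} r) \<partial>lborel) * q (sgn x)"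
        by (rule nn_integral_multc) measurable
      also have "(\<integral>\<^sup>+r. ennreal C * (ennreal (r * exp (- (r\<^sup>2 / 2))) * indicator {norm x..} r) \<partial>lborel)
        = ennreal C * (\<integral>\<^sup>+r. ennreal (r * exp (- (r\<^sup>2 / 2))) * indicator {norm x..} r \<partial>lborel)"
        by (rule nn_integral_cmult) measurable
      finally show "ennreal C * ennreal (exp (- ((norm x)\<^sup>2 / 2))) * q (sgn x)
        = (\<integral>\<^sup>+r. ennreal C * (ennreal (r * exp (- (r\<^sup>2 / 2))) * indicator {norm x..} r) * q (sgn x) \<partial>lborel)"
        by (simp only: nn_integral_gaussian_tail[OF norm_ge_zero])
    qed
    also have "\<dots> = (\<integral>\<^sup>+r. \<integral>\<^sup>+x. ennreal C * (ennreal (r * exp (- (r\<^sup>2 / 2))) * indicator {norm x..} r) * q (sgn x) \<partial>lborel \<partial>lborel)"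
    proof (rule lborel_pair.Fubini')
      have "(\<lambda>(r, x). ennreal C * (ennreal (r * exp (- (r\<^sup>2 / 2))) * (if norm x \<le> r then 1 else 0)) * q (sgn x))
        \<in> borel_measurable (lborel \<Otimes>\<^sub>M lborel)" by measurable
      then show "(\<lambda>(r, x). ennreal C * (ennreal (r * exp (- (r\<^sup>2 / 2))) * indicator {norm x..} r) * q (sgn x))
        \<in> borel_measurable (lborel \<Otimes>\<^sub>M lborel)"
        by (rule measurable_cong[THEN iffD1, rotated]) (auto simp: indicator_def)
    qed
    also have "\<dots> = (\<integral>\<^sup>+r. (ennreal (C * (r * exp (- (r\<^sup>2 / 2))) * r ^ DIM('a)) * indicator {0<..} r) * J q \<partial>lborel)"
    proof (rule nn_integral_cong)
      fix r :: real
      consider "r > 0" | "r = 0" | "r < 0" by linarith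
      then show "(\<integral>\<^sup>+x. ennreal C * (ennreal (r * exp (- (r\<^sup>2 / 2))) * indicator {norm x..} r) * q (sgn x) \<partial>lborel)
        = (ennreal (C * (r * exp (- (r\<^sup>2 / 2))) * r ^ DIM('a)) * indicator {0<..} r) * J q"
      proof cases
        case 1
        have "(\<integral>\<^sup>+x. ennreal C * (ennreal (r * exp (- (r\<^sup>2 / 2))) * indicator {norm x..} r) * q (sgn x) \<partial>lborel)
          = (\<integral>\<^sup>+x. ennreal (C * (r * exp (- (r\<^sup>2 / 2)))) * (q (sgn x) * indicator (cball 0 r) x) \<partial>lborel)"
          using C 1 by (intro nn_integral_cong) (auto simp: indicator_def ennreal_mult)
        also have "\<dots> = ennreal (C * (r * exp (- (r\<^sup>2 / 2)))) * (ennreal (r ^ DIM('a)) * J q)"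
          unfolding J_def by (subst nn_integral_cmult) (simp_all add: nn_integral_sgn_cball[OF _ 1])
        finally show ?thesis using 1 C by (simp add: ennreal_mult mult_ac)
      next
        case 3
        then have "indicator {norm x..} r = (0::ennreal)" for x :: 'a
          by (auto simp: indicator_def not_le intro: less_le_trans)
        with 3 show ?thesis by simp
      qed simp
    qed
    also have "\<dots> = K * J q"
      unfolding K_def by (rule nn_integral_multc) measurable
    finally show ?thesis .
  qed
  define v where "v = ball_vol TYPE('a)"
  have v: "v > 0" unfolding v_def by (rule ball_vol_pos)
  have "J (\<lambda>_. 1) = ennreal v"
    unfolding J_def v_def by (simp add: emeasure_cball_eq)
  moreover have "1 = K * J (\<lambda>_. 1)"
    using main[of "\<lambda>_. 1"] G.emeasure_space_1 by simp
  ultimately have "1 = K * ennreal v" by simp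
  then have "inverse (ennreal v) = K * (ennreal v * inverse (ennreal v))"
    by (metis mult.assoc mult_1)
  also have "ennreal v * inverse (ennreal v) = 1"
    using v by (simp add: inverse_ennreal flip: ennreal_mult)
  finally have K: "inverse (ennreal v) = K" by simp
  have "(\<integral>\<^sup>+u. q u \<partial>unif_sphere) = J q / ennreal v"
    unfolding J_def v_def by (simp add: nn_integral_unif_sphere nn_integral_unif_ball)
  then show ?thesis
    unfolding main[OF assms] divide_ennreal_def K by (simp add: mult.commute)
qed

lemma nn_integral_shear:
  fixes Q :: "'a::euclidean_space \<times> 'a \<Rightarrow> ennreal" and \<alpha> :: real
  assumes [measurable]: "Q \<in> borel_measurable (borel \<Otimes>\<^sub>M borel)"
  shows "(\<integral>\<^sup>+x. \<integral>\<^sup>+y. Q (x, y + \<alpha> *\<^sub>R x) \<partial>lborel \<partial>lborel) = (\<integral>\<^sup>+x. \<integral>\<^sup>+y. Q (x, y) \<partial>lborel \<partial>lborel)"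
    and "(\<integral>\<^sup>+x. \<integral>\<^sup>+y. Q (x + \<alpha> *\<^sub>R y, y) \<partial>lborel \<partial>lborel) = (\<integral>\<^sup>+x. \<integral>\<^sup>+y. Q (x, y) \<partial>lborel \<partial>lborel)"
proof -
  have shift: "(\<integral>\<^sup>+y. f y \<partial>lborel) = (\<integral>\<^sup>+y. f (y + a) \<partial>lborel)"
    if [measurable]: "f \<in> borel_measurable borel" for f :: "'a \<Rightarrow> ennreal" and a
    using nn_integral_lborel_affine[OF that, of 1 a] by (simp add: add.commute)
  show "(\<integral>\<^sup>+x. \<integral>\<^sup>+y. Q (x, y + \<alpha> *\<^sub>R x) \<partial>lborel \<partial>lborel) = (\<integral>\<^sup>+x. \<integral>\<^sup>+y. Q (x, y) \<partial>lborel \<partial>lborel)"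
    by (intro nn_integral_cong shift[symmetric]) measurable
  have "(\<integral>\<^sup>+x. \<integral>\<^sup>+y. Q (x + \<alpha> *\<^sub>R y, y) \<partial>lborel \<partial>lborel) = (\<integral>\<^sup>+y. \<integral>\<^sup>+x. Q (x + \<alpha> *\<^sub>R y, y) \<partial>lborel \<partial>lborel)"
    by (rule lborel_pair.Fubini') measurable
  also have "\<dots> = (\<integral>\<^sup>+y. \<integral>\<^sup>+x. Q (x, y) \<partial>lborel \<partial>lborel)"
    by (intro nn_integral_cong shift[symmetric]) measurable
  also have "\<dots> = (\<integral>\<^sup>+x. \<integral>\<^sup>+y. Q (x, y) \<partial>lborel \<partial>lborel)"
    by (rule lborel_pair.Fubini'[symmetric]) measurable
  finally show "(\<integral>\<^sup>+x. \<integral>\<^sup>+y. Q (x + \<alpha> *\<^sub>R y, y) \<partial>lborel \<partial>lborel) = (\<integral>\<^sup>+x. \<integral>\<^sup>+y. Q (x, y) \<partial>lborel \<partial>lborel)" .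
qed

text \<open>A rotation of the plane by an angle other than \<open>\<pi>\<close> is a product of three shears, and a shear acts as a
  translation on the lines that it preserves.\<close>

lemma nn_integral_lborel_rotate:
  fixes Q :: "'a::euclidean_space \<times> 'a \<Rightarrow> ennreal" and c s :: real
  assumes [measurable]: "Q \<in> borel_measurable (borel \<Otimes>\<^sub>M borel)" and cs: "c\<^sup>2 + s\<^sup>2 = 1" "c \<noteq> -1"
  shows "(\<integral>\<^sup>+x. \<integral>\<^sup>+y. Q (c *\<^sub>R x + s *\<^sub>R y, - s *\<^sub>R x + c *\<^sub>R y) \<partial>lborel \<partial>lborel) = (\<integral>\<^sup>+x. \<integral>\<^sup>+y. Q (x, y) \<partial>lborel \<partial>lborel)"
proof -
  define \<alpha> where "\<alpha> = s / (1 + c)"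
  have c1: "1 + c \<noteq> 0" using cs(2) by linarith
  have "s * s = (1 + c) * (1 - c)" using cs(1) by (simp add: power2_eq_square algebra_simps)
  then have "\<alpha> * s = 1 - c" using c1 by (simp add: \<alpha>_def)
  then have e1: "1 - \<alpha> * s = c" by simp
  have "\<alpha> * (1 + c) = s" using c1 by (simp add: \<alpha>_def)
  then have e2: "\<alpha> + \<alpha> * c = s" by (simp add: algebra_simps)
  define Q1 where "Q1 = (\<lambda>(x, y). Q (x + \<alpha> *\<^sub>R y, y))"
  define Q2 where "Q2 = (\<lambda>(x, y). Q1 (x, y + (- s) *\<^sub>R x))"
  have [measurable]: "Q1 \<in> borel_measurable (borel \<Otimes>\<^sub>M borel)" unfolding Q1_def by measurable
  have [measurable]: "Q2 \<in> borel_measurable (borel \<Otimes>\<^sub>M borel)" unfolding Q2_def by measurable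
  have "Q2 (x + \<alpha> *\<^sub>R y, y) = Q (c *\<^sub>R x + s *\<^sub>R y, - s *\<^sub>R x + c *\<^sub>R y)" for x y
  proof -
    have "c *\<^sub>R y = (1 - \<alpha> * s) *\<^sub>R y" by (simp add: e1)
    then have y: "y + (- s) *\<^sub>R (x + \<alpha> *\<^sub>R y) = - s *\<^sub>R x + c *\<^sub>R y"
      by (simp add: algebra_simps)
    have "(x + \<alpha> *\<^sub>R y) + \<alpha> *\<^sub>R (- s *\<^sub>R x + c *\<^sub>R y) = (1 - \<alpha> * s) *\<^sub>R x + (\<alpha> + \<alpha> * c) *\<^sub>R y"
      by (simp add: algebra_simps)
    then show ?thesis by (simp only: Q2_def Q1_def case_prod_conv y e1 e2)
  qed
  then have "(\<integral>\<^sup>+x. \<integral>\<^sup>+y. Q (c *\<^sub>R x + s *\<^sub>R y, - s *\<^sub>R x + c *\<^sub>R y) \<partial>lborel \<partial>lborel) = (\<integral>\<^sup>+x. \<integral>\<^sup>+y. Q2 (x + \<alpha> *\<^sub>R y, y) \<partial>lborel \<partial>lborel)"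
    by simp
  also have "\<dots> = (\<integral>\<^sup>+x. \<integral>\<^sup>+y. Q2 (x, y) \<partial>lborel \<partial>lborel)" by (rule nn_integral_shear) measurable
  also have "\<dots> = (\<integral>\<^sup>+x. \<integral>\<^sup>+y. Q1 (x, y) \<partial>lborel \<partial>lborel)"
    unfolding Q2_def case_prod_conv by (rule nn_integral_shear) measurable
  also have "\<dots> = (\<integral>\<^sup>+x. \<integral>\<^sup>+y. Q (x, y) \<partial>lborel \<partial>lborel)"
    unfolding Q1_def case_prod_conv by (rule nn_integral_shear) measurable
  finally show ?thesis .
qed

lemma gaussian_rotate:
  fixes q :: "'a::euclidean_space \<times> 'a \<Rightarrow> ennreal" and c s :: real
  assumes [measurable]: "q \<in> borel_measurable (borel \<Otimes>\<^sub>M borel)" and cs: "c\<^sup>2 + s\<^sup>2 = 1" "c \<noteq> -1"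
  shows "(\<integral>\<^sup>+x. \<integral>\<^sup>+y. q (c *\<^sub>R x + s *\<^sub>R y, - s *\<^sub>R x + c *\<^sub>R y) \<partial>gaussian \<partial>gaussian) = (\<integral>\<^sup>+x. \<integral>\<^sup>+y. q (x, y) \<partial>gaussian \<partial>gaussian)"
proof -
  define C where "C = (1 / sqrt (2 * pi)) ^ DIM('a)"
  have C: "C \<ge> 0" by (simp add: C_def)
  have eq: "(\<integral>\<^sup>+x. \<integral>\<^sup>+y. q (x, y) \<partial>gaussian \<partial>gaussian)
    = (\<integral>\<^sup>+x. \<integral>\<^sup>+y. ennreal (C * C * exp (- ((norm x)\<^sup>2 + (norm y)\<^sup>2) / 2)) * q (x, y) \<partial>lborel \<partial>lborel)"
    if [measurable]: "q \<in> borel_measurable (borel \<Otimes>\<^sub>M borel)" for q :: "'a \<times> 'a \<Rightarrow> ennreal"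
  proof -
    interpret G: sigma_finite_measure "gaussian :: 'a measure"
      by (rule prob_space_imp_sigma_finite) (rule prob_space_gaussian)
    define g where "g x = C * exp (- (norm x)\<^sup>2 / 2)" for x :: 'a
    have [measurable]: "g \<in> borel_measurable borel" unfolding g_def by measurable
    have gg: "ennreal (g x) * (ennreal (g y) * z) = ennreal (C * C * exp (- ((norm x)\<^sup>2 + (norm y)\<^sup>2) / 2)) * z" for x y z
    proof -
      have "g x * g y = C * C * exp (- ((norm x)\<^sup>2 + (norm y)\<^sup>2) / 2)"
        unfolding g_def by (simp add: mult_ac add_divide_distrib flip: exp_add)
      moreover have "g x \<ge> 0" "g y \<ge> 0" unfolding g_def using C by auto
      ultimately show ?thesis by (metis ennreal_mult mult.assoc)
    qed
    have "(\<integral>\<^sup>+x. \<integral>\<^sup>+y. q (x, y) \<partial>gaussian \<partial>gaussian) = (\<integral>\<^sup>+x. ennreal (g x) * (\<integral>\<^sup>+y. q (x, y) \<partial>gaussian) \<partial>lborel)"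
      unfolding g_def C_def by (rule nn_integral_gaussian) measurable
    also have "\<dots> = (\<integral>\<^sup>+x. \<integral>\<^sup>+y. ennreal (g x) * (ennreal (g y) * q (x, y)) \<partial>lborel \<partial>lborel)"
    proof (rule nn_integral_cong)
      fix x
      have "(\<integral>\<^sup>+y. q (x, y) \<partial>gaussian) = (\<integral>\<^sup>+y. ennreal (g y) * q (x, y) \<partial>lborel)"
        unfolding g_def C_def by (rule nn_integral_gaussian) measurable
      then show "ennreal (g x) * (\<integral>\<^sup>+y. q (x, y) \<partial>gaussian) = (\<integral>\<^sup>+y. ennreal (g x) * (ennreal (g y) * q (x, y)) \<partial>lborel)"
        by (subst nn_integral_cmult) simp_all
    qed
    finally show ?thesis unfolding gg .
  qed
  have nrm: "(norm (c *\<^sub>R x + s *\<^sub>R y))\<^sup>2 + (norm (- s *\<^sub>R x + c *\<^sub>R y))\<^sup>2 = (norm x)\<^sup>2 + (norm y)\<^sup>2" for x y :: 'a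
  proof -
    have "(norm (c *\<^sub>R x + s *\<^sub>R y))\<^sup>2 + (norm (- s *\<^sub>R x + c *\<^sub>R y))\<^sup>2 = (c\<^sup>2 + s\<^sup>2) * ((norm x)\<^sup>2 + (norm y)\<^sup>2)"
      unfolding power2_norm_eq_inner by (simp add: inner_add_left inner_add_right inner_commute power2_eq_square algebra_simps)
    then show ?thesis using cs by simp
  qed
  define Q where "Q = (\<lambda>(x, y). ennreal (C * C * exp (- ((norm x)\<^sup>2 + (norm y)\<^sup>2) / 2)) * q (x, y))"
  have [measurable]: "Q \<in> borel_measurable (borel \<Otimes>\<^sub>M borel)" unfolding Q_def by measurable
  define q' where "q' = (\<lambda>(x, y). q (c *\<^sub>R x + s *\<^sub>R y, - s *\<^sub>R x + c *\<^sub>R y))"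
  have [measurable]: "q' \<in> borel_measurable (borel \<Otimes>\<^sub>M borel)" unfolding q'_def by measurable
  have "(\<integral>\<^sup>+x. \<integral>\<^sup>+y. q' (x, y) \<partial>gaussian \<partial>gaussian) = (\<integral>\<^sup>+x. \<integral>\<^sup>+y. Q (c *\<^sub>R x + s *\<^sub>R y, - s *\<^sub>R x + c *\<^sub>R y) \<partial>lborel \<partial>lborel)"
    unfolding eq[OF \<open>q' \<in> _\<close>] unfolding Q_def q'_def case_prod_conv nrm ..
  also have "\<dots> = (\<integral>\<^sup>+x. \<integral>\<^sup>+y. Q (x, y) \<partial>lborel \<partial>lborel)"
    by (rule nn_integral_lborel_rotate[OF _ cs]) measurable
  also have "\<dots> = (\<integral>\<^sup>+x. \<integral>\<^sup>+y. q (x, y) \<partial>gaussian \<partial>gaussian)"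
    unfolding eq[OF assms(1)] Q_def case_prod_conv ..
  finally show ?thesis unfolding q'_def case_prod_conv .
qed


section \<open>Antipodal differences of Lipschitz functions\<close>

text \<open>The Cauchy-Schwarz inequality, as nonnegativity of the variance of \<open>p\<close> on the interval.\<close>

lemma integral_square_le:
  fixes p :: "real \<Rightarrow> real"
  assumes "a < b" and cont: "continuous_on {a..b} p"
  shows "ennreal ((\<integral>t. p t * indicator {a..b} t \<partial>lborel)\<^sup>2) \<le> (\<integral>\<^sup>+t. ennreal ((b - a) * (p t)\<^sup>2) * indicator {a..b} t \<partial>lborel)"
proof -
  define I where "I = (\<integral>t. p t * indicator {a..b} t \<partial>lborel)"
  define m where "m = I / (b - a)"
  have int: "integrable lborel (\<lambda>t. q t * indicator {a..b} t)" if "continuous_on {a..b} q" for q :: "real \<Rightarrow> real"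
    using borel_integrable_atLeastAtMost'[OF that] by (simp add: set_integrable_def mult.commute)
  have i1: "integrable lborel (\<lambda>t. p t * indicator {a..b} t)" by (rule int[OF cont])
  have i2: "integrable lborel (\<lambda>t. (p t)\<^sup>2 * indicator {a..b} t)" by (intro int continuous_intros cont)
  have i3: "integrable lborel (\<lambda>t. indicator {a..b} t :: real)" using int[of "\<lambda>_. 1"] by simp
  have "0 \<le> (\<integral>t. (p t - m)\<^sup>2 * indicator {a..b} t \<partial>lborel)"
    by (intro integral_nonneg_AE AE_I2) auto
  also have "\<dots> = (\<integral>t. (p t)\<^sup>2 * indicator {a..b} t - 2 * m * (p t * indicator {a..b} t) + m\<^sup>2 * indicator {a..b} t \<partial>lborel)"
    by (rule Bochner_Integration.integral_cong) (simp_all add: power2_eq_square algebra_simps)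
  also have "\<dots> = (\<integral>t. (p t)\<^sup>2 * indicator {a..b} t \<partial>lborel) - 2 * m * I + m\<^sup>2 * (b - a)"
    using i1 i2 i3 \<open>a < b\<close> by (simp add: I_def)
  also have "\<dots> = (\<integral>t. (p t)\<^sup>2 * indicator {a..b} t \<partial>lborel) - I\<^sup>2 / (b - a)"
  proof -
    have "m * (b - a) = I" using \<open>a < b\<close> by (simp add: m_def)
    then have "m\<^sup>2 * (b - a) = m * I" by (simp add: power2_eq_square mult.assoc)
    moreover have "m * I = I\<^sup>2 / (b - a)" by (simp add: m_def power2_eq_square)
    ultimately show ?thesis by simp
  qed
  finally have "I\<^sup>2 \<le> (b - a) * (\<integral>t. (p t)\<^sup>2 * indicator {a..b} t \<partial>lborel)"
    using \<open>a < b\<close> by (simp add: field_simps)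
  also have "\<dots> = (\<integral>t. (b - a) * ((p t)\<^sup>2 * indicator {a..b} t) \<partial>lborel)" by simp
  finally have "ennreal (I\<^sup>2) \<le> ennreal (\<integral>t. (b - a) * ((p t)\<^sup>2 * indicator {a..b} t) \<partial>lborel)"
    by (rule ennreal_leI)
  also have "\<dots> = (\<integral>\<^sup>+t. ennreal ((b - a) * ((p t)\<^sup>2 * indicator {a..b} t)) \<partial>lborel)"
    using i2 \<open>a < b\<close> by (intro nn_integral_eq_integral[symmetric]) auto
  also have "\<dots> = (\<integral>\<^sup>+t. ennreal ((b - a) * (p t)\<^sup>2) * indicator {a..b} t \<partial>lborel)"
    by (intro nn_integral_cong) (auto simp: indicator_def)
  finally show ?thesis unfolding I_def .
qed

lemma GDERIV_compose_curve:
  fixes h :: "'a::euclidean_space \<Rightarrow> real"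
  assumes "GDERIV h (c t) :> g" and "(c has_derivative (\<lambda>s. s *\<^sub>R v)) (at t)"
  shows "((\<lambda>t. h (c t)) has_real_derivative g \<bullet> v) (at t)"
proof -
  have "((\<lambda>t. h (c t)) has_derivative (\<lambda>s. (s *\<^sub>R v) \<bullet> g)) (at t)"
    using assms(2,1) unfolding gderiv_def by (rule has_derivative_compose)
  then show ?thesis
    unfolding has_field_derivative_def by (rule has_derivative_eq_rhs) (auto simp: fun_eq_iff inner_commute mult.commute)
qed

text \<open>The great circle argument of Maurey and Pisier. The path \<open>cos t * x + sin t * y\<close> runs from \<open>x\<close> to \<open>- x\<close>
  as \<open>t\<close> runs from \<open>0\<close> to \<open>\<pi>\<close>. By rotation invariance its position and velocity are distributed like the
  independent pair \<open>(x, y)\<close>, and the derivative \<open>g x \<bullet> y\<close> of \<open>h\<close> along the path has conditional second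
  moment \<open>(norm (g x))\<^sup>2\<close>: a single direction counts, not all \<open>DIM('a)\<close> of them.\<close>

lemma antipodal_gaussian_bound:
  fixes h :: "'a::euclidean_space \<Rightarrow> real"
  assumes deriv: "\<And>x. GDERIV h x :> g x" and cont: "continuous_on UNIV g" and bound: "\<And>x. norm (g x) \<le> L"
  shows "(\<integral>\<^sup>+x. ennreal ((h x - h (- x))\<^sup>2) \<partial>gaussian) \<le> ennreal (pi\<^sup>2 * L\<^sup>2)"
proof -
  have [measurable]: "g \<in> borel_measurable borel" using cont by (rule borel_measurable_continuous_onI)
  have L: "L \<ge> 0" using bound[of 0] norm_ge_zero order_trans by blast
  have "continuous_on UNIV h"
    using deriv unfolding gderiv_def by (intro has_derivative_continuous_on) (auto intro: has_derivative_at_withinI)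
  then have [measurable]: "h \<in> borel_measurable borel" by (rule borel_measurable_continuous_onI)
  interpret G: prob_space "gaussian :: 'a measure" by (rule prob_space_gaussian)
  interpret GG: pair_prob_space "gaussian :: 'a measure" "gaussian :: 'a measure" ..
  interpret GL: pair_sigma_finite "lborel :: real measure" "gaussian \<Otimes>\<^sub>M gaussian :: ('a \<times> 'a) measure" ..
  have [measurable]: "(cos :: real \<Rightarrow> real) \<in> borel_measurable borel" "(sin :: real \<Rightarrow> real) \<in> borel_measurable borel"
    by (intro borel_measurable_continuous_onI continuous_intros)+
  define q where "q = (\<lambda>(x, y). ennreal (pi * (g x \<bullet> y)\<^sup>2) :: ennreal)"
  have q[measurable]: "q \<in> borel_measurable (borel \<Otimes>\<^sub>M borel)" unfolding q_def by measurable
  define r where "r t z = q (cos t *\<^sub>R fst z + sin t *\<^sub>R snd z, - sin t *\<^sub>R fst z + cos t *\<^sub>R snd z) * indicator {0..pi} t" for t :: real and z :: "'a \<times> 'a"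
  have [measurable]: "case_prod r \<in> borel_measurable (borel \<Otimes>\<^sub>M (borel \<Otimes>\<^sub>M borel))" unfolding r_def by measurable
  have pw: "ennreal ((h x - h (- x))\<^sup>2) \<le> (\<integral>\<^sup>+t. r t (x, y) \<partial>lborel)" for x y
  proof -
    let ?X = "\<lambda>t. cos t *\<^sub>R x + sin t *\<^sub>R y" and ?Y = "\<lambda>t. - sin t *\<^sub>R x + cos t *\<^sub>R y"
    let ?p = "\<lambda>t. g (?X t) \<bullet> ?Y t"
    have contp: "continuous_on {0..pi} ?p"
      by (intro continuous_intros continuous_on_compose2[OF cont]) auto
    have d: "((\<lambda>t. h (?X t)) has_real_derivative ?p t) (at t)" for t
    proof -
      have "(?X has_derivative (\<lambda>s. s *\<^sub>R ?Y t)) (at t)"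
        by (auto intro!: derivative_eq_intros simp: algebra_simps)
      with deriv show ?thesis by (rule GDERIV_compose_curve)
    qed
    have "(\<integral>t. ?p t * indicator {0..pi} t \<partial>lborel) = h (?X pi) - h (?X 0)"
    proof (rule integral_FTC_Icc_real)
      fix t :: real assume "0 \<le> t" "t \<le> pi"
      show "((\<lambda>t. h (?X t)) has_real_derivative ?p t) (at t)" by (rule d)
      have "continuous_on UNIV ?p" by (intro continuous_intros continuous_on_compose2[OF cont]) auto
      then show "isCont ?p t" by (simp add: continuous_on_eq_continuous_at)
    qed simp
    then have "(\<integral>t. ?p t * indicator {0..pi} t \<partial>lborel)\<^sup>2 = (h x - h (- x))\<^sup>2"
      by (simp add: power2_commute)
    moreover have "(\<integral>\<^sup>+t. ennreal ((pi - 0) * (?p t)\<^sup>2) * indicator {0..pi} t \<partial>lborel) = (\<integral>\<^sup>+t. r t (x, y) \<partial>lborel)"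
      by (simp add: r_def q_def)
    ultimately show ?thesis using integral_square_le[OF pi_gt_zero contp] by metis
  qed
  have inner: "(\<integral>\<^sup>+x. \<integral>\<^sup>+y. q (x, y) \<partial>gaussian \<partial>gaussian) \<le> ennreal (pi * L\<^sup>2)"
  proof -
    have "(\<integral>\<^sup>+x. \<integral>\<^sup>+y. q (x, y) \<partial>gaussian \<partial>gaussian) \<le> (\<integral>\<^sup>+x. ennreal (pi * L\<^sup>2) \<partial>(gaussian :: 'a measure))"
    proof (rule nn_integral_mono)
      fix x
      have "(\<integral>\<^sup>+y. q (x, y) \<partial>gaussian) = ennreal pi * (\<integral>\<^sup>+y. ennreal ((g x \<bullet> y)\<^sup>2) \<partial>gaussian)"
        by (simp add: q_def ennreal_mult nn_integral_cmult)
      also have "\<dots> \<le> ennreal pi * ennreal ((norm (g x))\<^sup>2)"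
        by (intro mult_left_mono gaussian_inner_second_moment) auto
      also have "\<dots> \<le> ennreal pi * ennreal (L\<^sup>2)"
        by (intro mult_left_mono ennreal_leI power_mono bound) auto
      finally show "(\<integral>\<^sup>+y. q (x, y) \<partial>gaussian) \<le> ennreal (pi * L\<^sup>2)" by (simp add: ennreal_mult)
    qed
    then show ?thesis by (simp add: G.emeasure_space_1[simplified])
  qed
  have "(\<integral>\<^sup>+x. ennreal ((h x - h (- x))\<^sup>2) \<partial>gaussian) = (\<integral>\<^sup>+x. \<integral>\<^sup>+y. ennreal ((h x - h (- x))\<^sup>2) \<partial>(gaussian :: 'a measure) \<partial>gaussian)"
    by (simp add: G.emeasure_space_1[simplified])
  also have "\<dots> \<le> (\<integral>\<^sup>+x. \<integral>\<^sup>+y. \<integral>\<^sup>+t. r t (x, y) \<partial>lborel \<partial>gaussian \<partial>gaussian)"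
    by (intro nn_integral_mono pw)
  also have "\<dots> = (\<integral>\<^sup>+z. \<integral>\<^sup>+t. r t z \<partial>lborel \<partial>(gaussian \<Otimes>\<^sub>M gaussian))"
    by (rule G.nn_integral_fst) measurable
  also have "\<dots> = (\<integral>\<^sup>+t. \<integral>\<^sup>+z. r t z \<partial>(gaussian \<Otimes>\<^sub>M gaussian) \<partial>lborel)"
    by (rule GL.Fubini') measurable
  also have "\<dots> \<le> (\<integral>\<^sup>+t. ennreal (pi * L\<^sup>2) * indicator {0..pi} t \<partial>lborel)"
  proof (rule nn_integral_mono_AE)
    \<comment> \<open>The rotation by \<open>\<pi>\<close> is not a product of three shears.\<close>
    have "AE t in lborel. t \<noteq> pi" by (rule AE_lborel_singleton)
    then show "AE t in lborel. (\<integral>\<^sup>+z. r t z \<partial>(gaussian \<Otimes>\<^sub>M gaussian)) \<le> ennreal (pi * L\<^sup>2) * indicator {0..pi} t"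
    proof eventually_elim
      case (elim t)
      show ?case
      proof (cases "t \<in> {0..pi}")
        case True
        have "cos t \<noteq> -1"
          using True elim cos_monotone_0_pi[of t pi] by auto
        have "(\<integral>\<^sup>+z. r t z \<partial>(gaussian \<Otimes>\<^sub>M gaussian)) = (\<integral>\<^sup>+x. \<integral>\<^sup>+y. r t (x, y) \<partial>gaussian \<partial>gaussian)"
          by (rule G.nn_integral_fst[symmetric]) measurable
        also have "\<dots> = (\<integral>\<^sup>+x. \<integral>\<^sup>+y. q (cos t *\<^sub>R x + sin t *\<^sub>R y, - sin t *\<^sub>R x + cos t *\<^sub>R y) \<partial>gaussian \<partial>gaussian)"
          using True by (simp add: r_def)
        also have "\<dots> = (\<integral>\<^sup>+x. \<integral>\<^sup>+y. q (x, y) \<partial>gaussian \<partial>gaussian)"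
          by (rule gaussian_rotate[OF q]) (use \<open>cos t \<noteq> -1\<close> in auto)
        finally show ?thesis using inner True by simp
      qed (simp add: r_def)
    qed
  qed
  also have "\<dots> = ennreal (pi * L\<^sup>2) * ennreal pi"
    by (subst nn_integral_cmult) auto
  also have "\<dots> = ennreal (pi\<^sup>2 * L\<^sup>2)"
    using L by (simp add: power2_eq_square mult_ac flip: ennreal_mult)
  finally show ?thesis .
qed

lemma lipschitz_GDERIV_bound:
  fixes h :: "'a::euclidean_space \<Rightarrow> real"
  assumes h: "L-lipschitz_on UNIV h" and d: "GDERIV h x :> g"
  shows "norm g \<le> L"
proof (cases "g = 0")
  case False
  have L: "L \<ge> 0" using h by (rule lipschitz_on_nonneg)
  have "((\<lambda>t. x + t *\<^sub>R g) has_derivative (\<lambda>t. t *\<^sub>R g)) (at 0)" by (auto intro!: derivative_eq_intros)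
  then have "((\<lambda>t. h (x + t *\<^sub>R g)) has_real_derivative g \<bullet> g) (at 0)"
    using d by (intro GDERIV_compose_curve) auto
  then have "(\<lambda>t. (h (x + t *\<^sub>R g) - h x) / t) \<midarrow>0\<rightarrow> g \<bullet> g" by (simp add: DERIV_def)
  moreover have "\<forall>\<^sub>F t in at 0. (h (x + t *\<^sub>R g) - h x) / t \<le> L * norm g"
    unfolding eventually_at_filter
  proof (intro always_eventually allI impI)
    fix t :: real assume "t \<noteq> 0"
    have "\<bar>h (x + t *\<^sub>R g) - h x\<bar> \<le> L * (\<bar>t\<bar> * norm g)"
      using lipschitz_onD[OF h, of "x + t *\<^sub>R g" x] by (simp add: dist_norm)
    then have "\<bar>(h (x + t *\<^sub>R g) - h x) / t\<bar> \<le> L * norm g"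
      using \<open>t \<noteq> 0\<close> by (simp add: divide_le_eq mult_ac)
    then show "(h (x + t *\<^sub>R g) - h x) / t \<le> L * norm g" by linarith
  qed
  ultimately have "g \<bullet> g \<le> L * norm g"
    by (intro tendsto_upperbound) auto
  then show ?thesis using False by (simp add: dot_square_norm power2_eq_square)
qed (use lipschitz_on_nonneg[OF h] in simp)

lemma smoothing_lipschitz:
  fixes F :: "'a::euclidean_space \<Rightarrow> real" and G \<delta> :: real
  assumes F: "G-lipschitz_on UNIV F"
  shows "G-lipschitz_on UNIV (smoothing unif_ball \<delta> F)"
proof (rule lipschitz_onI)
  note [measurable] = borel_measurable_lipschitz[OF F]
  show G: "G \<ge> 0" using F by (rule lipschitz_on_nonneg)
  interpret prob_space "unif_ball :: 'a measure" by (rule prob_space_unif_ball)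
  note int = integrable_smoothing[OF F, of _ \<delta>]
  fix x y
  have "dist (smoothing unif_ball \<delta> F x) (smoothing unif_ball \<delta> F y) = \<bar>\<integral>u. F (x + \<delta> *\<^sub>R u) - F (y + \<delta> *\<^sub>R u) \<partial>unif_ball\<bar>"
    unfolding smoothing_def dist_real_def using int by simp
  also have "\<dots> \<le> (\<integral>u. G * dist x y \<partial>(unif_ball :: 'a measure))"
  proof (rule abs_integral_le)
    fix u show "\<bar>F (x + \<delta> *\<^sub>R u) - F (y + \<delta> *\<^sub>R u)\<bar> \<le> G * dist x y"
      using lipschitz_onD[OF F, of "x + \<delta> *\<^sub>R u" "y + \<delta> *\<^sub>R u"] by (simp add: dist_norm)
  qed (use int in simp_all)
  also have "\<dots> = G * dist x y" using prob_space by simp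
  finally show "dist (smoothing unif_ball \<delta> F x) (smoothing unif_ball \<delta> F y) \<le> G * dist x y" .
qed

text \<open>Three replacements reduce the claim to \<open>antipodal_gaussian_bound\<close>: the sphere by the direction of a
  Gaussian vector, this direction by the vector divided by the square root of the dimension, and \<open>f\<close>
  by its average over a ball, which has a continuous gradient. The smoothing radius
  \<open>\<delta> / sqrt DIM('a)\<close> makes all three errors of the same order, and \<open>84 = 3 * (16 + 8 + 4)\<close> with \<open>\<pi>\<^sup>2 \<le> 16\<close>.\<close>

theorem sphere_two_point_second_moment:
  fixes f :: "'a::euclidean_space \<Rightarrow> real"
  assumes f: "L-lipschitz_on UNIV f" and \<delta>: "\<delta> > 0"
  shows "(\<integral>\<^sup>+u. ennreal ((f (x + \<delta> *\<^sub>R u) - f (x - \<delta> *\<^sub>R u))\<^sup>2) \<partial>unif_sphere) \<le> ennreal (84 * \<delta>\<^sup>2 * L\<^sup>2 / DIM('a))"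
proof -
  note [measurable] = borel_measurable_lipschitz[OF f]
  have L: "L \<ge> 0" using f by (rule lipschitz_on_nonneg)
  interpret G: prob_space "gaussian :: 'a measure" by (rule prob_space_gaussian)
  define d where "d = real DIM('a)"
  have d: "d > 0" by (simp add: d_def)
  define \<eta> where "\<eta> = \<delta> / sqrt d"
  have \<eta>: "\<eta> > 0" using \<delta> d by (simp add: \<eta>_def)
  define m where "m = smoothing unif_ball \<eta> f"
  define h where "h y = m (x + \<eta> *\<^sub>R y)" for y
  define g where "g y = \<eta> *\<^sub>R sphere_grad \<eta> f (x + \<eta> *\<^sub>R y)" for y
  have mL: "L-lipschitz_on UNIV m" unfolding m_def by (rule smoothing_lipschitz[OF f])
  have gd: "GDERIV h y :> g y" for y
  proof -
    have "((\<lambda>y. x + \<eta> *\<^sub>R y) has_derivative (\<lambda>v. \<eta> *\<^sub>R v)) (at y)" by (auto intro!: derivative_eq_intros)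
    moreover have "(m has_derivative (\<lambda>v. v \<bullet> sphere_grad \<eta> f (x + \<eta> *\<^sub>R y))) (at (x + \<eta> *\<^sub>R y))"
      using GDERIV_smoothing_unif_ball[OF f \<eta>] by (simp add: gderiv_def m_def)
    ultimately have "(h has_derivative (\<lambda>v. (\<eta> *\<^sub>R v) \<bullet> sphere_grad \<eta> f (x + \<eta> *\<^sub>R y))) (at y)"
      unfolding h_def by (rule has_derivative_compose)
    then show ?thesis by (simp add: gderiv_def g_def)
  qed
  have gc: "continuous_on UNIV g"
    unfolding g_def
    by (intro continuous_intros continuous_on_compose2[OF lipschitz_on_continuous_on[OF sphere_grad_lipschitz[OF f \<eta>]]]) auto
  have gb: "norm (g y) \<le> \<eta> * L" for y
    using lipschitz_GDERIV_bound[OF mL, of "x + \<eta> *\<^sub>R y"] GDERIV_smoothing_unif_ball[OF f \<eta>] \<eta>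
    by (simp add: g_def m_def)
  have pw: "(f (x + \<delta> *\<^sub>R sgn y) - f (x - \<delta> *\<^sub>R sgn y))\<^sup>2 \<le> 3 * (h y - h (- y))\<^sup>2 + 12 * \<delta>\<^sup>2 * L\<^sup>2 * (1 - (norm y)\<^sup>2 / d)\<^sup>2 + 12 * \<eta>\<^sup>2 * L\<^sup>2" for y
  proof -
    define w where "w = \<bar>1 - (norm y)\<^sup>2 / d\<bar>"
    have nsy: "norm (\<delta> *\<^sub>R sgn y - \<eta> *\<^sub>R y) \<le> \<delta> * w"
    proof -
      define s where "s = norm y / sqrt d"
      have s: "s \<ge> 0" using d by (simp add: s_def)
      have "y = norm y *\<^sub>R sgn y" by (cases "y = 0") (simp_all add: sgn_div_norm)
      then have "\<eta> *\<^sub>R y = (\<delta> * s) *\<^sub>R sgn y" by (metis \<eta>_def s_def scaleR_scaleR times_divide_eq_left times_divide_eq_right)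
      then have "\<delta> *\<^sub>R sgn y - \<eta> *\<^sub>R y = (\<delta> * (1 - s)) *\<^sub>R sgn y" by (simp add: algebra_simps)
      then have "norm (\<delta> *\<^sub>R sgn y - \<eta> *\<^sub>R y) \<le> \<delta> * \<bar>1 - s\<bar>" using \<delta> by (simp add: abs_mult norm_sgn)
      also have "\<dots> \<le> \<delta> * (\<bar>1 - s\<bar> * (1 + s))"
        using \<delta> s by (intro mult_left_mono) (auto simp: mult_le_cancel_left1)
      also have "\<bar>1 - s\<bar> * (1 + s) = \<bar>(1 - s) * (1 + s)\<bar>" using s by (simp add: abs_mult)
      also have "(1 - s) * (1 + s) = 1 - (norm y)\<^sup>2 / d"
        using d by (simp add: s_def power2_eq_square field_simps)
      finally show ?thesis by (simp add: w_def)
    qed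
    have step: "\<bar>f (x + \<sigma> *\<^sub>R (\<delta> *\<^sub>R sgn y)) - m (x + \<sigma> *\<^sub>R (\<eta> *\<^sub>R y))\<bar> \<le> L * (\<delta> * w) + \<eta> * L" if "\<bar>\<sigma>\<bar> = 1" for \<sigma>
    proof -
      have "norm (\<sigma> *\<^sub>R (\<delta> *\<^sub>R sgn y) - \<sigma> *\<^sub>R (\<eta> *\<^sub>R y)) = norm (\<delta> *\<^sub>R sgn y - \<eta> *\<^sub>R y)"
        by (simp only: scaleR_diff_right[symmetric] norm_scaleR that mult_1)
      then have "\<bar>f (x + \<sigma> *\<^sub>R (\<delta> *\<^sub>R sgn y)) - f (x + \<sigma> *\<^sub>R (\<eta> *\<^sub>R y))\<bar> \<le> L * norm (\<delta> *\<^sub>R sgn y - \<eta> *\<^sub>R y)"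
        using lipschitz_onD[OF f, of "x + \<sigma> *\<^sub>R (\<delta> *\<^sub>R sgn y)" "x + \<sigma> *\<^sub>R (\<eta> *\<^sub>R y)"] by (simp add: dist_norm)
      also have "\<dots> \<le> L * (\<delta> * w)" using nsy L by (rule mult_left_mono)
      finally show ?thesis
        using smoothing_close[OF f \<eta>, of "x + \<sigma> *\<^sub>R (\<eta> *\<^sub>R y)"] by (simp add: m_def)
    qed
    have "\<bar>f (x + \<delta> *\<^sub>R sgn y) - f (x - \<delta> *\<^sub>R sgn y)\<bar> \<le> \<bar>h y - h (- y)\<bar> + 2 * L * \<delta> * w + 2 * \<eta> * L"
    proof -
      have tri: "\<bar>a - b\<bar> \<le> \<bar>a' - b'\<bar> + (e + e)" if "\<bar>a - a'\<bar> \<le> e" "\<bar>b - b'\<bar> \<le> e" for a a' b b' e :: real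
        using that by arith
      have "\<bar>f (x + \<delta> *\<^sub>R sgn y) - m (x + \<eta> *\<^sub>R y)\<bar> \<le> L * (\<delta> * w) + \<eta> * L"
        "\<bar>f (x - \<delta> *\<^sub>R sgn y) - m (x - \<eta> *\<^sub>R y)\<bar> \<le> L * (\<delta> * w) + \<eta> * L"
        using step[of 1] step[of "-1"] by simp_all
      from tri[OF this] show ?thesis unfolding h_def by (simp add: mult.assoc mult.left_commute mult.commute)
    qed
    then have "(f (x + \<delta> *\<^sub>R sgn y) - f (x - \<delta> *\<^sub>R sgn y))\<^sup>2 \<le> (\<bar>h y - h (- y)\<bar> + 2 * L * \<delta> * w + 2 * \<eta> * L)\<^sup>2"
      by (simp add: abs_le_square_iff[symmetric])
    also have "\<dots> \<le> 3 * (\<bar>h y - h (- y)\<bar>\<^sup>2 + (2 * L * \<delta> * w)\<^sup>2 + (2 * \<eta> * L)\<^sup>2)"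
    proof -
      have "3 * (a\<^sup>2 + b\<^sup>2 + c\<^sup>2) - (a + b + c)\<^sup>2 = (a - b)\<^sup>2 + (b - c)\<^sup>2 + (a - c)\<^sup>2" for a b c :: real
        by (simp add: power2_eq_square algebra_simps)
      moreover have "0 \<le> (a - b)\<^sup>2 + (b - c)\<^sup>2 + (a - c)\<^sup>2" for a b c :: real by simp
      ultimately have "(a + b + c)\<^sup>2 \<le> 3 * (a\<^sup>2 + b\<^sup>2 + c\<^sup>2)" for a b c :: real
        by (metis diff_ge_0_iff_ge)
      then show ?thesis .
    qed
    finally show ?thesis by (simp add: w_def power_mult_distrib algebra_simps)
  qed
  have "(\<integral>\<^sup>+u. ennreal ((f (x + \<delta> *\<^sub>R u) - f (x - \<delta> *\<^sub>R u))\<^sup>2) \<partial>unif_sphere)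
    = (\<integral>\<^sup>+y. ennreal ((f (x + \<delta> *\<^sub>R sgn y) - f (x - \<delta> *\<^sub>R sgn y))\<^sup>2) \<partial>gaussian)"
    by (rule nn_integral_gaussian_sgn[symmetric]) measurable
  also have "\<dots> \<le> (\<integral>\<^sup>+y. ennreal 3 * ennreal ((h y - h (- y))\<^sup>2) + (ennreal (12 * \<delta>\<^sup>2 * L\<^sup>2) * ennreal ((1 - (norm y)\<^sup>2 / d)\<^sup>2) + ennreal (12 * \<eta>\<^sup>2 * L\<^sup>2)) \<partial>gaussian)"
  proof (intro nn_integral_mono)
    fix y :: 'a
    have "ennreal ((f (x + \<delta> *\<^sub>R sgn y) - f (x - \<delta> *\<^sub>R sgn y))\<^sup>2) \<le> ennreal (3 * (h y - h (- y))\<^sup>2 + (12 * \<delta>\<^sup>2 * L\<^sup>2 * (1 - (norm y)\<^sup>2 / d)\<^sup>2 + 12 * \<eta>\<^sup>2 * L\<^sup>2))"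
      using pw[of y] by (intro ennreal_leI) (simp add: add.assoc)
    also have "\<dots> = ennreal 3 * ennreal ((h y - h (- y))\<^sup>2) + (ennreal (12 * \<delta>\<^sup>2 * L\<^sup>2) * ennreal ((1 - (norm y)\<^sup>2 / d)\<^sup>2) + ennreal (12 * \<eta>\<^sup>2 * L\<^sup>2))"
      by (simp only: ennreal_plus ennreal_mult zero_le_power2 zero_le_numeral mult_nonneg_nonneg add_nonneg_nonneg)
    finally show "ennreal ((f (x + \<delta> *\<^sub>R sgn y) - f (x - \<delta> *\<^sub>R sgn y))\<^sup>2) \<le> ennreal 3 * ennreal ((h y - h (- y))\<^sup>2) + (ennreal (12 * \<delta>\<^sup>2 * L\<^sup>2) * ennreal ((1 - (norm y)\<^sup>2 / d)\<^sup>2) + ennreal (12 * \<eta>\<^sup>2 * L\<^sup>2))" .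
  qed
  also have "\<dots> = ennreal 3 * (\<integral>\<^sup>+y. ennreal ((h y - h (- y))\<^sup>2) \<partial>gaussian) + (ennreal (12 * \<delta>\<^sup>2 * L\<^sup>2) * (\<integral>\<^sup>+y. ennreal ((1 - (norm (y::'a))\<^sup>2 / d)\<^sup>2) \<partial>gaussian) + ennreal (12 * \<eta>\<^sup>2 * L\<^sup>2))"
  proof -
    have [measurable]: "m \<in> borel_measurable borel" by (rule borel_measurable_lipschitz[OF mL])
    have [measurable]: "h \<in> borel_measurable borel" unfolding h_def by measurable
    show ?thesis
      by (simp add: nn_integral_add nn_integral_cmult G.emeasure_space_1[simplified])
  qed
  also have "\<dots> \<le> ennreal 3 * ennreal (pi\<^sup>2 * (\<eta> * L)\<^sup>2) + (ennreal (12 * \<delta>\<^sup>2 * L\<^sup>2) * ennreal (2 / d) + ennreal (12 * \<eta>\<^sup>2 * L\<^sup>2))"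
    unfolding d_def
    by (intro add_mono mult_left_mono antipodal_gaussian_bound[OF gd gc gb] gaussian_norm_concentration order_refl) auto
  also have "\<dots> = ennreal (3 * (pi\<^sup>2 * (\<eta> * L)\<^sup>2) + (12 * \<delta>\<^sup>2 * L\<^sup>2 * (2 / d) + 12 * \<eta>\<^sup>2 * L\<^sup>2))"
  proof -
    have "0 \<le> 2 / d" using d by simp
    then show ?thesis
      by (simp only: ennreal_plus ennreal_mult zero_le_power2 zero_le_numeral mult_nonneg_nonneg add_nonneg_nonneg)
  qed
  also have "\<dots> \<le> ennreal (84 * \<delta>\<^sup>2 * L\<^sup>2 / d)"
  proof (rule ennreal_leI)
    have "\<eta>\<^sup>2 = \<delta>\<^sup>2 / d" using d by (simp add: \<eta>_def power_divide)
    then have "3 * (pi\<^sup>2 * (\<eta> * L)\<^sup>2) + (12 * \<delta>\<^sup>2 * L\<^sup>2 * (2 / d) + 12 * \<eta>\<^sup>2 * L\<^sup>2) = (3 * pi\<^sup>2 + 36) * (\<delta>\<^sup>2 * L\<^sup>2 / d)"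
      by (simp add: power_mult_distrib algebra_simps)
    also have "\<dots> \<le> 84 * (\<delta>\<^sup>2 * L\<^sup>2 / d)"
    proof (rule mult_right_mono)
      have "pi\<^sup>2 \<le> 4\<^sup>2" using pi_less_4 by (intro power_mono) auto
      then show "3 * pi\<^sup>2 + 36 \<le> 84" by simp
    qed (use d in simp)
    finally show "3 * (pi\<^sup>2 * (\<eta> * L)\<^sup>2) + (12 * \<delta>\<^sup>2 * L\<^sup>2 * (2 / d) + 12 * \<eta>\<^sup>2 * L\<^sup>2) \<le> 84 * \<delta>\<^sup>2 * L\<^sup>2 / d" by simp
  qed
  finally show ?thesis by (simp add: d_def)
qed


section \<open>The proximal operator\<close>

lemma proper_closed_convexD:
  assumes "proper_closed_convex h"
  shows "h x \<noteq> -\<infinity>" "\<exists>x. h x < \<infinity>" "closed (epi h)" "convex (epi h)"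
  using assms by (auto simp: proper_closed_convex_def)

lemma mem_epi [simp]: "(x, r) \<in> epi h \<longleftrightarrow> h x \<le> ereal r"
  by (simp add: epi_def)

lemma proper_closed_convex_finite:
  assumes "proper_closed_convex h" "h x < \<infinity>" shows "\<exists>r. h x = ereal r"
  using assms(2) proper_closed_convexD(1)[OF assms(1), of x] by (cases "h x") auto

text \<open>A hyperplane that separates a point strictly below the graph from the epigraph cannot be vertical,
  because the epigraph contains the point of the graph above it.\<close>

lemma affine_minorant:
  assumes h: "proper_closed_convex h"
  shows "\<exists>a b. \<forall>y r. (y, r) \<in> epi h \<longrightarrow> a \<bullet> y + b \<le> r"
proof -
  obtain x0 where "h x0 < \<infinity>" using proper_closed_convexD(2)[OF h] by blast
  then obtain r0 where r0: "h x0 = ereal r0" using proper_closed_convex_finite[OF h] by blast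
  have "(x0, r0 - 1) \<notin> epi h" by (simp add: r0)
  from separating_hyperplane_closed_point[OF proper_closed_convexD(4,3)[OF h] this]
  obtain c b where c: "c \<bullet> (x0, r0 - 1) < b" "\<forall>z\<in>epi h. c \<bullet> z > b" by blast
  obtain p \<alpha> where [simp]: "c = (p, \<alpha>)" by (cases c)
  have "b < p \<bullet> x0 + \<alpha> * r0" using c(2)[rule_format, of "(x0, r0)"] r0 by simp
  moreover have "p \<bullet> x0 + \<alpha> * (r0 - 1) < b" using c(1) by simp
  ultimately have \<alpha>: "\<alpha> > 0" by (simp add: right_diff_distrib)
  have "(- (1 / \<alpha>) *\<^sub>R p) \<bullet> y + b / \<alpha> \<le> r" if "(y, r) \<in> epi h" for y r
  proof -
    from c(2)[rule_format, OF that] have "b < p \<bullet> y + \<alpha> * r" by simp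
    with \<alpha> show ?thesis by (simp add: field_simps)
  qed
  then show ?thesis by meson
qed

lemma norm_sq_convex_combination:
  fixes p z x :: "'a::real_inner"
  shows "(norm ((1 - t) *\<^sub>R p + t *\<^sub>R z - x))\<^sup>2 = (1 - t) * (norm (p - x))\<^sup>2 + t * (norm (z - x))\<^sup>2 - t * (1 - t) * (norm (z - p))\<^sup>2"
proof -
  define a b where "a = p - x" and "b = z - x"
  have "(1 - t) *\<^sub>R p + t *\<^sub>R z - x = a + t *\<^sub>R (b - a)" "z - p = b - a"
    by (simp_all add: a_def b_def algebra_simps)
  then show ?thesis
    unfolding a_def[symmetric] b_def[symmetric] power2_norm_eq_inner
    by (simp only: inner_diff_left inner_diff_right inner_add_left inner_add_right inner_scaleR_left inner_scaleR_right inner_commute[of b a])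
      (simp add: algebra_simps)
qed

lemma norm_sq_midpoint:
  fixes x y z :: "'a::real_inner"
  shows "(norm ((1/2) *\<^sub>R (y + z) - x))\<^sup>2 = ((norm (y - x))\<^sup>2 + (norm (z - x))\<^sup>2) / 2 - (norm (y - z))\<^sup>2 / 4"
  using norm_sq_convex_combination[of "1/2" y z x] by (simp add: scaleR_add_right norm_minus_commute)

text \<open>The objective is bounded below by a quadratic with positive leading coefficient. By the parallelogram
  law a minimizing sequence of the strongly convex objective is a Cauchy sequence, and its limit stays
  in the closed epigraph.\<close>

lemma prox_minimizer_exists:
  fixes h :: "'a::euclidean_space \<Rightarrow> ereal"
  assumes h: "proper_closed_convex h" and \<kappa>: "\<kappa> > 0"
  shows "\<exists>p hp. (p, hp) \<in> epi h \<and> (\<forall>y r. (y, r) \<in> epi h \<longrightarrow> hp + \<kappa> * (norm (p - x))\<^sup>2 \<le> r + \<kappa> * (norm (y - x))\<^sup>2)"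
proof -
  define v where "v = (\<lambda>(y, r). r + \<kappa> * (norm (y - x))\<^sup>2)"
  obtain a b where ab: "\<And>y r. (y, r) \<in> epi h \<Longrightarrow> a \<bullet> y + b \<le> r"
    using affine_minorant[OF h] by blast
  have bdd: "bdd_below (v ` epi h)"
  proof (rule bdd_belowI2)
    fix z assume "z \<in> epi h"
    obtain y r where [simp]: "z = (y, r)" by (cases z)
    have eq: "\<kappa> * (norm (y - x) - norm a / (2 * \<kappa>))\<^sup>2 = \<kappa> * (norm (y - x))\<^sup>2 - norm a * norm (y - x) + (norm a)\<^sup>2 / (4 * \<kappa>)"
      using \<kappa> by (simp add: power2_eq_square field_simps)
    have "a \<bullet> (y - x) \<ge> - (norm a * norm (y - x))" using Cauchy_Schwarz_ineq2[of a "y - x"] by linarith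
    moreover have "0 \<le> \<kappa> * (norm (y - x) - norm a / (2 * \<kappa>))\<^sup>2" using \<kappa> by simp
    then have "norm a * norm (y - x) - (norm a)\<^sup>2 / (4 * \<kappa>) \<le> \<kappa> * (norm (y - x))\<^sup>2"
      unfolding eq by linarith
    moreover have "a \<bullet> y + b \<le> r" using ab \<open>z \<in> epi h\<close> by simp
    ultimately show "a \<bullet> x + b - (norm a)\<^sup>2 / (4 * \<kappa>) \<le> v z"
      by (simp add: v_def inner_diff_right)
  qed
  define m where "m = Inf (v ` epi h)"
  have m: "m \<le> v z" if "z \<in> epi h" for z
    unfolding m_def using that bdd by (intro cInf_lower) auto
  have ne: "epi h \<noteq> {}"
  proof -
    obtain z where "h z < \<infinity>" using proper_closed_convexD(2)[OF h] by blast
    then obtain r where "h z = ereal r" using proper_closed_convex_finite[OF h] by blast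
    then have "(z, r) \<in> epi h" by simp
    then show ?thesis by blast
  qed
  have "\<exists>z\<in>epi h. v z < m + inverse (real (Suc n))" for n
    using cInf_lessD[of "v ` epi h" "m + inverse (real (Suc n))"] ne by (auto simp: m_def)
  then obtain Z where Z: "\<And>n. Z n \<in> epi h" "\<And>n. v (Z n) < m + inverse (real (Suc n))" by metis
  define Y where "Y n = fst (Z n)" for n
  have dist: "(norm (Y n - Y k))\<^sup>2 \<le> 2 / \<kappa> * (inverse (real (Suc n)) + inverse (real (Suc k)))" for n k
  proof -
    have "(1/2) *\<^sub>R Z n + (1/2) *\<^sub>R Z k \<in> epi h"
      using convexD[OF proper_closed_convexD(4)[OF h] Z(1) Z(1), of "1/2" "1/2"] by simp
    from m[OF this] have "m \<le> (snd (Z n) + snd (Z k)) / 2 + \<kappa> * (norm ((1/2) *\<^sub>R (Y n + Y k) - x))\<^sup>2"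
      by (simp add: v_def case_prod_beta Y_def scaleR_add_right add_divide_distrib)
    also have "\<dots> = (v (Z n) + v (Z k)) / 2 - \<kappa> * (norm (Y n - Y k))\<^sup>2 / 4"
      unfolding norm_sq_midpoint by (simp add: v_def case_prod_beta Y_def field_simps)
    finally have mid: "m \<le> (v (Z n) + v (Z k)) / 2 - \<kappa> * (norm (Y n - Y k))\<^sup>2 / 4" .
    have "X \<le> 2 * (i + j)" if "m \<le> (a + b) / 2 - X / 4" "a < m + i" "b < m + j" for X i j a b :: real
      using that by (simp add: field_simps)
    note * = this[OF mid Z(2) Z(2)]
    have "A \<le> 2 / \<kappa> * B" if "\<kappa> * A \<le> 2 * B" for A B
      using that \<kappa> by (simp add: field_simps)
    from this[OF *] show ?thesis .
  qed
  have "Cauchy Y"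
  proof (rule CauchyI)
    fix e :: real assume e: "e > 0"
    have "(\<lambda>n. 4 / \<kappa> * inverse (real (Suc n))) \<longlonglongrightarrow> 4 / \<kappa> * 0"
      by (intro tendsto_mult_left LIMSEQ_inverse_real_of_nat)
    then have "\<forall>\<^sub>F n in sequentially. 4 / \<kappa> * inverse (real (Suc n)) < e\<^sup>2"
      using e by (intro order_tendstoD(2)) auto
    then obtain N where N: "4 / \<kappa> * inverse (real (Suc N)) < e\<^sup>2" by (auto simp: eventually_sequentially)
    show "\<exists>M. \<forall>m\<ge>M. \<forall>n\<ge>M. norm (Y m - Y n) < e"
    proof (intro exI[of _ N] allI impI)
      fix k n assume kn: "k \<ge> N" "n \<ge> N"
      have "(norm (Y k - Y n))\<^sup>2 \<le> 2 / \<kappa> * (inverse (real (Suc N)) + inverse (real (Suc N)))"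
        using dist[of k n] kn \<kappa>
        by (intro order_trans[OF dist] mult_left_mono add_mono le_imp_inverse_le) auto
      with N have "(norm (Y k - Y n))\<^sup>2 < e\<^sup>2" by (simp add: field_simps)
      then show "norm (Y k - Y n) < e" using e by (simp add: power2_less_imp_less)
    qed
  qed
  then obtain p where p: "Y \<longlonglongrightarrow> p" using Cauchy_convergent convergent_def by blast
  have "(\<lambda>n. v (Z n)) \<longlonglongrightarrow> m"
  proof (rule tendsto_sandwich[OF _ _ tendsto_const])
    show "(\<lambda>n. m + inverse (real (Suc n))) \<longlonglongrightarrow> m"
      using tendsto_add[OF tendsto_const LIMSEQ_inverse_real_of_nat, of m] by simp
    show "\<forall>\<^sub>F n in sequentially. m \<le> v (Z n)" by (intro always_eventually allI m Z(1))
    show "\<forall>\<^sub>F n in sequentially. v (Z n) \<le> m + inverse (real (Suc n))"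
      by (intro always_eventually allI less_imp_le Z(2))
  qed
  then have "(\<lambda>n. v (Z n) - \<kappa> * (norm (Y n - x))\<^sup>2) \<longlonglongrightarrow> m - \<kappa> * (norm (p - x))\<^sup>2"
    by (intro tendsto_intros p)
  then have "(\<lambda>n. snd (Z n)) \<longlonglongrightarrow> m - \<kappa> * (norm (p - x))\<^sup>2"
    by (simp add: v_def case_prod_beta Y_def)
  from tendsto_Pair[OF p this] have "Z \<longlonglongrightarrow> (p, m - \<kappa> * (norm (p - x))\<^sup>2)" by (simp add: Y_def)
  then have "(p, m - \<kappa> * (norm (p - x))\<^sup>2) \<in> epi h"
    by (rule closed_sequentially[where f=Z, OF proper_closed_convexD(3)[OF h] Z(1)])
  moreover have "(m - \<kappa> * (norm (p - x))\<^sup>2) + \<kappa> * (norm (p - x))\<^sup>2 \<le> r + \<kappa> * (norm (y - x))\<^sup>2" if "(y, r) \<in> epi h" for y r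
    using m[OF that] by (simp add: v_def)
  ultimately show ?thesis by blast
qed

text \<open>The three-point inequality: comparing the minimum with points of the segment towards \<open>z\<close>, and letting
  these approach the minimizer, gives the quadratic growth of the objective.\<close>

lemma prox_spec:
  fixes h :: "'a::euclidean_space \<Rightarrow> ereal"
  assumes h: "proper_closed_convex h" and \<gamma>: "\<gamma> > 0"
  shows "\<exists>hp. h (prox \<gamma> h x) = ereal hp \<and> (\<forall>z r. h z \<le> ereal r \<longrightarrow>
       hp + 1 / (2 * \<gamma>) * (norm (prox \<gamma> h x - x))\<^sup>2 + 1 / (2 * \<gamma>) * (norm (z - prox \<gamma> h x))\<^sup>2 \<le> r + 1 / (2 * \<gamma>) * (norm (z - x))\<^sup>2)"
proof -
  define \<kappa> where "\<kappa> = 1 / (2 * \<gamma>)"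
  have \<kappa>: "\<kappa> > 0" using \<gamma> by (simp add: \<kappa>_def)
  define \<Psi> where "\<Psi> y = h y + ereal (\<kappa> * (norm (y - x))\<^sup>2)" for y
  obtain q hq where q: "(q, hq) \<in> epi h"
    "\<And>y r. (y, r) \<in> epi h \<Longrightarrow> hq + \<kappa> * (norm (q - x))\<^sup>2 \<le> r + \<kappa> * (norm (y - x))\<^sup>2"
    using prox_minimizer_exists[OF h \<kappa>] by blast
  have "\<Psi> q \<le> \<Psi> y" for y
  proof (cases "h y")
    case (real r)
    have "\<Psi> q \<le> ereal hq + ereal (\<kappa> * (norm (q - x))\<^sup>2)" unfolding \<Psi>_def using q(1) by (intro add_right_mono) simp
    also have "\<dots> \<le> \<Psi> y" using q(2)[of y r] real by (simp add: \<Psi>_def)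
    finally show ?thesis .
  qed (use proper_closed_convexD(1)[OF h] in \<open>auto simp: \<Psi>_def\<close>)
  then have "is_arg_min \<Psi> (\<lambda>_. True) q" by (auto simp: is_arg_min_def not_less)
  then have "is_arg_min \<Psi> (\<lambda>_. True) (prox \<gamma> h x)"
    unfolding prox_def arg_min_def \<Psi>_def[abs_def] \<kappa>_def by (rule someI)
  then have min: "\<Psi> (prox \<gamma> h x) \<le> \<Psi> y" for y by (auto simp: is_arg_min_def not_less)
  define p where "p = prox \<gamma> h x"
  have "\<Psi> q \<le> ereal hq + ereal (\<kappa> * (norm (q - x))\<^sup>2)" unfolding \<Psi>_def using q(1) by (intro add_right_mono) simp
  with min[of q] have "\<Psi> p < \<infinity>" unfolding p_def by (auto intro: le_less_trans)
  then obtain hp where hp: "h p = ereal hp"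
    using proper_closed_convexD(1)[OF h, of p] by (cases "h p") (auto simp: \<Psi>_def)
  have min': "hp + \<kappa> * (norm (p - x))\<^sup>2 \<le> r + \<kappa> * (norm (y - x))\<^sup>2" if "h y \<le> ereal r" for y r
  proof -
    have "\<Psi> y \<le> ereal r + ereal (\<kappa> * (norm (y - x))\<^sup>2)" unfolding \<Psi>_def using that by (intro add_right_mono)
    with min[of y] have "\<Psi> p \<le> ereal r + ereal (\<kappa> * (norm (y - x))\<^sup>2)" unfolding p_def by (rule order_trans)
    then show ?thesis by (simp add: \<Psi>_def hp)
  qed
  show ?thesis
    unfolding p_def[symmetric] \<kappa>_def[symmetric]
  proof (intro exI conjI allI impI)
    show "h p = ereal hp" by (rule hp)
    fix z r assume zr: "h z \<le> ereal r"
    let ?A = "hp + \<kappa> * (norm (p - x))\<^sup>2" and ?B = "r + \<kappa> * (norm (z - x))\<^sup>2" and ?C = "\<kappa> * (norm (z - p))\<^sup>2"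
    have ineq: "?A \<le> ?B - (1 - t) * ?C" if t: "0 < t" "t < 1" for t
    proof -
      have "(1 - t) *\<^sub>R (p, hp) + t *\<^sub>R (z, r) \<in> epi h"
        using zr hp t by (intro convexD[OF proper_closed_convexD(4)[OF h]]) auto
      then have "?A \<le> ((1 - t) * hp + t * r) + \<kappa> * (norm ((1 - t) *\<^sub>R p + t *\<^sub>R z - x))\<^sup>2"
        using min' by simp
      also have "\<dots> = (1 - t) * ?A + t * (?B - (1 - t) * ?C)"
        unfolding norm_sq_convex_combination by (simp add: algebra_simps)
      finally have "t * ?A \<le> t * (?B - (1 - t) * ?C)" by (simp add: algebra_simps)
      with t show ?thesis by (simp only: mult_le_cancel_left_pos)
    qed
    have "((\<lambda>t. ?B - (1 - t) * ?C) \<longlongrightarrow> ?B - (1 - 0) * ?C) (at_right 0)"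
      by (intro tendsto_intros)
    moreover have "\<forall>\<^sub>F t in at_right (0::real). ?A \<le> ?B - (1 - t) * ?C"
      using eventually_at_right_less[of "0::real"] eventually_at_right_field[of _ "0::real"]
      by (auto simp: eventually_at_right_field intro!: exI[of _ 1] ineq)
    ultimately have "?A \<le> ?B - (1 - 0) * ?C"
      by (intro tendsto_lowerbound) auto
    then show "?A + ?C \<le> ?B" by simp
  qed
qed

text \<open>Add the three-point inequalities of the two minimizers, each evaluated at the other one.\<close>

lemma prox_nonexpansive:
  fixes h :: "'a::euclidean_space \<Rightarrow> ereal"
  assumes h: "proper_closed_convex h" and \<gamma>: "\<gamma> > 0"
  shows "norm (prox \<gamma> h x - prox \<gamma> h x') \<le> norm (x - x')"
proof -
  define p p' where "p = prox \<gamma> h x" and "p' = prox \<gamma> h x'"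
  define \<kappa> where "\<kappa> = 1 / (2 * \<gamma>)"
  have \<kappa>: "\<kappa> > 0" using \<gamma> by (simp add: \<kappa>_def)
  obtain a where a: "h p = ereal a"
    "\<And>z r. h z \<le> ereal r \<Longrightarrow> a + \<kappa> * (norm (p - x))\<^sup>2 + \<kappa> * (norm (z - p))\<^sup>2 \<le> r + \<kappa> * (norm (z - x))\<^sup>2"
    using prox_spec[OF h \<gamma>, of x] unfolding p_def \<kappa>_def by blast
  obtain b where b: "h p' = ereal b"
    "\<And>z r. h z \<le> ereal r \<Longrightarrow> b + \<kappa> * (norm (p' - x'))\<^sup>2 + \<kappa> * (norm (z - p'))\<^sup>2 \<le> r + \<kappa> * (norm (z - x'))\<^sup>2"
    using prox_spec[OF h \<gamma>, of x'] unfolding p'_def \<kappa>_def by blast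
  have "\<kappa> * ((norm (p - x))\<^sup>2 + (norm (p' - p))\<^sup>2 + (norm (p' - x'))\<^sup>2 + (norm (p - p'))\<^sup>2) \<le> \<kappa> * ((norm (p' - x))\<^sup>2 + (norm (p - x'))\<^sup>2)"
    using a(2)[of p' b] b(2)[of p a] a(1) b(1) by (simp add: algebra_simps)
  then have "(norm (p - x))\<^sup>2 + (norm (p' - p))\<^sup>2 + (norm (p' - x'))\<^sup>2 + (norm (p - p'))\<^sup>2 \<le> (norm (p' - x))\<^sup>2 + (norm (p - x'))\<^sup>2"
    using \<kappa> by simp
  moreover have "(norm (p' - x))\<^sup>2 + (norm (p - x'))\<^sup>2 - (norm (p - x))\<^sup>2 - (norm (p' - x'))\<^sup>2 = 2 * ((p - p') \<bullet> (x - x'))"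
    unfolding power2_norm_eq_inner by (simp add: inner_diff_left inner_diff_right inner_commute)
  moreover have "norm (p' - p) = norm (p - p')" by (rule norm_minus_commute)
  ultimately have "(norm (p - p'))\<^sup>2 \<le> (p - p') \<bullet> (x - x')" by simp
  also have "\<dots> \<le> norm (p - p') * norm (x - x')" by (rule norm_cauchy_schwarz)
  finally have "norm (p - p') * norm (p - p') \<le> norm (p - p') * norm (x - x')" by (simp add: power2_eq_square)
  then have "norm (p - p') \<le> norm (x - x')"
    by (cases "p = p'") (simp, rule mult_left_le_imp_le[of "norm (p - p')"], simp_all)
  then show ?thesis by (simp add: p_def p'_def)
qed

lemma borel_measurable_proper_closed_convex:
  fixes h :: "'a::euclidean_space \<Rightarrow> ereal"
  assumes h: "proper_closed_convex h"
  shows "h \<in> borel_measurable borel"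
  unfolding borel_measurable_iff_Iic_ereal
proof (intro allI)
  fix a :: ereal
  show "h -` {..a} \<inter> space borel \<in> sets borel"
  proof (cases a)
    case (real r)
    have "h -` {..a} = (\<lambda>x. (x, r)) -` epi h" using real by auto
    moreover have "closed \<dots>"
      by (intro closed_vimage proper_closed_convexD(3)[OF h] continuous_intros)
    ultimately show ?thesis by simp
  next
    case MInf
    then have "h -` {..a} = {}" using proper_closed_convexD(1)[OF h] by auto
    then show ?thesis by simp
  next
    case PInf
    then have "h -` {..a} = UNIV" by auto
    then show ?thesis by simp
  qed
qed


section \<open>Clarke derivatives and the Goldstein subdifferential\<close>

definition clarke_deriv :: "('a::euclidean_space \<Rightarrow> real) \<Rightarrow> 'a \<Rightarrow> 'a \<Rightarrow> ereal" where
  "clarke_deriv F x v = Limsup (nhds x \<times>\<^sub>F at_right 0) (\<lambda>(y, t). ereal ((F (y + t *\<^sub>R v) - F y) / t))"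

abbreviation base_filter :: "'a::euclidean_space \<Rightarrow> ('a \<times> real) filter" where
  "base_filter x \<equiv> nhds x \<times>\<^sub>F at_right 0"

lemma base_filter_neq_bot: "base_filter x \<noteq> bot"
  by (simp add: prod_filter_eq_bot)

lemma eventually_base_filter_pos: "\<forall>\<^sub>F (y, t) in base_filter x. t > 0"
  using eventually_prod2[of "nhds x" "\<lambda>t. t > 0" "at_right (0::real)"]
  by (simp add: eventually_at_right_less)

lemma clarke_deriv_le:
  assumes "\<And>e. e > 0 \<Longrightarrow> \<forall>\<^sub>F (y, t) in base_filter x. (F (y + t *\<^sub>R v) - F y) / t \<le> a + e"
  shows "clarke_deriv F x v \<le> ereal a"
proof (rule ereal_le_epsilon2)
  fix e :: real assume "e > 0"
  have "\<forall>\<^sub>F z in base_filter x. (case z of (y, t) \<Rightarrow> ereal ((F (y + t *\<^sub>R v) - F y) / t)) \<le> ereal (a + e)"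
    using assms[OF \<open>e > 0\<close>] by eventually_elim auto
  then show "clarke_deriv F x v \<le> ereal a + ereal e"
    unfolding clarke_deriv_def by (intro Limsup_bounded) simp
qed

lemma clarke_deriv_less:
  assumes "clarke_deriv F x v < ereal b"
  shows "\<forall>\<^sub>F (y, t) in base_filter x. (F (y + t *\<^sub>R v) - F y) / t < b"
  using Limsup_lessD[OF assms[unfolded clarke_deriv_def]] by eventually_elim auto

context
  fixes F :: "'a::euclidean_space \<Rightarrow> real" and G :: real
  assumes F: "G-lipschitz_on UNIV F"
begin

lemma quotient_bound:
  assumes "t > 0" shows "\<bar>(F (y + t *\<^sub>R v) - F y) / t\<bar> \<le> G * norm v"
proof -
  have "\<bar>F (y + t *\<^sub>R v) - F y\<bar> \<le> G * (t * norm v)"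
    using lipschitz_onD[OF F, of "y + t *\<^sub>R v" y] assms by (simp add: dist_norm)
  with assms show ?thesis by (simp add: divide_le_eq mult_ac)
qed

lemma quotient_le:
  assumes "t > 0"
  shows "(F (y + t *\<^sub>R v) - F y) / t \<le> G * norm v" "- (G * norm v) \<le> (F (y + t *\<^sub>R v) - F y) / t"
  using quotient_bound[OF assms, of y v] unfolding abs_le_iff by linarith+

lemma clarke_deriv_bounds:
  "clarke_deriv F x v \<le> ereal (G * norm v)" "ereal (- (G * norm v)) \<le> clarke_deriv F x v"
proof -
  show "clarke_deriv F x v \<le> ereal (G * norm v)"
  proof (rule clarke_deriv_le)
    fix e :: real assume "e > 0"
    show "\<forall>\<^sub>F (y, t) in base_filter x. (F (y + t *\<^sub>R v) - F y) / t \<le> G * norm v + e"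
      using eventually_base_filter_pos
    proof eventually_elim
      case (elim z)
      then show ?case using quotient_le(1)[of "snd z" "fst z" v] \<open>e > 0\<close> by (auto simp: case_prod_beta)
    qed
  qed
  show "ereal (- (G * norm v)) \<le> clarke_deriv F x v"
    unfolding clarke_deriv_def
  proof (rule le_Limsup[OF base_filter_neq_bot])
    show "\<forall>\<^sub>F z in base_filter x. ereal (- (G * norm v)) \<le> (case z of (y, t) \<Rightarrow> ereal ((F (y + t *\<^sub>R v) - F y) / t))"
      using eventually_base_filter_pos
    proof eventually_elim
      case (elim z)
      then show ?case using quotient_le(2)[where t="snd z" and y="fst z" and v=v] by (auto simp: case_prod_beta)
    qed
  qed
qed

text \<open>For a Lipschitz function the Clarke derivative is finite, so it can be treated as a real number.\<close>

definition cdir :: "'a \<Rightarrow> 'a \<Rightarrow> real" where "cdir x v = real_of_ereal (clarke_deriv F x v)"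

lemma clarke_deriv_eq: "clarke_deriv F x v = ereal (cdir x v)"
  using clarke_deriv_bounds(1)[of x v] clarke_deriv_bounds(2)[of v x] unfolding cdir_def
  by (cases "clarke_deriv F x v") auto

lemma cdir_le: "(\<And>e. e > 0 \<Longrightarrow> \<forall>\<^sub>F (y, t) in base_filter x. (F (y + t *\<^sub>R v) - F y) / t \<le> a + e) \<Longrightarrow> cdir x v \<le> a"
  using clarke_deriv_le[where F=F and x=x and v=v and a=a] by (simp add: clarke_deriv_eq)

lemma cdir_less: "cdir x v < b \<Longrightarrow> \<forall>\<^sub>F (y, t) in base_filter x. (F (y + t *\<^sub>R v) - F y) / t < b"
  using clarke_deriv_less[where F=F and x=x and v=v and b=b] by (simp add: clarke_deriv_eq)

lemma cdir_bound: "\<bar>cdir x v\<bar> \<le> G * norm v"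
  using clarke_deriv_bounds(1)[of x v] clarke_deriv_bounds(2)[of v x] by (simp add: clarke_deriv_eq abs_le_iff)

text \<open>A step along \<open>v + w\<close> is a step along \<open>v\<close> followed by a step along \<open>w\<close> from a nearby base point; this is
  why the Clarke derivative moves the base point.\<close>

lemma cdir_subadditive: "cdir x (v + w) \<le> cdir x v + cdir x w"
proof (rule cdir_le)
  fix e :: real assume e: "e > 0"
  have "(snd \<longlongrightarrow> 0) (base_filter x)"
    by (rule filterlim_mono[OF filterlim_snd at_within_le_nhds order_refl])
  moreover have "(fst \<longlongrightarrow> x) (base_filter x)" by (rule filterlim_fst)
  ultimately have "((\<lambda>z. fst z + snd z *\<^sub>R v) \<longlongrightarrow> x + 0 *\<^sub>R v) (base_filter x)"
    by (intro tendsto_intros)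
  then have lim: "filterlim (\<lambda>z. (fst z + snd z *\<^sub>R v, snd z)) (base_filter x) (base_filter x)"
    by (intro filterlim_Pair filterlim_snd) simp
  have "cdir x w < cdir x w + e / 2" using e by simp
  from lim[unfolded filterlim_iff, rule_format, OF cdir_less[OF this]]
  have "\<forall>\<^sub>F z in base_filter x. (F (fst z + snd z *\<^sub>R v + snd z *\<^sub>R w) - F (fst z + snd z *\<^sub>R v)) / snd z < cdir x w + e / 2"
    by simp
  moreover have "\<forall>\<^sub>F (y, t) in base_filter x. (F (y + t *\<^sub>R v) - F y) / t < cdir x v + e / 2"
    using cdir_less[of x v "cdir x v + e / 2"] e by simp
  ultimately show "\<forall>\<^sub>F (y, t) in base_filter x. (F (y + t *\<^sub>R (v + w)) - F y) / t \<le> cdir x v + cdir x w + e"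
  proof eventually_elim
    case (elim z)
    obtain y t where [simp]: "z = (y, t)" by (cases z)
    have "(F (y + t *\<^sub>R (v + w)) - F y) / t = (F (y + t *\<^sub>R v + t *\<^sub>R w) - F (y + t *\<^sub>R v)) / t + (F (y + t *\<^sub>R v) - F y) / t"
      by (simp add: scaleR_add_right add.assoc flip: add_divide_distrib)
    with elim show ?case by simp
  qed
qed

lemma cdir_scale_le:
  assumes "c > 0" shows "cdir x (c *\<^sub>R v) \<le> c * cdir x v"
proof (rule cdir_le)
  fix e :: real assume e: "e > 0"
  have "((\<lambda>t. c * t) \<longlongrightarrow> c * 0) (at_right (0::real))" by (intro tendsto_intros)
  then have "filterlim (\<lambda>t. c * t) (at_right 0) (at_right (0::real))"
    using assms by (auto simp: filterlim_at eventually_at_right_less eventually_at_filter)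
  then have "filterlim (\<lambda>z. c * snd z) (at_right 0) (base_filter x)"
    by (rule filterlim_compose[OF _ filterlim_snd])
  then have lim: "filterlim (\<lambda>z. (fst z, c * snd z)) (base_filter x) (base_filter x)"
    by (intro filterlim_Pair filterlim_fst)
  have "cdir x v < cdir x v + e / c" using e assms by simp
  from lim[unfolded filterlim_iff, rule_format, OF cdir_less[OF this]]
  have "\<forall>\<^sub>F z in base_filter x. (F (fst z + (c * snd z) *\<^sub>R v) - F (fst z)) / (c * snd z) < cdir x v + e / c"
    by simp
  then show "\<forall>\<^sub>F (y, t) in base_filter x. (F (y + t *\<^sub>R (c *\<^sub>R v)) - F y) / t \<le> c * cdir x v + e"
    using eventually_base_filter_pos
  proof eventually_elim
    case (elim z)
    obtain y t where [simp]: "z = (y, t)" by (cases z)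
    have "(F (y + (c * t) *\<^sub>R v) - F y) / (c * t) < cdir x v + e / c" "t > 0" using elim by simp_all
    then have "c * ((F (y + (c * t) *\<^sub>R v) - F y) / (c * t)) \<le> c * (cdir x v + e / c)"
      using assms by (intro mult_left_mono) auto
    also have "c * (cdir x v + e / c) = c * cdir x v + e" using assms by (simp add: distrib_left)
    finally show ?case using assms by (simp add: mult.commute)
  qed
qed

lemma cdir_scale:
  assumes "c > 0" shows "cdir x (c *\<^sub>R v) = c * cdir x v"
proof (rule antisym[OF cdir_scale_le[OF assms]])
  have "cdir x ((1 / c) *\<^sub>R (c *\<^sub>R v)) \<le> 1 / c * cdir x (c *\<^sub>R v)" using assms by (intro cdir_scale_le) simp
  with assms show "c * cdir x v \<le> cdir x (c *\<^sub>R v)" by (simp add: field_simps)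
qed

lemma cdir_lipschitz: "G-lipschitz_on UNIV (cdir x)"
proof (rule lipschitz_onI)
  show "G \<ge> 0" using F by (rule lipschitz_on_nonneg)
  fix v w
  have "cdir x v \<le> cdir x w + G * norm (v - w)" for v w
    using cdir_subadditive[of x w "v - w"] cdir_bound[of x "v - w"] by simp
  from this[of v w] this[of w v] show "dist (cdir x v) (cdir x w) \<le> G * dist v w"
    by (simp add: dist_norm norm_minus_commute abs_le_iff)
qed

lemma cdir_upper_semicontinuous:
  assumes "cdir x v < b" shows "\<forall>\<^sub>F y in nhds x. cdir y v \<le> b"
proof -
  obtain P Q where P: "eventually P (nhds x)" and Q: "eventually Q (at_right (0::real))"
    and PQ: "\<And>y t. P y \<Longrightarrow> Q t \<Longrightarrow> (F (y + t *\<^sub>R v) - F y) / t < b"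
    using cdir_less[OF assms] unfolding eventually_prod_filter by auto
  have "\<forall>\<^sub>F y in nhds x. eventually P (nhds y)" using P by (simp add: eventually_eventually)
  then show ?thesis
  proof eventually_elim
    case (elim y)
    have ev: "\<forall>\<^sub>F (y, t) in base_filter y. (F (y + t *\<^sub>R v) - F y) / t < b"
      unfolding eventually_prod_filter using elim Q PQ by auto
    show ?case
    proof (rule cdir_le)
      fix e :: real assume "e > 0"
      show "\<forall>\<^sub>F (y, t) in base_filter y. (F (y + t *\<^sub>R v) - F y) / t \<le> b + e"
        using ev by eventually_elim (use \<open>e > 0\<close> in auto)
    qed
  qed
qed

lemma mem_clarke_subdiff: "g \<in> clarke_subdiff F x \<longleftrightarrow> (\<forall>v. g \<bullet> v \<le> cdir x v)"
  unfolding clarke_subdiff_def clarke_deriv_def[symmetric] clarke_deriv_eq by simp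

lemma clarke_subdiff_norm_le:
  assumes "g \<in> clarke_subdiff F x" shows "norm g \<le> G"
proof (cases "g = 0")
  case False
  have "g \<bullet> g \<le> cdir x g" using assms by (simp add: mem_clarke_subdiff)
  also have "\<dots> \<le> G * norm g" using cdir_bound[of x g] by linarith
  finally have "g \<bullet> g \<le> G * norm g" .
  with False show ?thesis by (simp add: dot_square_norm power2_eq_square)
qed (use lipschitz_on_nonneg[OF F] in simp)

text \<open>The Clarke derivative is sublinear, so its epigraph is a closed convex cone. The hyperplane that
  separates \<open>(v0, \<beta>)\<close> from it supports the cone at the origin, and its slope is a subgradient.\<close>

lemma clarke_support:
  assumes "\<beta> < cdir x v0" shows "\<exists>g\<in>clarke_subdiff F x. g \<bullet> v0 > \<beta>"
proof -
  define E where "E = {z. cdir x (fst z) \<le> snd z}"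
  have cont: "continuous_on UNIV (cdir x)" using cdir_lipschitz by (rule lipschitz_on_continuous_on)
  have "closed E" unfolding E_def
    by (intro closed_Collect_le continuous_intros continuous_on_compose2[OF cont]) auto
  have cone: "c *\<^sub>R z \<in> E" if "z \<in> E" "c > 0" for c z
    using that by (simp add: E_def cdir_scale)
  have cone0: "0 \<in> E" using cdir_bound[of x 0] by (simp add: E_def)
  have add: "z + z' \<in> E" if "z \<in> E" "z' \<in> E" for z z'
    using that cdir_subadditive[of x "fst z" "fst z'"] by (simp add: E_def)
  have "convex E"
    unfolding convex_alt
  proof (intro ballI allI impI)
    fix z z' and u :: real assume "z \<in> E" "z' \<in> E" "0 \<le> u \<and> u \<le> 1"
    then consider "u = 0" | "u = 1" | "0 < u" "u < 1" by linarith
    then show "(1 - u) *\<^sub>R z + u *\<^sub>R z' \<in> E"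
      using \<open>z \<in> E\<close> \<open>z' \<in> E\<close> by cases (auto intro!: add cone)
  qed
  \<comment> \<open>The cone contains the origin and all dilations, so the hyperplane is supporting at the origin.\<close>
  have "(v0, \<beta>) \<notin> E" using assms by (simp add: E_def)
  from separating_hyperplane_closed_point[OF \<open>convex E\<close> \<open>closed E\<close> this]
  obtain c b where c: "c \<bullet> (v0, \<beta>) < b" "\<forall>z\<in>E. c \<bullet> z > b" by blast
  have "b < 0" using c(2) cone0 by force
  have nonneg: "c \<bullet> z \<ge> 0" if "z \<in> E" for z
  proof (rule ccontr)
    assume "\<not> c \<bullet> z \<ge> 0"
    then have neg: "c \<bullet> z < 0" by simp
    have "(b / (c \<bullet> z)) *\<^sub>R z \<in> E" using that neg \<open>b < 0\<close> by (intro cone) (auto simp: divide_neg_neg)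
    with c(2) have "c \<bullet> ((b / (c \<bullet> z)) *\<^sub>R z) > b" by blast
    with neg show False by simp
  qed
  obtain p \<alpha> where [simp]: "c = (p, \<alpha>)" by (cases c)
  have lt: "p \<bullet> v0 + \<alpha> * \<beta> < 0" using c(1) \<open>b < 0\<close> by simp
  have ge: "0 \<le> p \<bullet> v + \<alpha> * cdir x v" for v using nonneg[of "(v, cdir x v)"] by (simp add: E_def)
  have "0 < \<alpha> * (cdir x v0 - \<beta>)" using ge[of v0] lt by (simp add: right_diff_distrib)
  then have \<alpha>: "\<alpha> > 0" using assms by (simp add: zero_less_mult_iff)
  show ?thesis
  proof (rule bexI[of _ "- (1 / \<alpha>) *\<^sub>R p"])
    show "- (1 / \<alpha>) *\<^sub>R p \<in> clarke_subdiff F x"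
      unfolding mem_clarke_subdiff
    proof
      fix v show "(- (1 / \<alpha>) *\<^sub>R p) \<bullet> v \<le> cdir x v" using ge[of v] \<alpha> by (simp add: field_simps)
    qed
    show "\<beta> < (- (1 / \<alpha>) *\<^sub>R p) \<bullet> v0" using lt \<alpha> by (simp add: field_simps)
  qed
qed

text \<open>Subgradients are bounded by the Lipschitz constant, and limits of subgradients are subgradients because
  the Clarke derivative is upper semicontinuous in the base point.\<close>

lemma compact_clarke_union: "compact (\<Union>y\<in>cball x \<delta>. clarke_subdiff F y)"
proof -
  let ?U = "\<Union>y\<in>cball x \<delta>. clarke_subdiff F y"
  have "bounded ?U" unfolding bounded_iff using clarke_subdiff_norm_le by blast
  moreover have "closed ?U"
    unfolding closed_sequential_limits
  proof (intro allI impI, elim conjE)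
    fix g l assume g: "\<forall>n. g n \<in> ?U" and lim: "g \<longlonglongrightarrow> l"
    from g have "\<forall>n. \<exists>y. y \<in> cball x \<delta> \<and> g n \<in> clarke_subdiff F y" by blast
    then obtain Y where Y: "\<And>n. Y n \<in> cball x \<delta>" "\<And>n. g n \<in> clarke_subdiff F (Y n)" by metis
    obtain y r where yr: "y \<in> cball x \<delta>" "strict_mono (r :: nat \<Rightarrow> nat)" "(Y \<circ> r) \<longlonglongrightarrow> y"
      using compact_cball[of x \<delta>] Y(1) unfolding compact_def by blast
    have "l \<in> clarke_subdiff F y"
      unfolding mem_clarke_subdiff
    proof (intro allI, rule ccontr)
      fix v assume "\<not> l \<bullet> v \<le> cdir y v"
      then obtain b where b: "cdir y v < b" "b < l \<bullet> v" using dense by (auto simp: not_le)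
      have "\<forall>\<^sub>F n in sequentially. cdir ((Y \<circ> r) n) v \<le> b"
        using cdir_upper_semicontinuous[OF b(1)] yr(3) by (rule eventually_compose_filterlim)
      moreover have "g (r n) \<bullet> v \<le> cdir ((Y \<circ> r) n) v" for n
        using Y(2)[of "r n"] by (simp add: mem_clarke_subdiff)
      ultimately have "\<forall>\<^sub>F n in sequentially. g (r n) \<bullet> v \<le> b"
        by (auto elim!: eventually_mono intro: order_trans)
      moreover have "(\<lambda>n. g (r n) \<bullet> v) \<longlonglongrightarrow> l \<bullet> v"
        using LIMSEQ_subseq_LIMSEQ[OF lim yr(2)] by (intro tendsto_intros) (simp add: o_def)
      ultimately have "l \<bullet> v \<le> b" by (intro tendsto_upperbound) auto
      with b show False by simp
    qed
    with yr(1) show "l \<in> ?U" by blast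
  qed
  ultimately show ?thesis by (simp add: compact_eq_bounded_closed)
qed

text \<open>Otherwise there are a direction \<open>v\<close> and a number \<open>\<beta>\<close> such that the Clarke derivatives along \<open>v\<close> on the
  ball are at most \<open>\<beta>\<close> but the derivative of the smoothed function is larger. The latter is the limit of
  the averages of the difference quotients. Truncated from below at \<open>\<beta>\<close>, these quotients converge to \<open>\<beta>\<close>
  pointwise, so the averages cannot exceed \<open>\<beta>\<close> in the limit.\<close>

theorem gradient_smoothing_in_goldstein:
  assumes \<delta>: "\<delta> > 0"
  shows "gradient (smoothing unif_ball \<delta> F) x \<in> goldstein_subdiff \<delta> F x"
proof (rule ccontr)
  note [measurable] = borel_measurable_lipschitz[OF F]
  have G: "G \<ge> 0" using F by (rule lipschitz_on_nonneg)
  interpret prob_space "unif_ball :: 'a measure" by (rule prob_space_unif_ball)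
  define g where "g = sphere_grad \<delta> F x"
  assume "gradient (smoothing unif_ball \<delta> F) x \<notin> goldstein_subdiff \<delta> F x"
  then have "g \<notin> goldstein_subdiff \<delta> F x" by (simp add: gradient_smoothing_unif_ball[OF F \<delta>] g_def)
  moreover have "closed (goldstein_subdiff \<delta> F x)" "convex (goldstein_subdiff \<delta> F x)"
    unfolding goldstein_subdiff_def
    by (intro compact_imp_closed compact_convex_hull compact_clarke_union) (rule convex_convex_hull)
  ultimately obtain a b where ab: "a \<bullet> g < b" "\<forall>s\<in>goldstein_subdiff \<delta> F x. a \<bullet> s > b"
    using separating_hyperplane_closed_point by metis
  define v where "v = - a"
  define \<beta> where "\<beta> = - b"
  have gv: "g \<bullet> v > \<beta>" using ab(1) by (simp add: v_def \<beta>_def inner_commute)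
  have le: "cdir y v \<le> \<beta>" if "y \<in> cball x \<delta>" for y
  proof (rule ccontr)
    assume "\<not> cdir y v \<le> \<beta>"
    then obtain s where s: "s \<in> clarke_subdiff F y" "s \<bullet> v > \<beta>" using clarke_support[of \<beta> y v] by (auto simp: not_le)
    then have "s \<in> goldstein_subdiff \<delta> F x"
      unfolding goldstein_subdiff_def using that by (intro hull_inc) blast
    with ab(2) s(2) show False by (force simp: v_def \<beta>_def inner_commute)
  qed
  define \<tau> where "\<tau> n = inverse (real (Suc n))" for n
  have \<tau>: "\<tau> n > 0" for n by (simp add: \<tau>_def)
  have \<tau>0: "\<tau> \<longlonglongrightarrow> 0" unfolding \<tau>_def by (rule LIMSEQ_inverse_real_of_nat)
  have \<tau>r: "filterlim \<tau> (at_right 0) sequentially"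
    using \<tau>0 \<tau> by (auto simp: filterlim_at intro!: always_eventually less_imp_neq[THEN not_sym])
  define q where "q n u = (F (x + \<delta> *\<^sub>R u + \<tau> n *\<^sub>R v) - F (x + \<delta> *\<^sub>R u)) / \<tau> n" for n u
  have qb: "\<bar>q n u\<bar> \<le> G * norm v" for n u unfolding q_def by (rule quotient_bound[OF \<tau>])
  have [measurable]: "q n \<in> borel_measurable borel" for n unfolding q_def by measurable
  define M where "M = max (G * norm v) \<bar>\<beta>\<bar>"
  have maxb: "\<bar>max (q n u) \<beta>\<bar> \<le> M" for n u using qb[of n u] by (auto simp: M_def max_def)
  have qint: "integrable unif_ball (q n)" for n
    by (rule integrable_const_bound[where B="G * norm v"]) (use qb in auto)
  have mint: "integrable unif_ball (\<lambda>u. max (q n u) \<beta>)" for n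
    by (rule integrable_const_bound[where B=M]) (use maxb in auto)
  have "(\<lambda>n. \<integral>u. max (q n u) \<beta> \<partial>unif_ball) \<longlonglongrightarrow> (\<integral>u. \<beta> \<partial>(unif_ball :: 'a measure))"
  proof (rule integral_dominated_convergence[where w="\<lambda>_. M"])
    show "AE u in unif_ball. (\<lambda>n. max (q n u) \<beta>) \<longlonglongrightarrow> \<beta>"
      using AE_unif_ball
    proof eventually_elim
      case (elim u)
      let ?y = "x + \<delta> *\<^sub>R u"
      have y: "?y \<in> cball x \<delta>" using elim \<delta> by (simp add: dist_norm)
      show ?case
      proof (rule order_tendstoI)
        fix c assume "c < \<beta>"
        then show "\<forall>\<^sub>F n in sequentially. c < max (q n u) \<beta>" by (simp add: less_max_iff_disj)
      next
        fix c assume c: "\<beta> < c"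
        then have "cdir ?y v < c" using le[OF y] by simp
        from cdir_less[OF this]
        have "\<forall>\<^sub>F (y, t) in base_filter ?y. (F (y + t *\<^sub>R v) - F y) / t < c" .
        moreover have "filterlim (\<lambda>n. (?y, \<tau> n)) (base_filter ?y) sequentially"
          by (intro filterlim_Pair tendsto_const \<tau>r)
        ultimately have "\<forall>\<^sub>F n in sequentially. q n u < c"
          unfolding filterlim_iff q_def by fastforce
        then show "\<forall>\<^sub>F n in sequentially. max (q n u) \<beta> < c"
          by eventually_elim (use c in auto)
      qed
    qed
  qed (use maxb in auto)
  then have lim1: "(\<lambda>n. \<integral>u. max (q n u) \<beta> \<partial>unif_ball) \<longlonglongrightarrow> \<beta>" using prob_space by simp
  note Fint = integrable_smoothing[OF F, of _ \<delta>]
  have "(\<lambda>n. \<integral>u. q n u \<partial>unif_ball) \<longlonglongrightarrow> g \<bullet> v"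
  proof -
    have "(\<integral>u. q n u \<partial>unif_ball) = (smoothing unif_ball \<delta> F (x + (0 + \<tau> n) *\<^sub>R v) - smoothing unif_ball \<delta> F (x + 0 *\<^sub>R v)) / \<tau> n" for n
      unfolding q_def smoothing_def using Fint[of "x + \<tau> n *\<^sub>R v"] Fint[of x]
      by (simp add: add_ac)
    moreover have "(\<lambda>t. (smoothing unif_ball \<delta> F (x + (0 + t) *\<^sub>R v) - smoothing unif_ball \<delta> F (x + 0 *\<^sub>R v)) / t) \<midarrow>0\<rightarrow> g \<bullet> v"
      using smoothing_directional_deriv[OF F \<delta>, of x v] unfolding DERIV_def g_def .
    moreover have "filterlim \<tau> (at 0) sequentially" using \<tau>r by (auto simp: filterlim_at elim: eventually_mono)
    ultimately show ?thesis by (simp only: ) (rule filterlim_compose)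
  qed
  moreover have "(\<integral>u. q n u \<partial>unif_ball) \<le> (\<integral>u. max (q n u) \<beta> \<partial>unif_ball)" for n
    by (intro integral_mono qint mint) auto
  ultimately have "g \<bullet> v \<le> \<beta>"
    using lim1 by (intro tendsto_le[OF _ lim1]) auto
  with gv show False by simp
qed

end


section \<open>Smoothing over the sphere\<close>

lemma AE_unif_sphere_norm: "AE u in unif_sphere. norm (u::'a::euclidean_space) = 1"
proof -
  have "AE v in (lborel :: 'a measure). v \<noteq> 0" by (rule AE_lborel_singleton)
  then have "AE v in (unif_ball :: 'a measure). v \<noteq> 0"
    unfolding unif_ball_def by (intro AE_uniform_measureI) (auto elim: eventually_mono)
  then show ?thesis
    unfolding unif_sphere_def by (subst AE_distr_iff) (auto simp: norm_sgn elim: eventually_mono)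
qed

text \<open>The average of \<open>\<bar>norm x - 1\<bar>\<close> over the unit sphere around \<open>t *\<^sub>R b\<close> vanishes for \<open>t = 0\<close> and grows at
  least like a multiple \<open>\<kappa> b\<close> of \<open>\<bar>t\<bar>\<close>. Since \<open>t = 0\<close> is a minimum, differentiability forces \<open>\<kappa> b = 0\<close>. But
  the sum of \<open>\<kappa> b\<close> over the basis is the mean of the \<open>1\<close>-norm on the sphere.\<close>

theorem not_smoothing_constant_unif_sphere:
  "\<not> smoothing_constant (unif_sphere :: 'a::euclidean_space measure) c"
proof
  assume c: "smoothing_constant (unif_sphere :: 'a measure) c"
  interpret prob_space "unif_sphere :: 'a measure" by (rule prob_space_unif_sphere)
  define F where "F x = \<bar>norm x - 1\<bar>" for x :: 'a
  have F: "1-lipschitz_on UNIV F"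
  proof (rule lipschitz_onI)
    fix x y :: 'a show "dist (F x) (F y) \<le> 1 * dist x y"
      using norm_triangle_ineq3[of x y] unfolding F_def dist_norm by simp
  qed simp
  note [measurable] = borel_measurable_lipschitz[OF F]
  define s where "s = smoothing unif_sphere 1 F"
  have s_eq: "s x = (\<integral>u. F (x + u) \<partial>unif_sphere)" for x by (simp add: s_def smoothing_def)
  have diff: "s differentiable (at 0)" 
    using c[unfolded smoothing_constant_def, THEN conjunct2, rule_format, OF zero_less_one zero_less_one F]
    unfolding s_def by blast
  have intF: "integrable unif_sphere (\<lambda>u. F (x + u))" for x
  proof (rule integrable_const_bound[where B="norm x + 2"])
    show "AE u in unif_sphere. norm (F (x + u)) \<le> norm x + 2"
      using AE_unif_sphere_norm
    proof eventually_elim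
      case (elim u)
      then show ?case using norm_triangle_ineq[of x u] norm_ge_zero[of "x + u"] norm_ge_zero[of x] unfolding F_def real_norm_def by linarith
    qed
  qed measurable
  have s0: "s 0 = 0"
    unfolding s_eq by (subst integral_eq_zero_AE) (use AE_unif_sphere_norm in \<open>auto simp: F_def elim: eventually_mono\<close>)
  have s_nonneg: "s x \<ge> 0" for x unfolding s_eq by (intro integral_nonneg_AE AE_I2) (simp add: F_def)
  define \<kappa> where "\<kappa> b = (\<integral>u. \<bar>b \<bullet> u\<bar> \<partial>unif_sphere)" for b :: 'a
  have int\<kappa>: "integrable unif_sphere (\<lambda>u. \<bar>b \<bullet> u\<bar>)" for b :: 'a
  proof (rule integrable_const_bound[where B="norm b"])
    show "AE u in unif_sphere. norm \<bar>b \<bullet> u\<bar> \<le> norm b"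
      using AE_unif_sphere_norm
    proof eventually_elim
      case (elim u) then show ?case using Cauchy_Schwarz_ineq2[of b u] by simp
    qed
  qed measurable
  have lower: "(2 * \<kappa> b - t) / 3 \<le> s (t *\<^sub>R b) / t" if b: "norm b = 1" and t: "0 < t" "t < 1" for b t
  proof -
    have "(2 * t * \<kappa> b - t\<^sup>2) / 3 = (\<integral>u. (2 * t * \<bar>b \<bullet> u\<bar> - t\<^sup>2) / 3 \<partial>unif_sphere)"
      unfolding \<kappa>_def using int\<kappa>[of b] prob_space by simp
    also have "\<dots> \<le> s (t *\<^sub>R b)"
      unfolding s_eq
    proof (rule integral_mono_AE)
      show "integrable unif_sphere (\<lambda>u. (2 * t * \<bar>b \<bullet> u\<bar> - t\<^sup>2) / 3)" using int\<kappa>[of b] by simp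
      show "integrable unif_sphere (\<lambda>u. F (t *\<^sub>R b + u))" by (rule intF)
      show "AE u in unif_sphere. (2 * t * \<bar>b \<bullet> u\<bar> - t\<^sup>2) / 3 \<le> F (t *\<^sub>R b + u)"
        using AE_unif_sphere_norm
      proof eventually_elim
        case (elim u)
        let ?n = "norm (t *\<^sub>R b + u)"
        have "?n\<^sup>2 = t\<^sup>2 * (norm b)\<^sup>2 + 2 * t * (b \<bullet> u) + (norm u)\<^sup>2"
          unfolding power2_norm_eq_inner by (simp add: inner_add_left inner_add_right inner_commute power2_eq_square)
        then have "(?n - 1) * (?n + 1) = 2 * t * (b \<bullet> u) + t\<^sup>2"
          using elim b by (simp add: power2_eq_square algebra_simps)
        then have "\<bar>?n - 1\<bar> * (?n + 1) = \<bar>2 * t * (b \<bullet> u) + t\<^sup>2\<bar>"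
          by (metis abs_mult abs_of_nonneg add_nonneg_nonneg norm_ge_zero zero_le_one)
        also have "\<dots> \<ge> \<bar>2 * t * (b \<bullet> u)\<bar> - t\<^sup>2" using zero_le_power2[of t] by linarith
        also have "\<bar>2 * t * (b \<bullet> u)\<bar> = 2 * t * \<bar>b \<bullet> u\<bar>" using t by (simp add: abs_mult)
        finally have "2 * t * \<bar>b \<bullet> u\<bar> - t\<^sup>2 \<le> \<bar>?n - 1\<bar> * (?n + 1)" .
        also have "\<dots> \<le> \<bar>?n - 1\<bar> * 3"
          using norm_triangle_ineq[of "t *\<^sub>R b" u] elim b t by (intro mult_left_mono) auto
        finally show ?case by (simp add: F_def)
      qed
    qed
    finally have "(2 * t * \<kappa> b - t\<^sup>2) / 3 / t \<le> s (t *\<^sub>R b) / t" using t by (intro divide_right_mono) auto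
    moreover have "(2 * t * \<kappa> b - t\<^sup>2) / 3 / t = (2 * \<kappa> b - t) / 3" using t by (simp add: power2_eq_square field_simps)
    ultimately show ?thesis by (simp only:)
  qed
  have "\<kappa> b \<le> 0" if b: "norm b = 1" for b
  proof -
    obtain D where D: "(s has_derivative D) (at (0 *\<^sub>R b))" using diff by (auto simp: differentiable_def)
    have "((\<lambda>t. t *\<^sub>R b) has_derivative (\<lambda>t. t *\<^sub>R b)) (at 0)" by (auto intro!: derivative_eq_intros)
    from has_derivative_compose[OF this D]
    have "((\<lambda>t. s (t *\<^sub>R b)) has_derivative (\<lambda>t. D (t *\<^sub>R b))) (at 0)" .
    moreover have "D (t *\<^sub>R b) = D b * t" for t
      using has_derivative_linear[OF D] by (simp add: linear_scale mult.commute)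
    ultimately have d: "((\<lambda>t. s (t *\<^sub>R b)) has_real_derivative D b) (at 0)"
      by (simp add: has_field_derivative_def)
    have "D b = 0"
      by (rule DERIV_local_min[OF d zero_less_one]) (simp add: s0 s_nonneg)
    with d have "(\<lambda>t. s (t *\<^sub>R b) / t) \<midarrow>0\<rightarrow> 0" by (simp add: DERIV_def s0)
    then have "((\<lambda>t. s (t *\<^sub>R b) / t) \<longlongrightarrow> 0) (at_right 0)" by (rule filterlim_mono[OF _ order_refl at_le]) simp
    moreover have "((\<lambda>t. (2 * \<kappa> b - t) / 3) \<longlongrightarrow> (2 * \<kappa> b - 0) / 3) (at_right 0)" by (intro tendsto_intros) simp
    moreover have "\<forall>\<^sub>F t in at_right 0. (2 * \<kappa> b - t) / 3 \<le> s (t *\<^sub>R b) / t"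
      unfolding eventually_at_right_field using lower[OF b] by (intro exI[of _ 1]) auto
    ultimately have "(2 * \<kappa> b - 0) / 3 \<le> 0" by (rule tendsto_le[OF trivial_limit_at_right_real])
    then show ?thesis by simp
  qed
  then have "(\<Sum>b\<in>(Basis::'a set). \<kappa> b) \<le> 0" by (intro sum_nonpos) auto
  moreover have "(\<Sum>b\<in>(Basis::'a set). \<kappa> b) = (\<integral>u. (\<Sum>b\<in>Basis. \<bar>b \<bullet> u\<bar>) \<partial>(unif_sphere :: 'a measure))"
    unfolding \<kappa>_def using int\<kappa> by (subst Bochner_Integration.integral_sum) auto
  moreover have "(\<integral>u. 1 \<partial>(unif_sphere :: 'a measure)) \<le> (\<integral>u. (\<Sum>b\<in>Basis. \<bar>b \<bullet> u\<bar>) \<partial>(unif_sphere :: 'a measure))"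
  proof (rule integral_mono_AE)
    show "AE u in unif_sphere. 1 \<le> (\<Sum>b\<in>Basis. \<bar>b \<bullet> u\<bar>)" for u :: 'a
      using AE_unif_sphere_norm
    proof eventually_elim
      case (elim u) then show ?case using norm_le_l1[of u] by (simp add: inner_commute)
    qed
  qed (use int\<kappa> in auto)
  ultimately show False using prob_space by simp
qed


section \<open>One proximal step\<close>

lemma (in prob_space) expectation_square_le:
  fixes Z :: "'a \<Rightarrow> real"
  assumes [measurable]: "Z \<in> borel_measurable M" and sq: "integrable M (\<lambda>x. (Z x)\<^sup>2)"
  shows "integrable M Z" "(expectation Z)\<^sup>2 \<le> expectation (\<lambda>x. (Z x)\<^sup>2)"
proof -
  have "\<bar>z\<bar> \<le> 1 + z\<^sup>2" for z :: real
  proof -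
    have "0 \<le> (\<bar>z\<bar> - 1)\<^sup>2" "0 \<le> \<bar>z\<bar>" by simp_all
    then show ?thesis unfolding power2_diff by simp
  qed
  then show int: "integrable M Z"
    using sq by (intro Bochner_Integration.integrable_bound[where f="\<lambda>x. 1 + (Z x)\<^sup>2" and g=Z]) (auto intro!: AE_I2)
  have "0 \<le> expectation (\<lambda>x. (Z x - expectation Z)\<^sup>2)" by (intro integral_nonneg_AE AE_I2) simp
  also have "\<dots> = expectation (\<lambda>x. (Z x)\<^sup>2) - (expectation Z)\<^sup>2"
    using variance_eq[OF int sq] .
  finally show "(expectation Z)\<^sup>2 \<le> expectation (\<lambda>x. (Z x)\<^sup>2)" by simp
qed

lemma (in prob_space) expectation_le_sqrt:
  fixes Z :: "'a \<Rightarrow> real"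
  assumes "Z \<in> borel_measurable M" "integrable M (\<lambda>x. (Z x)\<^sup>2)"
  shows "expectation Z \<le> sqrt (expectation (\<lambda>x. (Z x)\<^sup>2))"
  using expectation_square_le(2)[OF assms] by (rule real_le_rsqrt)

text \<open>Approximate the second argument by simple functions: for these the sections of \<open>f\<close> are patched from
  finitely many measurable pieces, and continuity gives the limit.\<close>

lemma borel_measurable_caratheodory:
  fixes f :: "'s \<Rightarrow> 'a::euclidean_space \<Rightarrow> real"
  assumes meas: "\<And>x. (\<lambda>\<xi>. f \<xi> x) \<in> borel_measurable P"
    and cont: "\<And>\<xi>. \<xi> \<in> space P \<Longrightarrow> continuous_on UNIV (f \<xi>)"
  shows "(\<lambda>z. f (snd z) (fst z)) \<in> borel_measurable (borel \<Otimes>\<^sub>M P)"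
proof -
  have "(\<lambda>x. x) \<in> borel_measurable (borel :: 'a measure)" by simp
  from borel_measurable_implies_sequence_metric[OF this, of 0]
  obtain s where "(\<forall>i. simple_function (borel :: 'a measure) (s i)) \<and> (\<forall>x\<in>space (borel :: 'a measure). (\<lambda>i. s i x) \<longlonglongrightarrow> x) \<and>
    (\<forall>i. \<forall>x\<in>space (borel :: 'a measure). dist (s i x) 0 \<le> 2 * dist x 0)"
    by (rule exE)
  then have s: "simple_function (borel :: 'a measure) (s i)" "(\<lambda>i. s i x) \<longlonglongrightarrow> x" for i x
    by simp_all
  show ?thesis
  proof (rule borel_measurable_LIMSEQ_metric)
    fix i
    have fin: "finite (range (s i))" using s(1)[of i] by (simp add: simple_function_def)
    have "s i \<in> measurable borel (count_space (range (s i)))"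
      using s(1)[of i] fin by (subst measurable_count_space_eq2) (auto simp: simple_function_def)
    then have g: "(\<lambda>z. s i (fst z)) \<in> measurable (borel \<Otimes>\<^sub>M P) (count_space (range (s i)))"
      by (rule measurable_compose[OF measurable_fst])
    show "(\<lambda>z. f (snd z) (s i (fst z))) \<in> borel_measurable (borel \<Otimes>\<^sub>M P)"
      by (rule measurable_compose_countable'[where f="\<lambda>a z. f (snd z) a", OF _ g])
        (auto intro: countable_finite[OF fin] measurable_compose[OF measurable_snd meas])
  next
    fix z :: "'a \<times> 's" assume "z \<in> space (borel \<Otimes>\<^sub>M P)"
    then have "snd z \<in> space P" by (auto simp: space_pair_measure)
    from cont[OF this] have "isCont (f (snd z)) (fst z)" by (simp add: continuous_on_eq_continuous_at)
    then show "(\<lambda>i. f (snd z) (s i (fst z))) \<longlonglongrightarrow> f (snd z) (fst z)"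
      using s(2) by (rule isCont_tendsto_compose)
  qed
qed

lemma descent_lemma:
  fixes F :: "'a::euclidean_space \<Rightarrow> real"
  assumes d: "\<And>x. GDERIV F x :> g x" and lip: "M-lipschitz_on UNIV g"
  shows "F y \<le> F x + g x \<bullet> (y - x) + M / 2 * (norm (y - x))\<^sup>2"
proof -
  define v where "v = y - x"
  define q where "q s = F (x + s *\<^sub>R v) - s * (g x \<bullet> v) - M / 2 * s\<^sup>2 * (norm v)\<^sup>2" for s
  have der: "(q has_real_derivative (g (x + s *\<^sub>R v) \<bullet> v - g x \<bullet> v - M * s * (norm v)\<^sup>2)) (at s)" for s
  proof -
    have "((\<lambda>s. x + s *\<^sub>R v) has_derivative (\<lambda>t. t *\<^sub>R v)) (at s)" by (auto intro!: derivative_eq_intros)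
    with d have "((\<lambda>s. F (x + s *\<^sub>R v)) has_real_derivative g (x + s *\<^sub>R v) \<bullet> v) (at s)"
      by (rule GDERIV_compose_curve)
    then show ?thesis unfolding q_def by (auto intro!: derivative_eq_intros)
  qed
  have "q 1 \<le> q 0"
  proof (rule DERIV_nonpos_imp_nonincreasing[OF zero_le_one])
    fix s :: real assume s: "0 \<le> s" "s \<le> 1"
    have "(g (x + s *\<^sub>R v) - g x) \<bullet> v \<le> norm (g (x + s *\<^sub>R v) - g x) * norm v" by (rule norm_cauchy_schwarz)
    also have "\<dots> \<le> (M * (s * norm v)) * norm v"
      using lipschitz_onD[OF lip, of "x + s *\<^sub>R v" x] s by (intro mult_right_mono) (auto simp: dist_norm)
    finally have "g (x + s *\<^sub>R v) \<bullet> v - g x \<bullet> v - M * s * (norm v)\<^sup>2 \<le> 0"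
      by (simp add: inner_diff_left power2_eq_square mult_ac)
    then show "\<exists>y. DERIV q s :> y \<and> y \<le> 0" using der[of s] by (intro exI conjI)
  qed
  then show ?thesis by (simp add: q_def v_def)
qed

locale stochastic_lipschitz =
  fixes P :: "'s measure" and f :: "'s \<Rightarrow> 'a::euclidean_space \<Rightarrow> real" and L :: "'s \<Rightarrow> real"
    and G :: real and F :: "'a \<Rightarrow> real"
  assumes prob_P: "prob_space P"
    and f_int: "\<And>x. integrable P (\<lambda>\<xi>. f \<xi> x)"
    and f_lip: "\<And>\<xi>. \<xi> \<in> space P \<Longrightarrow> (L \<xi>)-lipschitz_on UNIV (f \<xi>)"
    and L_meas [measurable]: "L \<in> borel_measurable P"
    and L_sq: "integrable P (\<lambda>\<xi>. (L \<xi>)\<^sup>2)" "(\<integral>\<xi>. (L \<xi>)\<^sup>2 \<partial>P) \<le> G\<^sup>2"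
    and G: "G > 0"
    and F_def: "F = (\<lambda>x. \<integral>\<xi>. f \<xi> x \<partial>P)"
begin

sublocale P: prob_space P by (rule prob_P)

lemma F_lipschitz: "G-lipschitz_on UNIV F"
proof (rule lipschitz_onI)
  fix x y :: 'a
  have "(\<integral>\<xi>. L \<xi> \<partial>P)\<^sup>2 \<le> G\<^sup>2" using P.expectation_square_le(2)[OF L_meas L_sq(1)] L_sq(2) by simp
  then have EL: "(\<integral>\<xi>. L \<xi> \<partial>P) \<le> G" using G by (rule power2_le_imp_le[OF _ less_imp_le])
  have "dist (F x) (F y) = \<bar>\<integral>\<xi>. f \<xi> x - f \<xi> y \<partial>P\<bar>"
    unfolding F_def dist_real_def by (subst Bochner_Integration.integral_diff[OF f_int f_int]) (rule refl)
  also have "\<dots> \<le> (\<integral>\<xi>. \<bar>f \<xi> x - f \<xi> y\<bar> \<partial>P)" by (rule integral_abs_bound)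
  also have "\<dots> \<le> (\<integral>\<xi>. L \<xi> * dist x y \<partial>P)"
  proof (rule integral_mono)
    show "integrable P (\<lambda>\<xi>. \<bar>f \<xi> x - f \<xi> y\<bar>)"
      by (intro integrable_abs Bochner_Integration.integrable_diff f_int)
    show "integrable P (\<lambda>\<xi>. L \<xi> * dist x y)"
      by (rule integrable_mult_left) (rule P.expectation_square_le(1)[OF L_meas L_sq(1)])
    fix \<xi> assume "\<xi> \<in> space P"
    from lipschitz_onD[OF f_lip[OF this], of x y] show "\<bar>f \<xi> x - f \<xi> y\<bar> \<le> L \<xi> * dist x y" by (simp add: dist_real_def)
  qed
  also have "\<dots> = (\<integral>\<xi>. L \<xi> \<partial>P) * dist x y" by (rule integral_mult_left_zero)
  also have "\<dots> \<le> G * dist x y" using EL by (rule mult_right_mono) (rule zero_le_dist)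
  finally show "dist (F x) (F y) \<le> G * dist x y" .
qed (use G in simp)

lemma F_meas [measurable]: "F \<in> borel_measurable borel"
  by (rule borel_measurable_lipschitz[OF F_lipschitz])

end

locale zo_prox = stochastic_lipschitz P f L G F
  for P :: "'s measure" and f :: "'s \<Rightarrow> 'a::euclidean_space \<Rightarrow> real" and L G F +
  fixes h :: "'a \<Rightarrow> ereal" and \<delta> \<gamma> :: real
  assumes h: "proper_closed_convex h"
    and \<delta>: "\<delta> > 0" and \<gamma>: "\<gamma> > 0"
    and smooth: "(1 / \<gamma>)-lipschitz_on UNIV (sphere_grad \<delta> F)"
begin

sublocale U: prob_space "unif_sphere :: 'a measure" by (rule prob_space_unif_sphere)

abbreviation Q :: "('a \<times> 's) measure" where "Q \<equiv> unif_sphere \<Otimes>\<^sub>M P"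

sublocale UP: pair_prob_space "unif_sphere :: 'a measure" P ..

definition est :: "'a \<Rightarrow> 'a \<times> 's \<Rightarrow> 'a" where
  "est x z = (DIM('a) / (2 * \<delta>) * (f (snd z) (x + \<delta> *\<^sub>R fst z) - f (snd z) (x - \<delta> *\<^sub>R fst z))) *\<^sub>R fst z"

text \<open>The gradient of the smoothed function, by \<open>gradient_smoothing_unif_ball\<close>.\<close>

abbreviation m :: "'a \<Rightarrow> 'a" where "m \<equiv> sphere_grad \<delta> F"

lemma m_meas [measurable]: "m \<in> borel_measurable borel"
  by (rule borel_measurable_lipschitz[OF smooth])

lemma f_meas_joint: "(\<lambda>z. f (snd z) (fst z)) \<in> borel_measurable (borel \<Otimes>\<^sub>M P)"
  by (rule borel_measurable_caratheodory) (use f_int in \<open>auto intro: lipschitz_on_continuous_on[OF f_lip]\<close>)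

lemma f_meas_compose [measurable (raw)]:
  assumes [measurable]: "a \<in> borel_measurable N" "b \<in> measurable N P"
  shows "(\<lambda>z. f (b z) (a z)) \<in> borel_measurable N"
  using measurable_compose[OF _ f_meas_joint, of "\<lambda>z. (a z, b z)" N] by simp

lemma est_meas [measurable (raw)]:
  assumes [measurable]: "a \<in> borel_measurable N" "b \<in> measurable N Q"
  shows "(\<lambda>z. est (a z) (b z)) \<in> borel_measurable N"
proof -
  have [measurable]: "(\<lambda>z. fst (b z)) \<in> borel_measurable N"
    using measurable_compose[OF assms(2) measurable_fst]
    by (subst (asm) measurable_cong_sets[OF refl sets_unif_sphere])
  have [measurable]: "(\<lambda>z. snd (b z)) \<in> measurable N P"
    by (rule measurable_compose[OF assms(2) measurable_snd])
  show ?thesis unfolding est_def by measurable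
qed

text \<open>The factor \<open>DIM('a)\<^sup>2 / (4 * \<delta>\<^sup>2)\<close> of the estimator meets the bound \<open>84 * \<delta>\<^sup>2 * (L \<xi>)\<^sup>2 / DIM('a)\<close>.\<close>

lemma est_second_moment: "(\<integral>\<^sup>+z. ennreal ((norm (est x z))\<^sup>2) \<partial>Q) \<le> ennreal (21 * DIM('a) * G\<^sup>2)"
proof -
  define c where "c = DIM('a) / (2 * \<delta>)"
  have "(\<integral>\<^sup>+z. ennreal ((norm (est x z))\<^sup>2) \<partial>Q) = (\<integral>\<^sup>+\<xi>. \<integral>\<^sup>+u. ennreal ((norm (est x (u, \<xi>)))\<^sup>2) \<partial>unif_sphere \<partial>P)"
    by (rule UP.nn_integral_snd[symmetric]) measurable
  also have "\<dots> \<le> (\<integral>\<^sup>+\<xi>. ennreal (21 * DIM('a) * (L \<xi>)\<^sup>2) \<partial>P)"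
  proof (rule nn_integral_mono)
    fix \<xi> assume \<xi>: "\<xi> \<in> space P"
    note [measurable] = borel_measurable_lipschitz[OF f_lip[OF \<xi>]]
    let ?D = "\<lambda>u. (f \<xi> (x + \<delta> *\<^sub>R u) - f \<xi> (x - \<delta> *\<^sub>R u))\<^sup>2"
    have "(\<integral>\<^sup>+u. ennreal ((norm (est x (u, \<xi>)))\<^sup>2) \<partial>unif_sphere) \<le> (\<integral>\<^sup>+u. ennreal (c\<^sup>2) * ennreal (?D u) \<partial>unif_sphere)"
    proof (rule nn_integral_mono_AE)
      show "AE u in unif_sphere. ennreal ((norm (est x (u, \<xi>)))\<^sup>2) \<le> ennreal (c\<^sup>2) * ennreal (?D u)"
        using AE_unif_sphere
      proof eventually_elim
        case (elim u)
        have "(norm (est x (u, \<xi>)))\<^sup>2 = c\<^sup>2 * ?D u * (norm u)\<^sup>2"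
          unfolding est_def norm_scaleR fst_conv snd_conv c_def[symmetric] power_mult_distrib power2_abs by simp
        also have "\<dots> \<le> c\<^sup>2 * ?D u * 1"
          using elim by (intro mult_left_mono) (auto simp: power_le_one)
        finally show ?case by (simp flip: ennreal_mult)
      qed
    qed
    also have "\<dots> = ennreal (c\<^sup>2) * (\<integral>\<^sup>+u. ennreal (?D u) \<partial>unif_sphere)"
      by (rule nn_integral_cmult) measurable
    also have "\<dots> \<le> ennreal (c\<^sup>2) * ennreal (84 * \<delta>\<^sup>2 * (L \<xi>)\<^sup>2 / DIM('a))"
      by (intro mult_left_mono sphere_two_point_second_moment f_lip \<xi> \<delta>) auto
    also have "\<dots> = ennreal (21 * DIM('a) * (L \<xi>)\<^sup>2)"
      using \<delta> by (simp add: c_def power2_eq_square field_simps flip: ennreal_mult)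
    finally show "(\<integral>\<^sup>+u. ennreal ((norm (est x (u, \<xi>)))\<^sup>2) \<partial>unif_sphere) \<le> ennreal (21 * DIM('a) * (L \<xi>)\<^sup>2)" .
  qed
  also have "\<dots> = ennreal (21 * DIM('a) * (\<integral>\<xi>. (L \<xi>)\<^sup>2 \<partial>P))"
    using L_sq(1) by (subst nn_integral_eq_integral) auto
  also have "\<dots> \<le> ennreal (21 * DIM('a) * G\<^sup>2)"
    using L_sq(2) by (intro ennreal_leI mult_left_mono) auto
  finally show ?thesis .
qed

lemma est_sq_integrable: "integrable Q (\<lambda>z. (norm (est x z))\<^sup>2)"
  using est_second_moment[of x] by (intro integrableI_bounded) (auto intro: le_less_trans)

lemma est_integrable: "integrable Q (est x)"
proof -
  have "integrable Q (\<lambda>z. norm (est x z))"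
    by (rule UP.expectation_square_le(1)[OF _ est_sq_integrable]) measurable
  then show ?thesis by (subst (asm) integrable_norm_iff) measurable
qed

lemma est_mean: "(\<integral>z. est x z \<partial>Q) = m x"
proof -
  have "(\<integral>z. est x z \<partial>Q) = (\<integral>u. \<integral>\<xi>. est x (u, \<xi>) \<partial>P \<partial>unif_sphere)"
    using UP.integral_fst'[OF est_integrable] by simp
  also have "\<dots> = (\<integral>u. (DIM('a) / (2 * \<delta>) * (F (x + \<delta> *\<^sub>R u) - F (x - \<delta> *\<^sub>R u))) *\<^sub>R u \<partial>unif_sphere)"
    using f_int by (simp add: est_def F_def)
  also have "\<dots> = m x" by (rule sphere_grad_odd[OF F_lipschitz, symmetric])
  finally show ?thesis .
qed

lemma est_centered:
  "integrable Q (\<lambda>z. est x z - m x)" "(\<integral>z. est x z - m x \<partial>Q) = 0"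
  "(\<integral>\<^sup>+z. ennreal ((norm (est x z - m x))\<^sup>2) \<partial>Q) \<le> ennreal (21 * DIM('a) * G\<^sup>2)"
proof -
  show "integrable Q (\<lambda>z. est x z - m x)" using est_integrable by simp
  show "(\<integral>z. est x z - m x \<partial>Q) = 0" using est_integrable by (simp add: est_mean UP.prob_space)
  have eq: "(norm (est x z - m x))\<^sup>2 = (norm (est x z))\<^sup>2 - 2 * (est x z \<bullet> m x) + (norm (m x))\<^sup>2" for z
    unfolding power2_norm_eq_inner by (simp add: inner_diff_left inner_diff_right inner_commute)
  have int: "integrable Q (\<lambda>z. 2 * (est x z \<bullet> m x))" using est_integrable by simp
  have "(\<integral>z. est x z \<bullet> m x \<partial>Q) = (norm (m x))\<^sup>2"
    by (subst integral_inner_left) (simp_all add: est_integrable est_mean power2_norm_eq_inner)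
  then have "(\<integral>z. (norm (est x z - m x))\<^sup>2 \<partial>Q) \<le> (\<integral>z. (norm (est x z))\<^sup>2 \<partial>Q)"
    unfolding eq using est_sq_integrable int by (simp add: UP.prob_space)
  moreover have "integrable Q (\<lambda>z. (norm (est x z - m x))\<^sup>2)" unfolding eq using est_sq_integrable int by simp
  ultimately have "(\<integral>\<^sup>+z. ennreal ((norm (est x z - m x))\<^sup>2) \<partial>Q) \<le> (\<integral>\<^sup>+z. ennreal ((norm (est x z))\<^sup>2) \<partial>Q)"
    using est_sq_integrable by (simp add: nn_integral_eq_integral ennreal_leI)
  then show "(\<integral>\<^sup>+z. ennreal ((norm (est x z - m x))\<^sup>2) \<partial>Q) \<le> ennreal (21 * DIM('a) * G\<^sup>2)"
    using est_second_moment by (rule order_trans)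
qed

abbreviation F\<delta> :: "'a \<Rightarrow> real" where "F\<delta> \<equiv> smoothing unif_ball \<delta> F"

text \<open>Put \<open>A = norm (y - x) / \<gamma>\<close>. The three-point inequality at \<open>x\<close> and the descent lemma bound the decrease
  below by \<open>\<gamma> * (A\<^sup>2 / 2 - e * A)\<close>, that is, \<open>(A - e)\<^sup>2 \<le> 2 * decrease / \<gamma> + e\<^sup>2\<close>. Nonexpansiveness of the
  proximal operator bounds the exact gradient mapping by \<open>A + e\<close>.\<close>

lemma prox_step:
  fixes x g :: 'a and a :: real
  assumes hx: "h x = ereal a"
  defines "y \<equiv> prox \<gamma> h (x - \<gamma> *\<^sub>R g)" and "e \<equiv> norm (g - m x)"
  shows "\<exists>b. h y = ereal b \<and> 0 \<le> 2 * ((F\<delta> x + a) - (F\<delta> y + b)) / \<gamma> + e\<^sup>2 \<and>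
    norm (grad_map \<gamma> h x (m x)) \<le> 2 * e + sqrt (2 * ((F\<delta> x + a) - (F\<delta> y + b)) / \<gamma> + e\<^sup>2)"
proof -
  obtain b where b: "h y = ereal b"
    "\<And>z r. h z \<le> ereal r \<Longrightarrow> b + 1 / (2 * \<gamma>) * (norm (y - (x - \<gamma> *\<^sub>R g)))\<^sup>2 + 1 / (2 * \<gamma>) * (norm (z - y))\<^sup>2
      \<le> r + 1 / (2 * \<gamma>) * (norm (z - (x - \<gamma> *\<^sub>R g)))\<^sup>2"
    using prox_spec[OF h \<gamma>, of "x - \<gamma> *\<^sub>R g"] unfolding y_def by blast
  define v where "v = y - x"
  define A where "A = norm v / \<gamma>"
  have nv: "norm v = \<gamma> * A" using \<gamma> by (simp add: A_def)
  have e: "y - (x - \<gamma> *\<^sub>R g) = v + \<gamma> *\<^sub>R g" "x - (x - \<gamma> *\<^sub>R g) = \<gamma> *\<^sub>R g" "norm (x - y) = norm v"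
    by (simp_all add: v_def norm_minus_commute)
  have "b + 1 / (2 * \<gamma>) * (norm (v + \<gamma> *\<^sub>R g))\<^sup>2 + 1 / (2 * \<gamma>) * (norm v)\<^sup>2 \<le> a + 1 / (2 * \<gamma>) * (norm (\<gamma> *\<^sub>R g))\<^sup>2"
    using b(2)[of x a, unfolded e] hx by simp
  moreover have "1 / (2 * \<gamma>) * (norm (v + \<gamma> *\<^sub>R g))\<^sup>2 = 1 / (2 * \<gamma>) * (norm v)\<^sup>2 + g \<bullet> v + 1 / (2 * \<gamma>) * (norm (\<gamma> *\<^sub>R g))\<^sup>2"
    using \<gamma> unfolding power2_norm_eq_inner by (simp add: inner_add_left inner_add_right inner_commute field_simps)
  ultimately have 1: "b + g \<bullet> v + 2 * (1 / (2 * \<gamma>) * (norm v)\<^sup>2) \<le> a" by linarith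
  have 2: "F\<delta> y \<le> F\<delta> x + m x \<bullet> v + 1 / \<gamma> / 2 * (norm v)\<^sup>2"
    unfolding v_def by (rule descent_lemma[OF GDERIV_smoothing_unif_ball[OF F_lipschitz \<delta>] smooth])
  have "(g - m x) \<bullet> v \<ge> - (e * norm v)"
    using Cauchy_Schwarz_ineq2[of "g - m x" v] unfolding e_def by linarith
  then have 3: "g \<bullet> v - m x \<bullet> v \<ge> - (e * (\<gamma> * A))" by (simp add: inner_diff_left nv)
  have sq: "1 / (2 * \<gamma>) * (norm v)\<^sup>2 = \<gamma> * A\<^sup>2 / 2" "1 / \<gamma> / 2 * (norm v)\<^sup>2 = \<gamma> * A\<^sup>2 / 2"
    using \<gamma> unfolding nv by (simp_all add: power2_eq_square field_simps)
  define D where "D = (F\<delta> x + a) - (F\<delta> y + b)"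
  have "D \<ge> \<gamma> * A\<^sup>2 / 2 - e * (\<gamma> * A)" using 1 2 3 unfolding D_def sq by linarith
  then have "\<gamma> * (A\<^sup>2 - 2 * e * A) \<le> 2 * D" by (simp add: algebra_simps)
  then have "A\<^sup>2 - 2 * e * A \<le> 2 * D / \<gamma>" using \<gamma> by (simp add: pos_le_divide_eq mult.commute)
  then have D: "(A - e)\<^sup>2 \<le> 2 * D / \<gamma> + e\<^sup>2" by (simp add: power2_diff algebra_simps)
  then have "A - e \<le> sqrt (2 * D / \<gamma> + e\<^sup>2)" by (rule real_le_rsqrt)
  moreover have "norm (grad_map \<gamma> h x (m x)) \<le> A + e"
  proof -
    have "norm (y - prox \<gamma> h (x - \<gamma> *\<^sub>R m x)) \<le> norm ((x - \<gamma> *\<^sub>R g) - (x - \<gamma> *\<^sub>R m x))"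
      unfolding y_def by (rule prox_nonexpansive[OF h \<gamma>])
    also have "(x - \<gamma> *\<^sub>R g) - (x - \<gamma> *\<^sub>R m x) = - (\<gamma> *\<^sub>R (g - m x))" by (simp add: algebra_simps)
    finally have "norm (y - prox \<gamma> h (x - \<gamma> *\<^sub>R m x)) \<le> \<gamma> * e" using \<gamma> by (simp add: e_def)
    moreover have "x - prox \<gamma> h (x - \<gamma> *\<^sub>R m x) = (y - prox \<gamma> h (x - \<gamma> *\<^sub>R m x)) - v" by (simp add: v_def)
    then have "norm (x - prox \<gamma> h (x - \<gamma> *\<^sub>R m x)) \<le> norm (y - prox \<gamma> h (x - \<gamma> *\<^sub>R m x)) + norm v"
      using norm_triangle_ineq4 by metis
    ultimately have "norm (x - prox \<gamma> h (x - \<gamma> *\<^sub>R m x)) \<le> \<gamma> * (A + e)" by (simp add: nv distrib_left)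
    then show ?thesis using \<gamma> by (simp add: grad_map_def divide_le_eq mult.commute)
  qed
  ultimately have "norm (grad_map \<gamma> h x (m x)) \<le> 2 * e + sqrt (2 * D / \<gamma> + e\<^sup>2)" by linarith
  moreover have "0 \<le> 2 * D / \<gamma> + e\<^sup>2" using D zero_le_power2[of "A - e"] by linarith
  ultimately show ?thesis
    unfolding D_def using b(1) by (intro exI[of _ b] conjI)
qed

end


section \<open>Expected progress of the iterates\<close>

lemma val_zo_pgd_cong:
  fixes f :: "'s \<Rightarrow> 'a::euclidean_space \<Rightarrow> real"
  assumes "\<And>s i. s < t \<Longrightarrow> i < B \<Longrightarrow> w (s, i) = w' (s, i)"
  shows "val (zo_pgd f h \<gamma> \<delta> B x0 w t) = val (zo_pgd f h \<gamma> \<delta> B x0 w' t)"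
  using assms
proof (induction t)
  case (Suc t)
  then have IH: "val (zo_pgd f h \<gamma> \<delta> B x0 w t) = val (zo_pgd f h \<gamma> \<delta> B x0 w' t)" by simp
  have "w (t, i) = w' (t, i)" if "i < B" for i using Suc.prems[of t i] that by simp
  then have "(\<Sum>i<B. e (w (t, i))) = (\<Sum>i<B. e (w' (t, i)))" for e :: "'a \<times> 's \<Rightarrow> 'a"
    by (intro sum.cong refl) simp
  from this[of "\<lambda>z. (real DIM('a) / (2 * \<delta>) * (f (snd z) (val (zo_pgd f h \<gamma> \<delta> B x0 w' t) + \<delta> *\<^sub>R fst z)
    - f (snd z) (val (zo_pgd f h \<gamma> \<delta> B x0 w' t) - \<delta> *\<^sub>R fst z))) *\<^sub>R fst z"]
  show ?case unfolding val_zo_pgd_Suc IH Let_def by (simp only:)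
qed simp

context zo_prox
begin

abbreviation X :: "nat \<Rightarrow> 'a \<Rightarrow> (nat \<times> nat \<Rightarrow> 'a \<times> 's) \<Rightarrow> nat \<Rightarrow> 'a" where
  "X B x0 w t \<equiv> val (zo_pgd f h \<gamma> \<delta> B x0 w t)"

definition gest :: "nat \<Rightarrow> 'a \<Rightarrow> (nat \<times> nat \<Rightarrow> 'a \<times> 's) \<Rightarrow> nat \<Rightarrow> 'a" where
  "gest B x0 w t = (1 / real B) *\<^sub>R (\<Sum>i<B. est (X B x0 w t) (w (t, i)))"

lemma X_0: "X B x0 w 0 = x0" by simp

lemma X_Suc: "X B x0 w (Suc t) = prox \<gamma> h (X B x0 w t - \<gamma> *\<^sub>R gest B x0 w t)"
  unfolding val_zo_pgd_Suc gest_def est_def by (simp add: Let_def)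

abbreviation W :: "nat \<Rightarrow> nat \<Rightarrow> (nat \<times> nat \<Rightarrow> 'a \<times> 's) measure" where
  "W T B \<equiv> \<Pi>\<^sub>M j \<in> {..<T} \<times> {..<B}. Q"

lemma prob_space_Q: "prob_space Q" by (rule UP.prob_space_axioms)

lemma prob_space_W: "prob_space (W T B)"
  by (rule prob_space_PiM) (rule prob_space_Q)

lemma prox_meas [measurable]: "prox \<gamma> h \<in> borel_measurable borel"
proof (rule borel_measurable_lipschitz)
  show "1-lipschitz_on UNIV (prox \<gamma> h)"
    by (rule lipschitz_onI) (use prox_nonexpansive[OF h \<gamma>] in \<open>simp_all add: dist_norm\<close>)
qed

lemma h_meas [measurable]: "h \<in> borel_measurable borel"
  by (rule borel_measurable_proper_closed_convex[OF h])

lemma F\<delta>_meas [measurable]: "F\<delta> \<in> borel_measurable borel"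
  by (rule borel_measurable_lipschitz[OF smoothing_lipschitz[OF F_lipschitz]])

lemma X_meas_aux:
  assumes a: "a \<in> borel_measurable N" and w: "\<And>s i. s < t \<Longrightarrow> i < B \<Longrightarrow> (\<lambda>z. b z (s, i)) \<in> measurable N Q"
  shows "(\<lambda>z. X B (a z) (b z) t) \<in> borel_measurable N"
  using w
proof (induction t)
  case 0 then show ?case using a by simp
next
  case (Suc t)
  have [measurable]: "(\<lambda>z. X B (a z) (b z) t) \<in> borel_measurable N" using Suc by simp
  have [measurable]: "(\<lambda>z. b z (t, i)) \<in> measurable N Q" if "i \<in> {..<B}" for i using Suc.prems[of t i] that by simp
  have "(\<lambda>z. gest B (a z) (b z) t) \<in> borel_measurable N" unfolding gest_def by measurable
  then show ?case unfolding X_Suc by measurable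
qed

lemma gest_meas_aux:
  assumes "a \<in> borel_measurable N" "\<And>s i. s < Suc t \<Longrightarrow> i < B \<Longrightarrow> (\<lambda>z. b z (s, i)) \<in> measurable N Q"
  shows "(\<lambda>z. gest B (a z) (b z) t) \<in> borel_measurable N"
proof -
  have [measurable]: "(\<lambda>z. X B (a z) (b z) t) \<in> borel_measurable N" by (rule X_meas_aux) (use assms in auto)
  have [measurable]: "(\<lambda>z. b z (t, i)) \<in> measurable N Q" if "i \<in> {..<B}" for i using assms(2)[of t i] that by simp
  show ?thesis unfolding gest_def by measurable
qed

definition err :: "nat \<Rightarrow> 'a \<Rightarrow> (nat \<times> nat \<Rightarrow> 'a \<times> 's) \<Rightarrow> nat \<Rightarrow> real" where
  "err B x0 w t = norm (gest B x0 w t - m (X B x0 w t))"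

text \<open>The samples of iteration \<open>t\<close> are independent of the iterate \<open>X B x0 w t\<close>, which depends on earlier samples
  only. Splitting the product measure accordingly, the error becomes for a fixed iterate an average of
  \<open>B\<close> independent centred vectors.\<close>

lemma err_second_moment:
  assumes t: "t < T" and B: "B \<ge> 1"
  shows "(\<integral>\<^sup>+w. ennreal ((err B x0 w t)\<^sup>2) \<partial>W T B) \<le> ennreal (21 * DIM('a) * G\<^sup>2 / B)"
proof -
  interpret prod: product_sigma_finite "\<lambda>_ :: nat \<times> nat. Q"
    unfolding product_sigma_finite_def by (intro allI prob_space_imp_sigma_finite prob_space_Q)
  define J where "J = {..<T} \<times> {..<B}"
  define J2 where "J2 = {t} \<times> {..<B}"
  define J1 where "J1 = J - J2"
  have J: "J = J1 \<union> J2" "J1 \<inter> J2 = {}" "finite J1" "finite J2" using t by (auto simp: J_def J1_def J2_def)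
  define v where "v = 21 * DIM('a) * G\<^sup>2"
  have v: "v \<ge> 0" by (simp add: v_def)
  have comp: "(\<lambda>w. w (s, i)) \<in> measurable (PiM J (\<lambda>_. Q)) Q" if "s < T" "i < B" for s i
    by (rule measurable_component_singleton) (use that in \<open>simp add: J_def\<close>)
  have [measurable]: "(\<lambda>w. gest B x0 w t) \<in> borel_measurable (PiM J (\<lambda>_. Q))"
    by (rule gest_meas_aux) (use comp t in auto)
  have [measurable]: "(\<lambda>w. X B x0 w t) \<in> borel_measurable (PiM J (\<lambda>_. Q))"
    by (rule X_meas_aux) (use comp t in auto)
  have meas: "(\<lambda>w. ennreal ((err B x0 w t)\<^sup>2)) \<in> borel_measurable (PiM (J1 \<union> J2) (\<lambda>_. Q))"
    unfolding err_def J(1)[symmetric] by measurable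
  have inner: "(\<integral>\<^sup>+b. ennreal ((err B x0 (merge J1 J2 (a, b)) t)\<^sup>2) \<partial>PiM J2 (\<lambda>_. Q)) \<le> ennreal (v / B)" for a
  proof -
    define x where "x = X B x0 a t"
    have Xa: "X B x0 (merge J1 J2 (a, b)) t = x" for b
      unfolding x_def by (rule val_zo_pgd_cong) (use t in \<open>auto simp: merge_def J1_def J2_def J_def\<close>)
    have "err B x0 (merge J1 J2 (a, b)) t = 1 / B * norm (0 + (\<Sum>j\<in>J2. est x (b j) - m x))" for b
    proof -
      have mer: "merge J1 J2 (a, b) (t, i) = b (t, i)" if "i < B" for i
        using that by (auto simp: merge_def J1_def J2_def)
      have "(\<Sum>j\<in>J2. est x (b j) - m x) = (\<Sum>i<B. est x (b (t, i)) - m x)"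
      proof -
        have "J2 = Pair t ` {..<B}" by (auto simp: J2_def)
        then show ?thesis by (simp add: sum.reindex inj_on_def)
      qed
      also have "\<dots> = (\<Sum>i<B. est x (merge J1 J2 (a, b) (t, i))) - real B *\<^sub>R m x"
        by (simp add: sum_subtractf mer scaleR_conv_of_real sum_constant_scaleR)
      finally have "(1 / real B) *\<^sub>R (\<Sum>j\<in>J2. est x (b j) - m x) = gest B x0 (merge J1 J2 (a, b)) t - m x"
        using B by (simp add: gest_def Xa scaleR_diff_right)
      then have "err B x0 (merge J1 J2 (a, b)) t = norm ((1 / real B) *\<^sub>R (\<Sum>j\<in>J2. est x (b j) - m x))"
        by (simp add: err_def Xa)
      then show ?thesis by simp
    qed
    then have "(\<integral>\<^sup>+b. ennreal ((err B x0 (merge J1 J2 (a, b)) t)\<^sup>2) \<partial>PiM J2 (\<lambda>_. Q))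
      = (\<integral>\<^sup>+b. ennreal ((1 / B)\<^sup>2) * ennreal ((norm (0 + (\<Sum>j\<in>J2. est x (b j) - m x)))\<^sup>2) \<partial>PiM J2 (\<lambda>_. Q))"
      by (simp only: power_mult_distrib ennreal_mult zero_le_power2)
    also have "\<dots> = ennreal ((1 / B)\<^sup>2) * (\<integral>\<^sup>+b. ennreal ((norm (0 + (\<Sum>j\<in>J2. est x (b j) - m x)))\<^sup>2) \<partial>PiM J2 (\<lambda>_. Q))"
      by (rule nn_integral_cmult) measurable
    also have "\<dots> \<le> ennreal ((1 / B)\<^sup>2) * (ennreal ((norm (0::'a))\<^sup>2) + (\<Sum>j\<in>J2. ennreal v))"
      unfolding v_def
      by (intro mult_left_mono prod.nn_integral_norm_sum_sq[OF J(4) prob_space_Q est_centered] zero_le)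
    also have "\<dots> = ennreal (v / B)"
      using B v by (simp add: J2_def ennreal_of_nat_eq_real_of_nat power2_eq_square flip: ennreal_mult)
    finally show ?thesis .
  qed
  interpret PJ: prob_space "PiM J1 (\<lambda>_. Q)" by (rule prob_space_PiM) (rule prob_space_Q)
  have "(\<integral>\<^sup>+w. ennreal ((err B x0 w t)\<^sup>2) \<partial>W T B) = (\<integral>\<^sup>+w. ennreal ((err B x0 w t)\<^sup>2) \<partial>PiM (J1 \<union> J2) (\<lambda>_. Q))"
    unfolding J(1)[symmetric] J_def ..
  also have "\<dots> = (\<integral>\<^sup>+a. \<integral>\<^sup>+b. ennreal ((err B x0 (merge J1 J2 (a, b)) t)\<^sup>2) \<partial>PiM J2 (\<lambda>_. Q) \<partial>PiM J1 (\<lambda>_. Q))"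
    by (rule prod.product_nn_integral_fold[OF J(2-4) meas])
  also have "\<dots> \<le> (\<integral>\<^sup>+a. ennreal (v / B) \<partial>PiM J1 (\<lambda>_. Q))"
    by (intro nn_integral_mono inner)
  also have "\<dots> = ennreal (v / B)" by (simp add: PJ.emeasure_space_1)
  finally show ?thesis by (simp add: v_def)
qed

end

locale zo_run = zo_prox P f L G F h \<delta> \<gamma>
  for P :: "'s measure" and f :: "'s \<Rightarrow> 'a::euclidean_space \<Rightarrow> real" and L G F h \<delta> \<gamma> +
  fixes \<mu>0 :: "'a measure" and \<phi>min :: real and T B :: nat
  assumes prob_\<mu>0: "prob_space \<mu>0" and sets_\<mu>0 [measurable_cong]: "sets \<mu>0 = sets borel"
    and h_fin: "AE x in \<mu>0. h x < \<infinity>"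
    and \<phi>_int: "integrable \<mu>0 (\<lambda>x. real_of_ereal (ereal (F x) + h x))"
    and \<phi>min: "\<And>x. ereal \<phi>min \<le> ereal (F x) + h x"
    and T: "T \<ge> 1" and B: "B \<ge> 1"
begin

sublocale M0: prob_space \<mu>0 by (rule prob_\<mu>0)
sublocale W: prob_space "W T B" by (rule prob_space_W)
sublocale M: pair_prob_space \<mu>0 "W T B" ..

abbreviation M :: "('a \<times> (nat \<times> nat \<Rightarrow> 'a \<times> 's)) measure" where "M \<equiv> \<mu>0 \<Otimes>\<^sub>M W T B"

definition iter :: "nat \<Rightarrow> 'a \<times> (nat \<times> nat \<Rightarrow> 'a \<times> 's) \<Rightarrow> 'a" where "iter t z = X B (fst z) (snd z) t"
definition noise :: "nat \<Rightarrow> 'a \<times> (nat \<times> nat \<Rightarrow> 'a \<times> 's) \<Rightarrow> real" where "noise t z = err B (fst z) (snd z) t"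
text \<open>The value of \<open>real_of_ereal\<close> at \<open>\<infinity>\<close> is harmless: \<open>h\<close> is finite after every proximal step and almost surely at
  the initial point.\<close>

definition \<Phi> :: "'a \<Rightarrow> real" where "\<Phi> x = F\<delta> x + real_of_ereal (h x)"
definition S :: "'a \<Rightarrow> real" where "S x = norm (grad_map \<gamma> h x (m x))"
text \<open>The quantity under the square root in \<open>prox_step\<close>; its first part telescopes.\<close>

definition gain :: "nat \<Rightarrow> 'a \<times> (nat \<times> nat \<Rightarrow> 'a \<times> 's) \<Rightarrow> real" where
  "gain t z = 2 * (\<Phi> (iter t z) - \<Phi> (iter (Suc t) z)) / \<gamma> + (noise t z)\<^sup>2"
definition \<sigma>2 :: real where "\<sigma>2 = 21 * DIM('a) * G\<^sup>2 / B"

lemma fst_meas: "fst \<in> borel_measurable M"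
  using measurable_fst[of \<mu>0 "W T B"] by (subst (asm) measurable_cong_sets[OF refl sets_\<mu>0])

lemma sample_meas: "s < T \<Longrightarrow> i < B \<Longrightarrow> (\<lambda>z. snd z (s, i)) \<in> measurable M Q"
  by (rule measurable_compose[OF measurable_snd measurable_component_singleton]) simp

lemma iter_meas [measurable]: "t \<le> T \<Longrightarrow> iter t \<in> borel_measurable M"
  unfolding iter_def
  by (rule X_meas_aux[where a=fst and b=snd, OF fst_meas]) (use sample_meas in simp)

lemma noise_meas [measurable]:
  assumes "t < T" shows "noise t \<in> borel_measurable M"
proof -
  have [measurable]: "(\<lambda>z. X B (fst z) (snd z) t) \<in> borel_measurable M"
    using iter_meas[of t] assms unfolding iter_def by simp
  have [measurable]: "(\<lambda>z. gest B (fst z) (snd z) t) \<in> borel_measurable M"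
    by (rule gest_meas_aux[where a=fst and b=snd, OF fst_meas]) (use assms sample_meas in simp)
  show ?thesis unfolding noise_def err_def by measurable
qed

lemma \<Phi>_meas [measurable]: "\<Phi> \<in> borel_measurable borel" unfolding \<Phi>_def by measurable
lemma S_meas [measurable]: "S \<in> borel_measurable borel" unfolding S_def grad_map_def by measurable

lemma gain_meas [measurable]: "t < T \<Longrightarrow> gain t \<in> borel_measurable M"
  unfolding gain_def by measurable

lemma noise_second_moment:
  assumes t: "t < T"
  shows "integrable M (\<lambda>z. (noise t z)\<^sup>2)" "(\<integral>z. (noise t z)\<^sup>2 \<partial>M) \<le> \<sigma>2"
proof -
  have [measurable]: "noise t \<in> borel_measurable M" using t by measurable
  have "(\<integral>\<^sup>+z. ennreal ((noise t z)\<^sup>2) \<partial>M) = (\<integral>\<^sup>+x. \<integral>\<^sup>+w. ennreal ((err B x w t)\<^sup>2) \<partial>W T B \<partial>\<mu>0)"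
  proof -
    have "(\<lambda>z. ennreal ((noise t z)\<^sup>2)) \<in> borel_measurable M" by measurable
    from W.nn_integral_fst[OF this] show ?thesis by (simp add: noise_def)
  qed
  also have "\<dots> \<le> (\<integral>\<^sup>+x. ennreal \<sigma>2 \<partial>\<mu>0)"
    unfolding \<sigma>2_def by (intro nn_integral_mono err_second_moment t B)
  also have "\<dots> = ennreal \<sigma>2" by (simp add: M0.emeasure_space_1)
  finally have le: "(\<integral>\<^sup>+z. ennreal ((noise t z)\<^sup>2) \<partial>M) \<le> ennreal \<sigma>2" .
  then show int: "integrable M (\<lambda>z. (noise t z)\<^sup>2)"
    by (intro integrableI_bounded) (auto intro: le_less_trans)
  have "\<sigma>2 \<ge> 0" by (simp add: \<sigma>2_def)
  with le show "(\<integral>z. (noise t z)\<^sup>2 \<partial>M) \<le> \<sigma>2"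
    using int by (subst (asm) nn_integral_eq_integral) auto
qed

lemma h_finite_AE: "AE z in M. \<forall>t. \<exists>a. h (iter t z) = ereal a"
proof -
  have "AE z in M. h (fst z) < \<infinity>"
  proof (rule AE_distrD[OF measurable_fst])
    show "AE x in distr M \<mu>0 fst. h x < \<infinity>" by (subst W.distr_pair_fst) (rule h_fin)
  qed
  then show ?thesis
  proof eventually_elim
    case (elim z)
    show ?case
    proof
      fix t show "\<exists>a. h (iter t z) = ereal a"
      proof (cases t)
        case 0 then show ?thesis using proper_closed_convex_finite[OF h elim] by (simp add: iter_def)
      next
        case (Suc n) then show ?thesis unfolding iter_def Suc X_Suc using prox_spec[OF h \<gamma>] by blast
      qed
    qed
  qed
qed

lemma \<Phi>_lower:
  assumes "h x = ereal a" shows "\<phi>min - \<delta> * G \<le> \<Phi> x"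
  using \<phi>min[of x] smoothing_close[OF F_lipschitz \<delta>, of x] assms by (simp add: \<Phi>_def abs_le_iff)

lemma step_AE:
  "AE z in M. \<forall>t. \<phi>min - \<delta> * G \<le> \<Phi> (iter t z) \<and> 0 \<le> gain t z \<and> S (iter t z) \<le> 2 * noise t z + sqrt (gain t z)"
  using h_finite_AE
proof eventually_elim
  case (elim z)
  show ?case
  proof (intro allI)
    fix t
    obtain a where a: "h (iter t z) = ereal a" using elim by blast
    from prox_step[OF this, of "gest B (fst z) (snd z) t"]
    obtain b where b: "h (iter (Suc t) z) = ereal b"
      "0 \<le> 2 * ((F\<delta> (iter t z) + a) - (F\<delta> (iter (Suc t) z) + b)) / \<gamma> + (noise t z)\<^sup>2"
      "S (iter t z) \<le> 2 * noise t z + sqrt (2 * ((F\<delta> (iter t z) + a) - (F\<delta> (iter (Suc t) z) + b)) / \<gamma> + (noise t z)\<^sup>2)"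
      unfolding iter_def noise_def err_def S_def X_Suc by blast
    then show "\<phi>min - \<delta> * G \<le> \<Phi> (iter t z) \<and> 0 \<le> gain t z \<and> S (iter t z) \<le> 2 * noise t z + sqrt (gain t z)"
      using \<Phi>_lower[OF a] by (simp add: gain_def \<Phi>_def a)
  qed
qed

lemma \<Phi>0: "integrable M (\<lambda>z. \<Phi> (iter 0 z))"
  "(\<integral>z. \<Phi> (iter 0 z) \<partial>M) \<le> (\<integral>x. real_of_ereal (ereal (F x) + h x) \<partial>\<mu>0) + \<delta> * G"
proof -
  let ?\<phi> = "\<lambda>x. real_of_ereal (ereal (F x) + h x)"
  have ae: "AE x in \<mu>0. \<Phi> x = ?\<phi> x + (F\<delta> x - F x)"
    using h_fin
  proof eventually_elim
    case (elim x)
    then obtain a where "h x = ereal a" using proper_closed_convex_finite[OF h] by blast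
    then show ?case by (simp add: \<Phi>_def)
  qed
  have b: "\<bar>F\<delta> x - F x\<bar> \<le> \<delta> * G" for x by (rule smoothing_close[OF F_lipschitz \<delta>])
  have int2: "integrable \<mu>0 (\<lambda>x. F\<delta> x - F x)"
    by (rule M0.integrable_const_bound[where B="\<delta> * G"]) (use b in auto)
  have int: "integrable \<mu>0 \<Phi>"
    using Bochner_Integration.integrable_add[OF \<phi>_int int2]
    by (subst integrable_cong_AE[OF _ _ ae]) auto
  have "(\<integral>x. \<Phi> x \<partial>\<mu>0) = (\<integral>x. ?\<phi> x + (F\<delta> x - F x) \<partial>\<mu>0)"
    by (rule integral_cong_AE[OF _ _ ae]) auto
  also have "\<dots> = (\<integral>x. ?\<phi> x \<partial>\<mu>0) + (\<integral>x. F\<delta> x - F x \<partial>\<mu>0)"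
    by (rule Bochner_Integration.integral_add[OF \<phi>_int int2])
  also have "(\<integral>x. F\<delta> x - F x \<partial>\<mu>0) \<le> (\<integral>x. \<delta> * G \<partial>\<mu>0)"
    using b by (intro integral_mono int2) (auto simp: abs_le_iff)
  finally have le: "(\<integral>x. \<Phi> x \<partial>\<mu>0) \<le> (\<integral>x. ?\<phi> x \<partial>\<mu>0) + \<delta> * G" by (simp add: M0.prob_space)
  have d: "distr M \<mu>0 fst = \<mu>0" by (rule W.distr_pair_fst)
  show "integrable M (\<lambda>z. \<Phi> (iter 0 z))"
    unfolding iter_def X_0 using int by (intro integrable_distr[OF measurable_fst]) (simp add: d)
  have "(\<integral>z. \<Phi> (iter 0 z) \<partial>M) = (\<integral>x. \<Phi> x \<partial>distr M \<mu>0 fst)"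
    unfolding iter_def X_0 by (rule integral_distr[symmetric]) measurable
  then show "(\<integral>z. \<Phi> (iter 0 z) \<partial>M) \<le> (\<integral>x. ?\<phi> x \<partial>\<mu>0) + \<delta> * G" using le by (simp add: d)
qed

text \<open>Nonnegativity of \<open>gain\<close> bounds the next value of \<open>\<Phi>\<close> above, \<open>\<phi>min\<close> bounds it below.\<close>

lemma \<Phi>_int: "t \<le> T \<Longrightarrow> integrable M (\<lambda>z. \<Phi> (iter t z))"
proof (induction t)
  case 0 show ?case by (rule \<Phi>0)
next
  case (Suc t)
  have [measurable]: "iter (Suc t) \<in> borel_measurable M" using Suc.prems by measurable
  have e: "integrable M (\<lambda>z. (noise t z)\<^sup>2)" using Suc.prems by (intro noise_second_moment) simp
  have \<Phi>t: "integrable M (\<lambda>z. \<Phi> (iter t z))" using Suc by simp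
  show ?case
  proof (rule Bochner_Integration.integrable_bound)
    show "integrable M (\<lambda>z. \<bar>\<Phi> (iter t z)\<bar> + \<gamma> / 2 * (noise t z)\<^sup>2 + \<bar>\<phi>min - \<delta> * G\<bar>)" using e \<Phi>t by simp
    show "AE z in M. norm (\<Phi> (iter (Suc t) z)) \<le> norm (\<bar>\<Phi> (iter t z)\<bar> + \<gamma> / 2 * (noise t z)\<^sup>2 + \<bar>\<phi>min - \<delta> * G\<bar>)"
      using step_AE
    proof eventually_elim
      case (elim z)
      have "0 \<le> \<gamma> / 2 * gain t z" using elim \<gamma> by simp
      also have "\<gamma> / 2 * gain t z = \<Phi> (iter t z) - \<Phi> (iter (Suc t) z) + \<gamma> / 2 * (noise t z)\<^sup>2"
        using \<gamma> by (simp add: gain_def distrib_left)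
      finally have up: "\<Phi> (iter (Suc t) z) \<le> \<Phi> (iter t z) + \<gamma> / 2 * (noise t z)\<^sup>2" by simp
      have lo: "\<phi>min - \<delta> * G \<le> \<Phi> (iter (Suc t) z)" using elim by blast
      have nn: "0 \<le> \<gamma> / 2 * (noise t z)\<^sup>2" using \<gamma> by simp
      have "\<bar>\<Phi> (iter (Suc t) z)\<bar> \<le> \<bar>\<Phi> (iter t z)\<bar> + \<gamma> / 2 * (noise t z)\<^sup>2 + \<bar>\<phi>min - \<delta> * G\<bar>"
        using up lo nn by linarith
      then show ?case by simp
    qed
  qed measurable
qed

lemma gain_int:
  assumes "t < T"
  shows "integrable M (gain t)"
    "(\<integral>z. gain t z \<partial>M) \<le> 2 / \<gamma> * ((\<integral>z. \<Phi> (iter t z) \<partial>M) - (\<integral>z. \<Phi> (iter (Suc t) z) \<partial>M)) + \<sigma>2"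
proof -
  have i: "integrable M (\<lambda>z. \<Phi> (iter t z))" "integrable M (\<lambda>z. \<Phi> (iter (Suc t) z))" "integrable M (\<lambda>z. (noise t z)\<^sup>2)"
    using assms by (auto intro!: \<Phi>_int noise_second_moment)
  show "integrable M (gain t)" unfolding gain_def using i by simp
  have "(\<integral>z. gain t z \<partial>M) = 2 / \<gamma> * ((\<integral>z. \<Phi> (iter t z) \<partial>M) - (\<integral>z. \<Phi> (iter (Suc t) z) \<partial>M)) + (\<integral>z. (noise t z)\<^sup>2 \<partial>M)"
    unfolding gain_def using i by simp
  with noise_second_moment(2)[OF assms] show "(\<integral>z. gain t z \<partial>M) \<le> 2 / \<gamma> * ((\<integral>z. \<Phi> (iter t z) \<partial>M) - (\<integral>z. \<Phi> (iter (Suc t) z) \<partial>M)) + \<sigma>2"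
    by simp
qed

lemma S_int:
  assumes t: "t < T"
  shows "integrable M (\<lambda>z. S (iter t z))" "(\<integral>z. S (iter t z) \<partial>M) \<le> 2 * sqrt \<sigma>2 + sqrt (\<integral>z. gain t z \<partial>M)"
    "0 \<le> (\<integral>z. gain t z \<partial>M)"
proof -
  have [measurable]: "iter t \<in> borel_measurable M" "noise t \<in> borel_measurable M" "gain t \<in> borel_measurable M"
    using t by (intro iter_meas noise_meas gain_meas; simp)+
  have pos: "AE z in M. (sqrt (gain t z))\<^sup>2 = gain t z" using step_AE by eventually_elim simp
  have sq: "integrable M (\<lambda>z. (sqrt (gain t z))\<^sup>2)"
    using gain_int(1)[OF t] by (subst integrable_cong_AE[OF _ _ pos]) auto
  have eq: "(\<integral>z. (sqrt (gain t z))\<^sup>2 \<partial>M) = (\<integral>z. gain t z \<partial>M)" by (rule integral_cong_AE[OF _ _ pos]) auto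
  have i: "integrable M (noise t)" "integrable M (\<lambda>z. sqrt (gain t z))"
    by (rule M.expectation_square_le(1)[OF _ noise_second_moment(1)[OF t]], measurable)
      (rule M.expectation_square_le(1)[OF _ sq], measurable)
  have i2: "integrable M (\<lambda>z. 2 * noise t z + sqrt (gain t z))" using i by simp
  have bd: "AE z in M. S (iter t z) \<le> 2 * noise t z + sqrt (gain t z)" using step_AE by eventually_elim blast
  show int: "integrable M (\<lambda>z. S (iter t z))"
    by (rule Bochner_Integration.integrable_bound[OF i2])
      (measurable, use bd in \<open>auto elim!: eventually_mono simp: S_def\<close>)
  have "(\<integral>z. noise t z \<partial>M) \<le> sqrt \<sigma>2"
    using M.expectation_le_sqrt[OF _ noise_second_moment(1)[OF t]] noise_second_moment(2)[OF t]
    by (auto intro: order_trans)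
  moreover have "(\<integral>z. sqrt (gain t z) \<partial>M) \<le> sqrt (\<integral>z. gain t z \<partial>M)"
    using M.expectation_le_sqrt[OF _ sq] unfolding eq by auto
  moreover have "(\<integral>z. S (iter t z) \<partial>M) \<le> (\<integral>z. 2 * noise t z + sqrt (gain t z) \<partial>M)"
    by (rule integral_mono_AE[OF int i2 bd])
  ultimately show "(\<integral>z. S (iter t z) \<partial>M) \<le> 2 * sqrt \<sigma>2 + sqrt (\<integral>z. gain t z \<partial>M)" using i by simp
  show "0 \<le> (\<integral>z. gain t z \<partial>M)" using step_AE by (intro integral_nonneg_AE) (auto elim!: eventually_mono)
qed

definition \<Delta> :: real where "\<Delta> = (\<integral>x. real_of_ereal (ereal (F x) + h x) \<partial>\<mu>0) - \<phi>min"

text \<open>By Jensen's inequality the mean of \<open>sqrt (gain t)\<close> is at most the root of the mean, once for the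
  expectation and once for the average over the iterations. The gap between the first and the last value
  of the smoothed objective exceeds \<open>\<Delta>\<close> by at most \<open>2 * \<delta> * G\<close>, because smoothing changes \<open>F\<close> by at most
  \<open>\<delta> * G\<close>.\<close>

theorem average_bound:
  "(\<Sum>t<T. \<integral>z. S (iter t z) \<partial>M) / T \<le> sqrt (2 * (\<Delta> + 2 * \<delta> * G) / (\<gamma> * T)) + 3 * sqrt \<sigma>2"
proof -
  define y where "y t = (\<integral>z. gain t z \<partial>M)" for t
  define \<phi> where "\<phi> t = (\<integral>z. \<Phi> (iter t z) \<partial>M)" for t
  have y0: "t < T \<Longrightarrow> 0 \<le> y t" for t unfolding y_def by (rule S_int(3))
  have \<sigma>0: "\<sigma>2 \<ge> 0" by (simp add: \<sigma>2_def)
  have T0: "real T > 0" using T by simp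
  have "\<phi> T \<ge> \<phi>min - \<delta> * G"
  proof -
    have "(\<integral>z. \<phi>min - \<delta> * G \<partial>M) \<le> \<phi> T"
      unfolding \<phi>_def by (rule integral_mono_AE) (use step_AE \<Phi>_int[of T] in \<open>auto elim!: eventually_mono\<close>)
    then show ?thesis by (simp add: M.prob_space)
  qed
  moreover have "\<phi> 0 \<le> \<Delta> + \<phi>min + \<delta> * G" unfolding \<phi>_def using \<Phi>0(2) by (simp add: \<Delta>_def)
  ultimately have gap: "\<phi> 0 - \<phi> T \<le> \<Delta> + 2 * \<delta> * G" by simp
  have "(\<Sum>t<T. y t) \<le> (\<Sum>t<T. 2 / \<gamma> * (\<phi> t - \<phi> (Suc t)) + \<sigma>2)"
    unfolding y_def \<phi>_def by (intro sum_mono gain_int(2)) simp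
  also have "\<dots> = 2 / \<gamma> * (\<phi> 0 - \<phi> T) + T * \<sigma>2"
    by (simp only: sum.distrib sum_distrib_left[symmetric] sum_lessThan_telescope') simp
  also have "\<dots> \<le> 2 / \<gamma> * (\<Delta> + 2 * \<delta> * G) + T * \<sigma>2"
    using gap \<gamma> by (intro add_right_mono mult_left_mono) auto
  finally have "(\<Sum>t<T. y t) / T \<le> (2 / \<gamma> * (\<Delta> + 2 * \<delta> * G) + T * \<sigma>2) / T"
    by (rule divide_right_mono) simp
  also have "\<dots> = 2 * (\<Delta> + 2 * \<delta> * G) / (\<gamma> * T) + \<sigma>2"
    using T0 by (simp add: add_divide_distrib)
  finally have sy: "(\<Sum>t<T. y t) / T \<le> 2 * (\<Delta> + 2 * \<delta> * G) / (\<gamma> * T) + \<sigma>2" .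
  have "((\<Sum>t<T. sqrt (y t)) / T)\<^sup>2 \<le> (\<Sum>t<T. y t) / T"
  proof -
    have "(\<Sum>t<T. sqrt (y t))\<^sup>2 \<le> (\<Sum>t<T. (sqrt (y t))\<^sup>2) * T"
      using sum_squared_le_sum_of_squares[of "\<lambda>t. sqrt (y t)" "{..<T}"] by simp
    also have "(\<Sum>t<T. (sqrt (y t))\<^sup>2) = (\<Sum>t<T. y t)" using y0 by (intro sum.cong) auto
    finally have "(\<Sum>t<T. sqrt (y t))\<^sup>2 / (real T)\<^sup>2 \<le> (\<Sum>t<T. y t) * T / (real T)\<^sup>2"
      by (rule divide_right_mono) simp
    then show ?thesis using T0 by (simp add: power_divide power2_eq_square)
  qed
  then have "(\<Sum>t<T. sqrt (y t)) / T \<le> sqrt ((\<Sum>t<T. y t) / T)" by (rule real_le_rsqrt)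
  also have "\<dots> \<le> sqrt (2 * (\<Delta> + 2 * \<delta> * G) / (\<gamma> * T) + \<sigma>2)" using sy by (rule real_sqrt_le_mono)
  also have "\<dots> \<le> sqrt (2 * (\<Delta> + 2 * \<delta> * G) / (\<gamma> * T)) + sqrt \<sigma>2"
  proof (rule sqrt_add_le_add_sqrt)
    have "0 \<le> \<Delta> + 2 * \<delta> * G"
    proof -
      have "\<phi>min - \<delta> * G \<le> \<phi> 0"
      proof -
        have "(\<integral>z. \<phi>min - \<delta> * G \<partial>M) \<le> \<phi> 0"
          unfolding \<phi>_def by (rule integral_mono_AE) (use step_AE \<Phi>_int[of 0] in \<open>auto elim!: eventually_mono\<close>)
        then show ?thesis by (simp add: M.prob_space)
      qed
      with \<open>\<phi> 0 \<le> \<Delta> + \<phi>min + \<delta> * G\<close> show ?thesis by simp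
    qed
    then show "0 \<le> 2 * (\<Delta> + 2 * \<delta> * G) / (\<gamma> * T)" using \<gamma> by simp
  qed (rule \<sigma>0)
  finally have main: "(\<Sum>t<T. sqrt (y t)) / T \<le> sqrt (2 * (\<Delta> + 2 * \<delta> * G) / (\<gamma> * T)) + sqrt \<sigma>2" .
  have "(\<Sum>t<T. \<integral>z. S (iter t z) \<partial>M) \<le> (\<Sum>t<T. 2 * sqrt \<sigma>2 + sqrt (y t))"
    unfolding y_def by (intro sum_mono S_int(2)) simp
  also have "\<dots> = T * (2 * sqrt \<sigma>2) + (\<Sum>t<T. sqrt (y t))" by (simp add: sum.distrib)
  finally have "(\<Sum>t<T. \<integral>z. S (iter t z) \<partial>M) / T \<le> (T * (2 * sqrt \<sigma>2) + (\<Sum>t<T. sqrt (y t))) / T"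
    by (rule divide_right_mono) simp
  also have "\<dots> = 2 * sqrt \<sigma>2 + (\<Sum>t<T. sqrt (y t)) / T" using T0 by (simp add: add_divide_distrib)
  finally show ?thesis using main by simp
qed

end


section \<open>The random output, its cost and the hyperparameters\<close>

context zo_run
begin

abbreviation \<Omega> where "\<Omega> \<equiv> run_space \<mu>0 P T B"
abbreviation out where "out \<equiv> zo_pgd_output f h \<gamma> \<delta> B"
abbreviation K where "K \<equiv> uniform_count_measure {..<T}"

sublocale K: prob_space K
  by (rule prob_space_uniform_count_measure) (use T in \<open>auto simp: lessThan_empty_iff\<close>)
sublocale WK: pair_prob_space "W T B" K ..
sublocale \<Omega>: pair_prob_space \<mu>0 "W T B \<Otimes>\<^sub>M K" ..

lemma \<Omega>_eq: "\<Omega> = \<mu>0 \<Otimes>\<^sub>M (W T B \<Otimes>\<^sub>M K)" by (simp add: run_space_def)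

lemma out_eq: "out \<omega> = X B (fst \<omega>) (fst (snd \<omega>)) (snd (snd \<omega>))"
  by (simp add: zo_pgd_output_def case_prod_beta)

lemma out_meas [measurable]: "out \<in> borel_measurable \<Omega>"
proof -
  have "(\<lambda>\<omega>. X B (fst \<omega>) (fst (snd \<omega>)) (snd (snd \<omega>))) \<in> borel_measurable \<Omega>"
  proof (rule measurable_compose_countable'[where I="{..<T}" and f="\<lambda>k \<omega>. X B (fst \<omega>) (fst (snd \<omega>)) k"])
    show "(\<lambda>\<omega>. snd (snd \<omega>)) \<in> measurable \<Omega> (count_space {..<T})"
      unfolding \<Omega>_eq by measurable
    fix k assume k: "k \<in> {..<T}"
    have f: "fst \<in> borel_measurable \<Omega>"
      unfolding \<Omega>_eq using measurable_fst[of \<mu>0 "W T B \<Otimes>\<^sub>M K"] by (subst (asm) measurable_cong_sets[OF refl sets_\<mu>0])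
    show "(\<lambda>\<omega>. X B (fst \<omega>) (fst (snd \<omega>)) k) \<in> borel_measurable \<Omega>"
    proof (rule X_meas_aux[where a=fst and b="\<lambda>\<omega>. fst (snd \<omega>)", OF f])
      fix s i assume "s < k" "i < B"
      then have "(\<lambda>w. w (s, i)) \<in> measurable (W T B) Q" using k by (intro measurable_component_singleton) auto
      then show "(\<lambda>\<omega>. fst (snd \<omega>) (s, i)) \<in> measurable \<Omega> Q"
        unfolding \<Omega>_eq by measurable
    qed
  qed simp
  then show ?thesis by (simp add: out_eq[abs_def])
qed

lemma nn_integral_out:
  assumes [measurable]: "q \<in> borel_measurable borel"
  shows "(\<integral>\<^sup>+\<omega>. q (out \<omega>) \<partial>\<Omega>) = ennreal (1 / T) * (\<Sum>k<T. \<integral>\<^sup>+z. q (iter k z) \<partial>M)"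
proof -
  have m: "(\<lambda>\<omega>. q (out \<omega>)) \<in> borel_measurable (\<mu>0 \<Otimes>\<^sub>M (W T B \<Otimes>\<^sub>M K))"
    using measurable_compose[OF out_meas assms] unfolding \<Omega>_eq .
  have "(\<integral>\<^sup>+\<omega>. q (out \<omega>) \<partial>\<Omega>) = (\<integral>\<^sup>+x. \<integral>\<^sup>+v. q (out (x, v)) \<partial>(W T B \<Otimes>\<^sub>M K) \<partial>\<mu>0)"
    unfolding \<Omega>_eq by (rule WK.nn_integral_fst[OF m, symmetric])
  also have "\<dots> = (\<integral>\<^sup>+x. \<integral>\<^sup>+w. \<integral>\<^sup>+k. q (out (x, w, k)) \<partial>K \<partial>W T B \<partial>\<mu>0)"
  proof (rule nn_integral_cong)
    fix x assume "x \<in> space \<mu>0"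
    then have "(\<lambda>v. q (out (x, v))) \<in> borel_measurable (W T B \<Otimes>\<^sub>M K)" by (rule measurable_compose_Pair1[OF _ m])
    from K.nn_integral_fst[OF this]
    show "(\<integral>\<^sup>+v. q (out (x, v)) \<partial>(W T B \<Otimes>\<^sub>M K)) = (\<integral>\<^sup>+w. \<integral>\<^sup>+k. q (out (x, w, k)) \<partial>K \<partial>W T B)" by simp
  qed
  also have "\<dots> = (\<integral>\<^sup>+x. \<integral>\<^sup>+w. ennreal (1 / T) * (\<Sum>k<T. q (iter k (x, w))) \<partial>W T B \<partial>\<mu>0)"
    by (simp add: uniform_count_measure_def nn_integral_point_measure_finite out_eq iter_def sum_distrib_left)
  also have "\<dots> = (\<integral>\<^sup>+z. ennreal (1 / T) * (\<Sum>k<T. q (iter k z)) \<partial>M)"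
  proof (rule W.nn_integral_fst)
    have "(\<lambda>z. q (iter k z)) \<in> borel_measurable M" if "k \<in> {..<T}" for k
      using that by (intro measurable_compose[OF iter_meas assms]) simp
    then show "(\<lambda>z. ennreal (1 / T) * (\<Sum>k<T. q (iter k z))) \<in> borel_measurable M" by measurable
  qed
  also have "\<dots> = ennreal (1 / T) * (\<Sum>k<T. \<integral>\<^sup>+z. q (iter k z) \<partial>M)"
  proof -
    have [measurable]: "(\<lambda>z. q (iter k z)) \<in> borel_measurable M" if "k \<in> {..<T}" for k
      using that by (intro measurable_compose[OF iter_meas assms]) simp
    show ?thesis by (subst nn_integral_cmult) (simp_all add: nn_integral_sum)
  qed
  finally show ?thesis .
qed

lemma S_out:
  "integrable \<Omega> (\<lambda>\<omega>. S (out \<omega>))"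
  "(\<integral>\<omega>. S (out \<omega>) \<partial>\<Omega>) \<le> sqrt (2 * (\<Delta> + 2 * \<delta> * G) / (\<gamma> * T)) + 3 * sqrt \<sigma>2"
proof -
  have S0: "S x \<ge> 0" for x by (simp add: S_def)
  have i0: "0 \<le> (\<integral>z. S (iter k z) \<partial>M)" for k by (intro integral_nonneg_AE AE_I2 S0)
  have "(\<integral>\<^sup>+\<omega>. ennreal (S (out \<omega>)) \<partial>\<Omega>) = ennreal (1 / T) * (\<Sum>k<T. \<integral>\<^sup>+z. ennreal (S (iter k z)) \<partial>M)"
    by (rule nn_integral_out) measurable
  also have "(\<Sum>k<T. \<integral>\<^sup>+z. ennreal (S (iter k z)) \<partial>M) = (\<Sum>k<T. ennreal (\<integral>z. S (iter k z) \<partial>M))"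
    using S_int(1) S0 by (intro sum.cong refl nn_integral_eq_integral) auto
  also have "\<dots> = ennreal (\<Sum>k<T. \<integral>z. S (iter k z) \<partial>M)" using i0 by (simp add: sum_ennreal)
  also have "ennreal (1 / T) * \<dots> = ennreal ((\<Sum>k<T. \<integral>z. S (iter k z) \<partial>M) / T)"
    using i0 by (simp add: sum_nonneg flip: ennreal_mult)
  finally have nn: "(\<integral>\<^sup>+\<omega>. ennreal (S (out \<omega>)) \<partial>\<Omega>) = ennreal ((\<Sum>k<T. \<integral>z. S (iter k z) \<partial>M) / T)" .
  have Sm: "(\<lambda>\<omega>. S (out \<omega>)) \<in> borel_measurable \<Omega>" by measurable
  show int: "integrable \<Omega> (\<lambda>\<omega>. S (out \<omega>))"
    by (rule integrableI_bounded[OF Sm]) (use S0 nn in simp)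
  have "(\<integral>\<omega>. S (out \<omega>) \<partial>\<Omega>) = (\<Sum>k<T. \<integral>z. S (iter k z) \<partial>M) / T"
    using nn int S0 i0 by (subst (asm) nn_integral_eq_integral) (auto simp: integral_nonneg_AE sum_nonneg)
  then show "(\<integral>\<omega>. S (out \<omega>) \<partial>\<Omega>) \<le> sqrt (2 * (\<Delta> + 2 * \<delta> * G) / (\<gamma> * T)) + 3 * sqrt \<sigma>2"
    using average_bound by simp
qed

lemma prob_space_\<Omega>: "prob_space \<Omega>" unfolding \<Omega>_eq by (rule \<Omega>.prob_space_axioms)

lemma \<Delta>_nonneg: "\<Delta> \<ge> 0"
proof -
  have "(\<integral>x. \<phi>min \<partial>\<mu>0) \<le> (\<integral>x. real_of_ereal (ereal (F x) + h x) \<partial>\<mu>0)"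
  proof (rule integral_mono_AE[OF _ \<phi>_int])
    show "AE x in \<mu>0. \<phi>min \<le> real_of_ereal (ereal (F x) + h x)"
      using h_fin
    proof eventually_elim
      case (elim x)
      then obtain a where "h x = ereal a" using proper_closed_convex_finite[OF h] by blast
      with \<phi>min[of x] show ?case by simp
    qed
  qed simp
  then show ?thesis by (simp add: \<Delta>_def M0.prob_space)
qed

lemma \<sigma>2_bound: "3 * sqrt \<sigma>2 \<le> 16 * G * sqrt DIM('a) / sqrt B"
proof -
  \<comment> \<open>\<open>189 = 9 * 21\<close> is less than \<open>256 = 16\<^sup>2\<close>.\<close>
  have "3 * sqrt \<sigma>2 = sqrt (189 * DIM('a) * G\<^sup>2 / B)"
  proof -
    have "3 * sqrt \<sigma>2 = sqrt (3\<^sup>2) * sqrt \<sigma>2" by simp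
    also have "\<dots> = sqrt (3\<^sup>2 * \<sigma>2)" by (rule real_sqrt_mult[symmetric])
    finally show ?thesis by (simp add: \<sigma>2_def)
  qed
  also have "\<dots> \<le> sqrt ((16 * G)\<^sup>2 * DIM('a) / B)"
    by (intro real_sqrt_le_mono divide_right_mono) (auto simp: power_mult_distrib mult_right_mono)
  also have "\<dots> = 16 * G * sqrt DIM('a) / sqrt B"
    using G by (simp add: real_sqrt_mult real_sqrt_divide)
  finally show ?thesis .
qed

end

lemma (in prob_space) prob_le_expectation_pos:
  fixes Z :: "'a \<Rightarrow> real"
  assumes int: "integrable M Z" and le: "expectation Z \<le> \<epsilon>"
  shows "prob {x \<in> space M. Z x \<le> \<epsilon>} > 0"
proof (rule ccontr)
  have [measurable]: "Z \<in> borel_measurable M" using int by simp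
  assume "\<not> 0 < prob {x \<in> space M. Z x \<le> \<epsilon>}"
  then have "prob {x \<in> space M. Z x \<le> \<epsilon>} = 0" by (simp add: zero_less_measure_iff)
  then have ae: "AE x in M. \<epsilon> < Z x"
    by (subst (asm) prob_eq_0) (auto simp: not_le elim!: eventually_mono)
  have i: "integrable M (\<lambda>x. Z x - \<epsilon>)" using int by simp
  have "expectation (\<lambda>x. Z x - \<epsilon>) = expectation Z - \<epsilon>" using int by (simp add: prob_space)
  moreover have nn: "AE x in M. 0 \<le> Z x - \<epsilon>" using ae by eventually_elim simp
  then have "0 \<le> expectation (\<lambda>x. Z x - \<epsilon>)" by (rule integral_nonneg_AE)
  ultimately have "expectation (\<lambda>x. Z x - \<epsilon>) = 0" using le by simp
  then have "AE x in M. Z x - \<epsilon> = 0" using integral_nonneg_eq_0_iff_AE[OF i nn] by simp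
  with ae have "AE x in M. False" by eventually_elim simp
  then show False by simp
qed

lemma fevals_bindc: "fevals (bindc m k) = fevals m + fevals (k (val m))"
  and prox_updates_bindc: "prox_updates (bindc m k) = prox_updates m + prox_updates (k (val m))"
  by (simp_all add: bindc_def split: prod.splits)

lemma cost_sum_costed:
  assumes "\<And>i. fevals (m i) = a" "\<And>i. prox_updates (m i) = 0"
  shows "fevals (sum_costed m n) = n * a" "prox_updates (sum_costed m n) = 0"
  using assms by (induction n) (simp_all add: fevals_bindc prox_updates_bindc ret_def)

lemma cost_minibatch:
  "fevals (minibatch f \<delta> B w x) = 2 * B" "prox_updates (minibatch f \<delta> B w x) = 0"
proof -
  have two: "fevals (two_point \<delta> \<phi> x u) = 2" "prox_updates (two_point \<delta> \<phi> x u) = 0" for \<phi> :: "'a \<Rightarrow> real" and u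
    by (simp_all add: two_point_def fevals_bindc prox_updates_bindc call_fun_def ret_def)
  let ?m = "\<lambda>i. case w i of (u, \<xi>) \<Rightarrow> two_point \<delta> (f \<xi>) x u"
  have "fevals (?m i) = 2" "prox_updates (?m i) = 0" for i by (simp_all add: two split: prod.split)
  from cost_sum_costed[of ?m, OF this] show "fevals (minibatch f \<delta> B w x) = 2 * B" "prox_updates (minibatch f \<delta> B w x) = 0"
    by (simp_all add: minibatch_def fevals_bindc prox_updates_bindc ret_def)
qed

lemma cost_zo_pgd:
  "fevals (zo_pgd f h \<gamma> \<delta> B x0 w t) = 2 * t * B" "prox_updates (zo_pgd f h \<gamma> \<delta> B x0 w t) = t"
  by (induction t) (simp_all add: fevals_bindc prox_updates_bindc cost_minibatch call_prox_def ret_def algebra_simps)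

text \<open>On the regime the rate is at least \<open>1\<close> and absorbs the error of rounding up.\<close>

lemma hyper_T_le:
  assumes "c > 0" "(G, d, \<delta>, \<epsilon>, \<Delta>) \<in> regime D"
  shows "real (hyper_T c G d \<delta> \<epsilon> \<Delta>) \<le> (8 * c * \<bar>D\<bar> + 1) * (G * real d powr (1/2) / (\<delta> * \<epsilon>\<^sup>2))"
proof -
  define R where "R = G * sqrt (real d) / (\<delta> * \<epsilon>\<^sup>2)"
  have r: "G > 0" "\<delta> > 0" "\<epsilon> > 0" "\<Delta> \<ge> 0" "\<Delta> + 2 * \<delta> * G \<le> D" "R \<ge> 1" using assms(2) by (auto simp: regime_def R_def)
  define x where "x = 8 * c * R * (\<Delta> + 2 * \<delta> * G)"
  have "x \<ge> 0" unfolding x_def using r assms(1) by simp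
  then have "real (nat \<lceil>x\<rceil>) \<le> x + 1" by linarith
  also have "x \<le> 8 * c * R * \<bar>D\<bar>" unfolding x_def using r assms(1) by (intro mult_left_mono) auto
  also have "8 * c * R * \<bar>D\<bar> + 1 \<le> (8 * c * \<bar>D\<bar> + 1) * R" using r(6) by (simp add: algebra_simps)
  finally have "real (nat \<lceil>x\<rceil>) \<le> (8 * c * \<bar>D\<bar> + 1) * R" by simp
  moreover have "hyper_T c G d \<delta> \<epsilon> \<Delta> = nat \<lceil>x\<rceil>" by (simp add: hyper_T_def x_def R_def mult.assoc)
  ultimately show ?thesis by (simp add: R_def powr_half_sqrt)
qed

lemma hyper_B_le:
  assumes "(G, d, \<delta>, \<epsilon>, \<Delta>) \<in> regime D"
  shows "real (hyper_B G d \<epsilon>) \<le> 1025 * (G\<^sup>2 * real d / \<epsilon>\<^sup>2)"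
proof -
  define R where "R = G\<^sup>2 * real d / \<epsilon>\<^sup>2"
  have "R \<ge> 1" using assms by (simp add: regime_def R_def)
  then have "real (nat \<lceil>1024 * R\<rceil>) \<le> 1025 * R" by linarith
  moreover have "hyper_B G d \<epsilon> = nat \<lceil>1024 * R\<rceil>" by (simp add: hyper_B_def R_def mult_ac)
  ultimately show ?thesis by (simp add: R_def)
qed

lemma hyper_T_bigo:
  assumes "c > 0"
  shows "(\<lambda>(G, d, \<delta>, \<epsilon>, \<Delta>). real (hyper_T c G d \<delta> \<epsilon> \<Delta>)) \<in> O[principal (regime D)](\<lambda>(G, d, \<delta>, \<epsilon>, \<Delta>). G * real d powr (1/2) / (\<delta> * \<epsilon>^2))"
proof (rule landau_o.bigI[of "8 * c * \<bar>D\<bar> + 1"])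
  show "8 * c * \<bar>D\<bar> + 1 > 0" using assms by (simp add: add_nonneg_pos)
  show "\<forall>\<^sub>F z in principal (regime D). norm (case z of (G, d, \<delta>, \<epsilon>, \<Delta>) \<Rightarrow> real (hyper_T c G d \<delta> \<epsilon> \<Delta>))
    \<le> (8 * c * \<bar>D\<bar> + 1) * norm (case z of (G, d, \<delta>, \<epsilon>, \<Delta>) \<Rightarrow> G * real d powr (1/2) / (\<delta> * \<epsilon>^2))"
    unfolding eventually_principal
  proof
    fix z :: "real \<times> nat \<times> real \<times> real \<times> real" assume z: "z \<in> regime D"
    obtain G d \<delta> \<epsilon> \<Delta> where zz: "z = (G, d, \<delta>, \<epsilon>, \<Delta>)" by (cases z) auto
    have "0 \<le> G * real d powr (1/2) / (\<delta> * \<epsilon>^2)" using z by (simp add: zz regime_def)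
    then show "norm (case z of (G, d, \<delta>, \<epsilon>, \<Delta>) \<Rightarrow> real (hyper_T c G d \<delta> \<epsilon> \<Delta>))
      \<le> (8 * c * \<bar>D\<bar> + 1) * norm (case z of (G, d, \<delta>, \<epsilon>, \<Delta>) \<Rightarrow> G * real d powr (1/2) / (\<delta> * \<epsilon>^2))"
      using hyper_T_le[OF assms z[unfolded zz]] unfolding zz case_prod_conv real_norm_def by (simp only: abs_of_nonneg of_nat_0_le_iff)
  qed
qed

lemma hyper_B_bigo:
  "(\<lambda>(G, d, \<delta>, \<epsilon>, \<Delta>). real (hyper_B G d \<epsilon>)) \<in> O[principal (regime D)](\<lambda>(G, d, \<delta>, \<epsilon>, \<Delta>). G^2 * real d / \<epsilon>^2)"
proof (rule landau_o.bigI[of 1025])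
  show "\<forall>\<^sub>F z in principal (regime D). norm (case z of (G, d, \<delta>, \<epsilon>, \<Delta>) \<Rightarrow> real (hyper_B G d \<epsilon>))
    \<le> 1025 * norm (case z of (G, d, \<delta>, \<epsilon>, \<Delta>) \<Rightarrow> G^2 * real d / \<epsilon>^2)"
    unfolding eventually_principal
  proof
    fix z :: "real \<times> nat \<times> real \<times> real \<times> real" assume z: "z \<in> regime D"
    obtain G d \<delta> \<epsilon> \<Delta> where zz: "z = (G, d, \<delta>, \<epsilon>, \<Delta>)" by (cases z) auto
    have "0 \<le> G^2 * real d / \<epsilon>^2" by simp
    then show "norm (case z of (G, d, \<delta>, \<epsilon>, \<Delta>) \<Rightarrow> real (hyper_B G d \<epsilon>))
      \<le> 1025 * norm (case z of (G, d, \<delta>, \<epsilon>, \<Delta>) \<Rightarrow> G^2 * real d / \<epsilon>^2)"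
      using hyper_B_le[OF z[unfolded zz]] unfolding zz case_prod_conv real_norm_def by (simp only: abs_of_nonneg of_nat_0_le_iff)
  qed
qed simp

lemma hyper_evals_bigo:
  assumes "c > 0"
  shows "(\<lambda>(G, d, \<delta>, \<epsilon>, \<Delta>). real (2 * hyper_T c G d \<delta> \<epsilon> \<Delta> * hyper_B G d \<epsilon>)) \<in> O[principal (regime D)](\<lambda>(G, d, \<delta>, \<epsilon>, \<Delta>). G^3 * real d powr (3/2) / (\<delta> * \<epsilon>^4))"
proof -
  have eq1: "(\<lambda>(G, d, \<delta>, \<epsilon>, \<Delta>). real (2 * hyper_T c G d \<delta> \<epsilon> \<Delta> * hyper_B G d \<epsilon>)) =
    (\<lambda>z. 2 * ((case z of (G, d, \<delta>, \<epsilon>, \<Delta>) \<Rightarrow> real (hyper_T c G d \<delta> \<epsilon> \<Delta>)) * (case z of (G, d, \<delta>, \<epsilon>, \<Delta>) \<Rightarrow> real (hyper_B G d \<epsilon>))))"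
    by (auto simp: fun_eq_iff)
  have "real d powr (3/2) = real d powr (1/2) * real d" for d :: nat
  proof (cases "d = 0")
    case False
    then show ?thesis using powr_add[of "real d" "1/2" 1] by simp
  qed simp
  then have eq2: "(\<lambda>(G, d, \<delta>, \<epsilon>, \<Delta>). G^3 * real d powr (3/2) / (\<delta> * \<epsilon>^4)) =
    (\<lambda>z. (case z of (G, d, \<delta>, \<epsilon>, \<Delta>::real) \<Rightarrow> G * real d powr (1/2) / (\<delta> * \<epsilon>^2)) * (case z of (G, d, \<delta>, \<epsilon>, \<Delta>) \<Rightarrow> G^2 * real d / \<epsilon>^2))"
    by (auto simp: fun_eq_iff power2_eq_square power3_eq_cube power4_eq_xxxx mult_ac)
  show ?thesis unfolding eq1 eq2
    using landau_o.big.mult[OF hyper_T_bigo[OF assms] hyper_B_bigo] by simp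
qed


section \<open>The convergence theorem\<close>

lemma rate_eq:
  fixes c G \<delta> D :: real and d T :: nat
  assumes "c > 0" "G > 0" "\<delta> > 0" "d > 0" "T > 0"
  shows "sqrt (2 * D / (\<delta> / (c * G * sqrt (real d)) * real T)) =
    sqrt (2 * c * G) * real d powr (1/4) / sqrt (real T * \<delta>) * sqrt D"
proof -
  have d: "real d powr (1/4) = sqrt (sqrt (real d))"
    by (simp add: powr_half_sqrt[symmetric] powr_powr)
  have "2 * D / (\<delta> / (c * G * sqrt (real d)) * real T) = 2 * c * G * sqrt (real d) / (real T * \<delta>) * D"
    using assms by (simp add: field_simps)
  then show ?thesis unfolding d by (simp add: real_sqrt_mult real_sqrt_divide)
qed

theorem theorem2:
  fixes P :: "'s measure"
    and f :: "'s \<Rightarrow> 'a::euclidean_space \<Rightarrow> real"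
    and L :: "'s \<Rightarrow> real"
    and h :: "'a \<Rightarrow> ereal"
    and \<mu>0 \<nu> :: "'a measure"
    and c G \<delta> :: real
  defines "F \<equiv> \<lambda>x. \<integral>\<xi>. f \<xi> x \<partial>P"
  defines "\<phi> \<equiv> \<lambda>x. ereal (F x) + h x"
  defines "\<phi>min \<equiv> INF x. \<phi> x"
  defines "F\<delta> \<equiv> smoothing \<nu> \<delta> F"
  defines "d \<equiv> DIM('a)"
  defines "\<gamma> \<equiv> \<delta> / (c * G * sqrt (real d))"
  defines "\<Delta> \<equiv> (\<integral>x. real_of_ereal (\<phi> x) \<partial>\<mu>0) - real_of_ereal \<phi>min"
  defines "out \<equiv> \<lambda>B. zo_pgd_output f h \<gamma> \<delta> B"
  defines "\<Omega> \<equiv> \<lambda>T B. run_space \<mu>0 P T B"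
  defines "S \<equiv> \<lambda>x. norm (grad_map \<gamma> h x (gradient F\<delta> x))"
  assumes P: "prob_space P"
    and f_int: "\<And>x. integrable P (\<lambda>\<xi>. f \<xi> x)"
    and A1_lip: "\<And>\<xi>. \<xi> \<in> space P \<Longrightarrow> L \<xi> > 0 \<and> (L \<xi>)-lipschitz_on UNIV (f \<xi>)"
    and A1_sq: "L \<in> borel_measurable P" "integrable P (\<lambda>\<xi>. (L \<xi>)\<^sup>2)"
      "(\<integral>\<xi>. (L \<xi>)\<^sup>2 \<partial>P) \<le> G\<^sup>2" "G > 0"
    and A2: "proper_closed_convex h"
    and phi_min: "\<phi>min \<noteq> -\<infinity>"
    and delta: "\<delta> > 0"
    and nu: "\<nu> = unif_sphere \<or> \<nu> = unif_ball"
    and c: "smoothing_constant \<nu> c"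
    and x0: "prob_space \<mu>0" "sets \<mu>0 = sets borel"
      "AE x in \<mu>0. h x < \<infinity>" "integrable \<mu>0 (\<lambda>x. real_of_ereal (\<phi> x))"
  shows
    "(\<forall>T\<ge>1. \<forall>B\<ge>1.
       integrable (\<Omega> T B) (\<lambda>\<omega>. S (out B \<omega>)) \<and>
       (\<integral>\<omega>. S (out B \<omega>) \<partial>(\<Omega> T B))
         \<le> sqrt (2 * c * G) * real d powr (1/4) / sqrt (real T * \<delta>) * sqrt (\<Delta> + 2 * \<delta> * G)
           + 16 * G * sqrt (real d) / sqrt (real B)) \<and>
     (\<forall>\<epsilon>>0. \<forall>T B. T = hyper_T c G d \<delta> \<epsilon> \<Delta> \<and> B = hyper_B G d \<epsilon> \<longrightarrow>
       (\<forall>x. gradient F\<delta> x \<in> goldstein_subdiff \<delta> F x) \<and>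
       integrable (\<Omega> T B) (\<lambda>\<omega>. S (out B \<omega>)) \<and>
       (\<integral>\<omega>. S (out B \<omega>) \<partial>(\<Omega> T B)) \<le> \<epsilon> \<and>
       (\<integral>\<^sup>+\<omega>. pgs_residual F h \<gamma> \<delta> (out B \<omega>) \<partial>(\<Omega> T B)) \<le> ennreal \<epsilon> \<and>
       (\<exists>A \<in> sets (\<Omega> T B). measure (\<Omega> T B) A > 0 \<and> (\<forall>\<omega>\<in>A. PGSP F h \<gamma> \<delta> \<epsilon> (out B \<omega>))) \<and>
       (\<forall>x0 w. fevals (zo_pgd f h \<gamma> \<delta> B x0 w T) \<le> 2 * T * B \<and>
               prox_updates (zo_pgd f h \<gamma> \<delta> B x0 w T) = T)) \<and>
     (\<forall>D.
       (\<lambda>(G, d, \<delta>, \<epsilon>, \<Delta>). real (hyper_T c G d \<delta> \<epsilon> \<Delta>)) \<in> O[principal (regime D)](\<lambda>(G, d, \<delta>, \<epsilon>, \<Delta>). G * real d powr (1/2) / (\<delta> * \<epsilon>^2)) \<and>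
       (\<lambda>(G, d, \<delta>, \<epsilon>, \<Delta>). real (hyper_B G d \<epsilon>)) \<in> O[principal (regime D)](\<lambda>(G, d, \<delta>, \<epsilon>, \<Delta>). G^2 * real d / \<epsilon>^2) \<and>
       (\<lambda>(G, d, \<delta>, \<epsilon>, \<Delta>). real (2 * hyper_T c G d \<delta> \<epsilon> \<Delta> * hyper_B G d \<epsilon>)) \<in> O[principal (regime D)](\<lambda>(G, d, \<delta>, \<epsilon>, \<Delta>). G^3 * real d powr (3/2) / (\<delta> * \<epsilon>^4)))"
proof -
  have sphere_case: False if "\<nu> = unif_sphere"
    using c not_smoothing_constant_unif_sphere that by blast
  then have \<nu>: "\<nu> = unif_ball" using nu by blast
  have c0: "c > 0" using c by (simp add: smoothing_constant_def)
  have d0: "d > 0" by (simp add: d_def)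
  have \<gamma>0: "\<gamma> > 0" using c0 d0 A1_sq(4) delta by (simp add: \<gamma>_def)
  have sl: "stochastic_lipschitz P f L G F"
  proof (rule stochastic_lipschitz.intro)
    show "(L \<xi>)-lipschitz_on UNIV (f \<xi>)" if "\<xi> \<in> space P" for \<xi> using A1_lip[OF that] by (rule conjunct2)
    show "F = (\<lambda>x. \<integral>\<xi>. f \<xi> x \<partial>P)" unfolding F_def ..
  qed (fact P f_int A1_sq)+
  interpret stochastic_lipschitz P f L G F by (rule sl)
  note F_lip = F_lipschitz
  have grad: "gradient F\<delta> = sphere_grad \<delta> F"
    unfolding F\<delta>_def \<nu> by (rule gradient_smoothing_unif_ball[OF F_lip delta])
  have smooth: "(1 / \<gamma>)-lipschitz_on UNIV (sphere_grad \<delta> F)"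
  proof -
    have "(c * G * sqrt (real DIM('a)) / \<delta>)-lipschitz_on UNIV (gradient (smoothing \<nu> \<delta> F))"
      using c A1_sq(4) delta F_lip unfolding smoothing_constant_def by blast
    then show ?thesis using grad by (simp add: \<gamma>_def d_def F\<delta>_def)
  qed
  obtain xh where "h xh < \<infinity>" using proper_closed_convexD(2)[OF A2] by blast
  then obtain ah where ah: "h xh = ereal ah" using proper_closed_convex_finite[OF A2] by blast
  have "\<phi>min \<le> \<phi> xh" unfolding \<phi>min_def by (rule INF_lower) simp
  then have "\<phi>min \<noteq> \<infinity>" by (auto simp: \<phi>_def ah)
  with phi_min obtain p where p: "\<phi>min = ereal p" by (cases \<phi>min) auto
  have p_le: "ereal p \<le> ereal (F x) + h x" for x
    using INF_lower[of x UNIV \<phi>] unfolding p[symmetric] \<phi>min_def \<phi>_def by simp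
  have run: "zo_run P f L G F h \<delta> \<gamma> \<mu>0 p T B" if "T \<ge> 1" "B \<ge> 1" for T B
  proof (rule zo_run.intro)
    show "zo_prox P f L G F h \<delta> \<gamma>"
      by (rule zo_prox.intro[OF sl zo_prox_axioms.intro[OF A2 delta \<gamma>0 smooth]])
    show "zo_run_axioms F h \<mu>0 p T B"
      by (rule zo_run_axioms.intro[OF x0(1-3) _ p_le that]) (use x0(4) in \<open>simp add: \<phi>_def\<close>)
  qed
  have S_eq: "norm (grad_map \<gamma> h x (sphere_grad \<delta> F x)) = S x" for x
    by (simp add: S_def grad)
  have \<Delta>_eq: "(\<integral>x. real_of_ereal (ereal (F x) + h x) \<partial>\<mu>0) - p = \<Delta>"
    by (simp add: \<Delta>_def p \<phi>_def)
  have gap: "\<Delta> + 2 * \<delta> * G > 0"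
  proof -
    interpret R: zo_run P f L G F h \<delta> \<gamma> \<mu>0 p 1 1 by (rule run) auto
    have "R.\<Delta> = \<Delta>" unfolding R.\<Delta>_def by (rule \<Delta>_eq)
    then have "\<Delta> \<ge> 0" using R.\<Delta>_nonneg by simp
    with delta A1_sq(4) show ?thesis by (simp add: add_nonneg_pos)
  qed
  have main: "integrable (\<Omega> T B) (\<lambda>\<omega>. S (out B \<omega>))" (is ?int)
    "(\<integral>\<omega>. S (out B \<omega>) \<partial>(\<Omega> T B)) \<le> sqrt (2 * (\<Delta> + 2 * \<delta> * G) / (\<gamma> * T)) + 16 * G * sqrt (real d) / sqrt (real B)" (is ?le)
    "(\<lambda>\<omega>. S (out B \<omega>)) \<in> borel_measurable (\<Omega> T B)" (is ?meas)
    "prob_space (\<Omega> T B)" (is ?prob)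
    if TB: "T \<ge> 1" "B \<ge> 1" for T B
  proof -
    interpret R: zo_run P f L G F h \<delta> \<gamma> \<mu>0 p T B by (rule run[OF TB])
    have S: "R.S = S" by (rule ext) (simp add: R.S_def S_eq)
    have D: "R.\<Delta> = \<Delta>" unfolding R.\<Delta>_def by (rule \<Delta>_eq)
    show ?int ?prob unfolding \<Omega>_def out_def using R.S_out(1) R.prob_space_\<Omega> by (simp_all only: S)
    show ?meas unfolding \<Omega>_def out_def S[symmetric] by (rule measurable_compose[OF R.out_meas R.S_meas])
    show ?le
      using R.S_out(2) R.\<sigma>2_bound unfolding S D \<Omega>_def out_def d_def by linarith
  qed
  have part1: "integrable (\<Omega> T B) (\<lambda>\<omega>. S (out B \<omega>)) \<and>
       (\<integral>\<omega>. S (out B \<omega>) \<partial>(\<Omega> T B))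
         \<le> sqrt (2 * c * G) * real d powr (1/4) / sqrt (real T * \<delta>) * sqrt (\<Delta> + 2 * \<delta> * G)
           + 16 * G * sqrt (real d) / sqrt (real B)" if TB: "T \<ge> 1" "B \<ge> 1" for T B
    using main(1,2)[OF TB] rate_eq[OF c0 A1_sq(4) delta d0, of T "\<Delta> + 2 * \<delta> * G"] TB(1)
    by (simp add: \<gamma>_def)
  have goldstein: "gradient F\<delta> x \<in> goldstein_subdiff \<delta> F x" for x
    unfolding F\<delta>_def \<nu> by (rule gradient_smoothing_in_goldstein[OF F_lip delta])
  have part2: "integrable (\<Omega> T B) (\<lambda>\<omega>. S (out B \<omega>)) \<and>
       (\<integral>\<omega>. S (out B \<omega>) \<partial>(\<Omega> T B)) \<le> \<epsilon> \<and>
       (\<integral>\<^sup>+\<omega>. pgs_residual F h \<gamma> \<delta> (out B \<omega>) \<partial>(\<Omega> T B)) \<le> ennreal \<epsilon> \<and>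
       (\<exists>A \<in> sets (\<Omega> T B). measure (\<Omega> T B) A > 0 \<and> (\<forall>\<omega>\<in>A. PGSP F h \<gamma> \<delta> \<epsilon> (out B \<omega>)))"
    if \<epsilon>: "\<epsilon> > 0" and T: "T = hyper_T c G d \<delta> \<epsilon> \<Delta>" and B: "B = hyper_B G d \<epsilon>" for \<epsilon> T B
  proof -
    define D where "D = \<Delta> + 2 * \<delta> * G"
    define x where "x = 8 * c * G * sqrt (real d) / (\<delta> * \<epsilon>\<^sup>2) * D"
    define y where "y = 1024 * real d * G\<^sup>2 / \<epsilon>\<^sup>2"
    have x: "x > 0" unfolding x_def D_def using c0 A1_sq(4) d0 delta \<epsilon> gap by simp
    have y: "y > 0" unfolding y_def using A1_sq(4) d0 \<epsilon> by simp
    have Tx: "T \<ge> 1" "real T \<ge> x" using x unfolding T hyper_T_def x_def D_def by linarith+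
    have By: "B \<ge> 1" "real B \<ge> y" using y unfolding B hyper_B_def y_def by linarith+
    have "sqrt (2 * D / (\<gamma> * T)) \<le> \<epsilon> / 2"
    proof (rule real_le_lsqrt)
      have "8 * D = \<epsilon>\<^sup>2 * \<gamma> * x" using c0 A1_sq(4) d0 delta \<epsilon> by (simp add: x_def \<gamma>_def field_simps)
      also have "\<dots> \<le> \<epsilon>\<^sup>2 * \<gamma> * T" using Tx(2) \<gamma>0 by (intro mult_left_mono) auto
      finally show "2 * D / (\<gamma> * T) \<le> (\<epsilon> / 2)\<^sup>2"
        using \<gamma>0 Tx(1) by (simp add: pos_divide_le_eq power_divide mult_ac)
    qed (use \<epsilon> in simp)
    moreover have "16 * G * sqrt (real d) / sqrt (real B) \<le> \<epsilon> / 2"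
    proof -
      have "sqrt y = 32 * G * sqrt (real d) / \<epsilon>"
        using A1_sq(4) \<epsilon> real_sqrt_mult[of "32\<^sup>2" "real d * G\<^sup>2"] by (simp add: y_def real_sqrt_mult real_sqrt_divide)
      then have "32 * G * sqrt (real d) / \<epsilon> \<le> sqrt (real B)" using By(2) real_sqrt_le_mono by metis
      then have "16 * G * sqrt (real d) \<le> \<epsilon> / 2 * sqrt (real B)" using \<epsilon> by (simp add: divide_le_eq mult_ac)
      then show ?thesis using By(1) by (simp add: divide_le_eq)
    qed
    ultimately have le: "(\<integral>\<omega>. S (out B \<omega>) \<partial>(\<Omega> T B)) \<le> \<epsilon>"
      using main(2)[OF Tx(1) By(1)] unfolding D_def by linarith
    note int = main(1)[OF Tx(1) By(1)] and meas = main(3)[OF Tx(1) By(1)]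
    interpret \<Omega>: prob_space "\<Omega> T B" by (rule main(4)[OF Tx(1) By(1)])
    have "(\<integral>\<^sup>+\<omega>. pgs_residual F h \<gamma> \<delta> (out B \<omega>) \<partial>(\<Omega> T B)) \<le> (\<integral>\<^sup>+\<omega>. ennreal (S (out B \<omega>)) \<partial>(\<Omega> T B))"
    proof (rule nn_integral_mono)
      fix \<omega> show "pgs_residual F h \<gamma> \<delta> (out B \<omega>) \<le> ennreal (S (out B \<omega>))"
        unfolding pgs_residual_def S_def by (rule INF_lower[OF goldstein])
    qed
    also have "\<dots> = ennreal (\<integral>\<omega>. S (out B \<omega>) \<partial>(\<Omega> T B))"
      by (rule nn_integral_eq_integral[OF int]) (simp add: S_def)
    also have "\<dots> \<le> ennreal \<epsilon>" using le by (rule ennreal_leI)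
    finally have res: "(\<integral>\<^sup>+\<omega>. pgs_residual F h \<gamma> \<delta> (out B \<omega>) \<partial>(\<Omega> T B)) \<le> ennreal \<epsilon>" .
    define A where "A = {\<omega> \<in> space (\<Omega> T B). S (out B \<omega>) \<le> \<epsilon>}"
    have "A = (\<lambda>\<omega>. S (out B \<omega>)) -` {..\<epsilon>} \<inter> space (\<Omega> T B)" unfolding A_def by blast
    then have "A \<in> sets (\<Omega> T B)" using measurable_sets[OF meas, of "{..\<epsilon>}"] by simp
    moreover have "measure (\<Omega> T B) A > 0" unfolding A_def by (rule \<Omega>.prob_le_expectation_pos[OF int le])
    moreover have "\<forall>\<omega>\<in>A. PGSP F h \<gamma> \<delta> \<epsilon> (out B \<omega>)"
      unfolding PGSP_def
    proof
      fix \<omega> assume "\<omega> \<in> A"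
      then have "norm (grad_map \<gamma> h (out B \<omega>) (gradient F\<delta> (out B \<omega>))) \<le> \<epsilon>" by (simp add: A_def S_def)
      then show "\<exists>g\<in>goldstein_subdiff \<delta> F (out B \<omega>). norm (grad_map \<gamma> h (out B \<omega>) g) \<le> \<epsilon>"
        by (rule bexI[OF _ goldstein])
    qed
    ultimately have "\<exists>A \<in> sets (\<Omega> T B). measure (\<Omega> T B) A > 0 \<and> (\<forall>\<omega>\<in>A. PGSP F h \<gamma> \<delta> \<epsilon> (out B \<omega>))"
      by (intro bexI[of _ A] conjI)
    with int le res show ?thesis by (intro conjI)
  qed
  have costs: "fevals (zo_pgd f h \<gamma> \<delta> B x0 w T) \<le> 2 * T * B" "prox_updates (zo_pgd f h \<gamma> \<delta> B x0 w T) = T" for B x0 w T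
    by (simp_all add: cost_zo_pgd)
  show ?thesis
  proof (rule conjI[OF _ conjI])
    show "\<forall>T\<ge>1. \<forall>B\<ge>1. integrable (\<Omega> T B) (\<lambda>\<omega>. S (out B \<omega>)) \<and>
       (\<integral>\<omega>. S (out B \<omega>) \<partial>(\<Omega> T B))
         \<le> sqrt (2 * c * G) * real d powr (1/4) / sqrt (real T * \<delta>) * sqrt (\<Delta> + 2 * \<delta> * G)
           + 16 * G * sqrt (real d) / sqrt (real B)"
      by (intro allI impI part1)
    show "\<forall>\<epsilon>>0. \<forall>T B. T = hyper_T c G d \<delta> \<epsilon> \<Delta> \<and> B = hyper_B G d \<epsilon> \<longrightarrow>
       (\<forall>x. gradient F\<delta> x \<in> goldstein_subdiff \<delta> F x) \<and>
       integrable (\<Omega> T B) (\<lambda>\<omega>. S (out B \<omega>)) \<and>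
       (\<integral>\<omega>. S (out B \<omega>) \<partial>(\<Omega> T B)) \<le> \<epsilon> \<and>
       (\<integral>\<^sup>+\<omega>. pgs_residual F h \<gamma> \<delta> (out B \<omega>) \<partial>(\<Omega> T B)) \<le> ennreal \<epsilon> \<and>
       (\<exists>A \<in> sets (\<Omega> T B). measure (\<Omega> T B) A > 0 \<and> (\<forall>\<omega>\<in>A. PGSP F h \<gamma> \<delta> \<epsilon> (out B \<omega>))) \<and>
       (\<forall>x0 w. fevals (zo_pgd f h \<gamma> \<delta> B x0 w T) \<le> 2 * T * B \<and>
               prox_updates (zo_pgd f h \<gamma> \<delta> B x0 w T) = T)"
    proof (intro allI impI, elim conjE)
      fix \<epsilon> :: real and T B
      assume "\<epsilon> > 0" "T = hyper_T c G d \<delta> \<epsilon> \<Delta>" "B = hyper_B G d \<epsilon>"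
      note p2 = part2[OF this]
      show "(\<forall>x. gradient F\<delta> x \<in> goldstein_subdiff \<delta> F x) \<and>
       integrable (\<Omega> T B) (\<lambda>\<omega>. S (out B \<omega>)) \<and>
       (\<integral>\<omega>. S (out B \<omega>) \<partial>(\<Omega> T B)) \<le> \<epsilon> \<and>
       (\<integral>\<^sup>+\<omega>. pgs_residual F h \<gamma> \<delta> (out B \<omega>) \<partial>(\<Omega> T B)) \<le> ennreal \<epsilon> \<and>
       (\<exists>A \<in> sets (\<Omega> T B). measure (\<Omega> T B) A > 0 \<and> (\<forall>\<omega>\<in>A. PGSP F h \<gamma> \<delta> \<epsilon> (out B \<omega>))) \<and>
       (\<forall>x0 w. fevals (zo_pgd f h \<gamma> \<delta> B x0 w T) \<le> 2 * T * B \<and>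
               prox_updates (zo_pgd f h \<gamma> \<delta> B x0 w T) = T)"
        by (intro conjI allI goldstein costs
            p2[THEN conjunct1] p2[THEN conjunct2, THEN conjunct1]
            p2[THEN conjunct2, THEN conjunct2, THEN conjunct1]
            p2[THEN conjunct2, THEN conjunct2, THEN conjunct2])
    qed
  qed (intro allI conjI hyper_T_bigo[OF c0] hyper_B_bigo hyper_evals_bigo[OF c0])
qed

end
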